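(* Let $\mathcal{R}=\mathbb{C}[\partial]A\oplus\mathbb{C}[\partial]B$ be a solvable rank two Lie conformal algebra with structure polynomials $p(\lambda)$, $Q_1(\partial,\lambda)$. Consider extensions of nontrivial finite irreducible $\mathcal{R}$-modules of the form $$0\longrightarrow V_{\phi_A,\phi_B}\longrightarrow E\longrightarrow V_{\bar\phi_A,\bar\phi_B}\longrightarrow0 ,\qquad(\ast)$$ where $V_{\phi_A,\phi_B}=\mathbb{C}[\partial]v$, $V_{\bar\phi_A,\bar\phi_B}=\mathbb{C}[\partial]\bar v$. Every such $E$ is, as a $\mathbb{C}[\partial]$-module, $\mathbb{C}[\partial]v\oplus\mathbb{C}[\partial]\bar v$ with $$A_\lambda v=\phi_A(\lambda)v,\quad B_\lambda v=\phi_B(\lambda)v,\quad A_\lambda\bar v=\bar\phi_A(\lambda)\bar v+f(\partial,\lambda)v,\quad B_\lambda\bar v=\bar\phi_B(\lambda)\bar v+g(\partial,\lambda)v\qquad(\ast\ast)$$ for some $f,g\in\mathbb{C}[\partial,\lambda]$. Nontrivial extensions of the form $(\ast)$ always exist (i.e. for every such $\mathcal{R}$, for suitable modules). Moreover, they are given (up to equivalence) by $(\ast\ast)$ with the following data: (1) In the case $p(\lambda)=Q_1(\partial,\lambda)=0$: (i) $\phi_A=\bar\phi_A=0$, $\phi_B=\bar\phi_B\neq0$, and $f(\partial,\lambda)=s(\lambda)$, $g(\partial,\lambda)=t(\lambda)$, where $s,t$ are polynomials and either $s\neq0$ or $t(\lambda)$ is not a scalar multiple of $\lambda\phi_B(\lambda)$;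 (ii) $\phi_A=\bar\phi_A\neq0$, $\phi_B=\bar\phi_B=0$, and $f(\partial,\lambda)=s(\lambda)$, $g(\partial,\lambda)=t(\lambda)$, where $s,t$ are polynomials and either $t\neq0$ or $s(\lambda)$ is not a scalar multiple of $\lambda\phi_A(\lambda)$; (iii) $\phi_A=\bar\phi_A\neq0$, $\phi_B=\bar\phi_B\neq0$, and $f(\partial,\lambda)=s(\lambda)$, $g(\partial,\lambda)=t(\lambda)$, where $s,t$ are polynomials such that $s(\lambda),t(\lambda)$ are not the same scalar multiple of $\lambda\phi_A(\lambda),\lambda\phi_B(\lambda)$ respectively. (2) In the case $p(\lambda)=0$, $Q_1(\partial,\lambda)\neq0$ (where always $\phi_B=\bar\phi_B=0$): (i) $\phi_A=\bar\phi_A\neq0$, $g(\partial,\lambda)=0$, and $f(\partial,\lambda)=s(\lambda)$, where the polynomial $s(\lambda)$ is not a scalar multiple of $\lambda\phi_A(\lambda)$; (ii) $\phi_A=\bar\phi_A\neq0$, $g(\partial,\lambda)=t(\lambda)\neq0$, where $t$ is such that the matrix $M=(q_{ij})_{i,j\ge0}$ of coefficients of $Q_1(-\lambda-\mu,\lambda)\,t(\lambda+\mu)=\sum_{i,j}q_{ij}\lambda^i\mu^j$ has rank $2$, and such that for $i_0<j_0$ with $q_{i_0,j_0}\neq0$, $$\lambda\phi_A(\lambda)=\frac{a_{i_0-1}}{q_{i_0,j_0}}\sum_kq_{k,j_0}\lambda^k-\frac{a_{j_0-1}}{q_{i_0,j_0}}\sum_kq_{k,i_0}\lambda^k ,$$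 where $a_{i_0-1},a_{j_0-1}$, the coefficients of $\lambda^{i_0-1},\lambda^{j_0-1}$ in $\phi_A$ (with $a_{-1}:=0$), are not both $0$; and then $$f(\partial,\lambda)=\begin{cases}-\frac1{a_{i_0-1}}\Big(\sum_kq_{k,i_0}\lambda^k\Big)\partial+s(\lambda),&\text{if }a_{i_0-1}\neq0,\\[4pt]-\frac1{a_{j_0-1}}\Big(\sum_kq_{k,j_0}\lambda^k\Big)\partial+s(\lambda),&\text{if }a_{i_0-1}=0,\end{cases}$$ where $s$ is a polynomial. (3) In the case $p(\lambda)\neq0$, $Q_1(\partial,\lambda)=0$ (where $\phi_B=\bar\phi_B=0$): (i) $\phi_A=\bar\phi_A\neq0$, $f(\partial,\lambda)=s(\lambda)$, $g(\partial,\lambda)=0$, where the polynomial $s(\lambda)$ is not a scalar multiple of $\lambda\phi_A(\lambda)$; (ii) $\phi_A\neq\bar\phi_A$, $f(\partial,\lambda)=0$, $\phi_A(\lambda)-\bar\phi_A(\lambda)=p(\lambda)$, and $$g(\partial,\lambda)=\begin{cases}k_1\big(\partial+\frac1r\lambda\big)+k_2,&p(\lambda)=r\phi_A(\lambda)\text{ with }r\in\mathbb{C},\ r\neq1,\\k_1,&p(\lambda)\text{ is not a scalar multiple of }\phi_A(\lambda),\end{cases}$$ where $k_1,k_2\in\mathbb{C}$ and $g(\partial,\lambda)\neq0$. The space $\mathrm{Ext}(V_{\bar\phi_A,\bar\phi_B},V_{\phi_A,\phi_B})$ is infinite-dimensional in each of the subcases (1)(i), (1)(ii), (1)(iii), (2)(i),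 (2)(ii) and (3)(i), but not in subcase (3)(ii).
   Context: Everything is over $\mathbb{C}$. A Lie conformal algebra $\mathcal{R}$ is a $\mathbb{C}[\partial]$-module with a $\mathbb{C}$-linear $\lambda$-bracket $\mathcal{R}\otimes\mathcal{R}\to\mathcal{R}[\lambda]$, $a\otimes b\mapsto[a_\lambda b]$, satisfying $[\partial a_\lambda b]=-\lambda[a_\lambda b]$, $[a_\lambda\partial b]=(\partial+\lambda)[a_\lambda b]$, $[a_\lambda b]=-[b_{-\lambda-\partial}a]$ and $[a_\lambda[b_\mu c]]=[[a_\lambda b]_{\lambda+\mu}c]+[b_\mu[a_\lambda c]]$. A conformal $\mathcal{R}$-module $V$ is a $\mathbb{C}[\partial]$-module with a $\mathbb{C}$-linear map $\mathcal{R}\otimes V\to V[\lambda]$, $a\otimes v\mapsto a_\lambda v$, satisfying $(\partial a)_\lambda v=-\lambda(a_\lambda v)$, $a_\lambda(\partial v)=(\partial+\lambda)a_\lambda v$, $a_\lambda(b_\mu v)=[a_\lambda b]_{\lambda+\mu}v+b_\mu(a_\lambda v)$. An extension of $W$ by $V$ is an exact sequence of modules $0\to V\to E\to W\to0$. Two extensions $E,E'$ are equivalent if there is a module homomorphism $E\to E'$ compatible with the identity maps of $V$ and $W$. An extension is trivial if it is equivalent to $V\oplus W$. $\mathrm{Ext}(W,V)$ is the vector space of extension cocycles modulo those equivalent to the trivial extension. A solvable rank two Lie conformal algebra (free of rank two over $\mathbb{C}[\partial]$) has a basis $\{A,B\}$, which is fixed, such that $[A_\lambda A]=Q_1(\partial,\lambda)B$,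 $[A_\lambda B]=p(\lambda)B$, $[B_\lambda B]=0$, where $p(\lambda)$ is a polynomial and $Q_1$ is a skew-symmetric polynomial, i.e. $Q_1(\partial,\lambda)=-Q_1(\partial,-\lambda-\partial)$, with $p(\lambda)Q_1(\partial,\lambda)=0$. Its nontrivial finite irreducible modules are $V_{\phi_A,\phi_B}=\mathbb{C}[\partial]v$ (free of rank one), $A_\lambda v=\phi_A(\lambda)v$, $B_\lambda v=\phi_B(\lambda)v$, where $\phi_A,\phi_B\in\mathbb{C}[\lambda]$ are not both zero, and $\phi_B\neq0$ only if $p=Q_1=0$. *)

theory Defs
  imports "HOL-Computational_Algebra.Polynomial" "HOL-Library.Product_Plus"
begin

section \<open>Conventions on polynomials\<close>

text \<open>
  A \<open>\<complex>[\<partial>]\<close>-module is a library \<open>module\<close> over the ring \<open>complex poly\<close>; the indeterminate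
  \<open>[:0, 1:]\<close> is \<open>\<partial>\<close> and \<open>[:c:]\<close> is the scalar \<open>c\<close>.
  The space \<open>M[\<lambda>]\<close> is \<open>'m poly\<close>.
  A polynomial of \<open>\<complex>[\<partial>,\<lambda>]\<close> has type \<open>complex poly poly\<close>, where the outer indeterminate is \<open>\<lambda>\<close>
  and the coefficients lie in \<open>\<complex>[\<partial>]\<close>.
\<close>

definition in_lam :: "complex poly \<Rightarrow> complex poly poly" where
  "in_lam s = map_poly (\<lambda>c. [:c:]) s"

text \<open>\<open>times_vec sM f m\<close> is \<open>f(\<partial>,\<lambda>) m \<in> M[\<lambda>]\<close>.\<close>

definition times_vec ::
    "(complex poly \<Rightarrow> 'm \<Rightarrow> 'm) \<Rightarrow> complex poly poly \<Rightarrow> 'm::zero \<Rightarrow> 'm poly" where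
  "times_vec sM f m = map_poly (\<lambda>q. sM q m) f"

text \<open>
  Substitution of \<open>q \<in> \<complex>[\<partial>]\<close> for \<open>\<lambda>\<close> in \<open>P \<in> M[\<lambda>]\<close>, the powers of \<open>q\<close> acting on the coefficients
  from the left.
\<close>

definition subst_lam ::
    "(complex poly \<Rightarrow> 'm \<Rightarrow> 'm) \<Rightarrow> 'm::comm_monoid_add poly \<Rightarrow> complex poly \<Rightarrow> 'm" where
  "subst_lam sM P q = (\<Sum>i\<le>degree P. sM (q ^ i) (coeff P i))"

section \<open>Lie conformal algebras and conformal modules\<close>

text \<open>
  The \<open>\<complex>[\<partial>]\<close>-scaling and the \<open>\<lambda>\<close>-action \<open>a \<mapsto> m \<mapsto> a\<^sub>\<lambda> m \<in> M[\<lambda>]\<close>. A Lie conformal algebra is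
  given by the same data with \<open>'m = 'r\<close>, its \<open>\<lambda>\<close>-bracket being \<open>cact\<close>.
\<close>

record (overloaded) ('r, 'm :: zero) cmod =
  cscale :: "complex poly \<Rightarrow> 'm \<Rightarrow> 'm"
  cact :: "'r \<Rightarrow> 'm \<Rightarrow> 'm poly"

text \<open>
  \<open>a\<^sub>\<lambda> m\<close> with a complex number \<open>l\<close> put for \<open>\<lambda>\<close>. As \<open>\<complex>\<close> is infinite, an identity in
  \<open>M[\<lambda>]\<close> or \<open>M[\<lambda>,\<mu>]\<close> holds iff it holds for all complex values of \<open>\<lambda>\<close> and \<open>\<mu>\<close>; the axioms
  below are written in this way.
\<close>

definition act_at :: "('r, 'm::ab_group_add) cmod \<Rightarrow> 'r \<Rightarrow> complex \<Rightarrow> 'm \<Rightarrow> 'm" where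
  "act_at M a l m = subst_lam (cscale M) (cact M a m) [:l:]"

definition conformal_action ::
    "('r::ab_group_add, 'r) cmod \<Rightarrow> ('r, 'm::ab_group_add) cmod \<Rightarrow> bool" where
  "conformal_action R M \<longleftrightarrow>
     module (cscale M) \<and>
     (\<forall>a b m. cact M (a + b) m = cact M a m + cact M b m) \<and>
     (\<forall>a m n. cact M a (m + n) = cact M a m + cact M a n) \<and>
     (\<forall>c a m. cact M (cscale R [:c:] a) m = map_poly (cscale M [:c:]) (cact M a m)) \<and>
     (\<forall>c a m. cact M a (cscale M [:c:] m) = map_poly (cscale M [:c:]) (cact M a m)) \<and>
     (\<forall>a m l. act_at M (cscale R [:0, 1:] a) l m = cscale M [:- l:] (act_at M a l m)) \<and>
     (\<forall>a m l. act_at M a l (cscale M [:0, 1:] m) = cscale M [:l, 1:] (act_at M a l m)) \<and>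
     (\<forall>a b m l k. act_at M a l (act_at M b k m) =
        act_at M (act_at R a l b) (l + k) m + act_at M b k (act_at M a l m))"

definition lie_conformal_algebra :: "('r::ab_group_add, 'r) cmod \<Rightarrow> bool" where
  "lie_conformal_algebra R \<longleftrightarrow>
     conformal_action R R \<and>
     (\<forall>a b l. act_at R a l b = - subst_lam (cscale R) (cact R b a) [:- l, - 1:])"

definition conformal_module ::
    "('r::ab_group_add, 'r) cmod \<Rightarrow> ('r, 'm::ab_group_add) cmod \<Rightarrow> bool" where
  "conformal_module R M \<longleftrightarrow> lie_conformal_algebra R \<and> conformal_action R M"

definition conformal_hom ::
    "('r, 'm::ab_group_add) cmod \<Rightarrow> ('r, 'n::ab_group_add) cmod \<Rightarrow> ('m \<Rightarrow> 'n) \<Rightarrow> bool" where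
  "conformal_hom M N h \<longleftrightarrow>
     module_hom (cscale M) (cscale N) h \<and> (\<forall>a m. cact N a (h m) = map_poly h (cact M a m))"

section \<open>Extensions\<close>

definition extension ::
    "('r::ab_group_add, 'r) cmod \<Rightarrow> ('r, 'v::ab_group_add) cmod \<Rightarrow> ('r, 'w::ab_group_add) cmod \<Rightarrow>
     ('r, 'e::ab_group_add) cmod \<Rightarrow> ('v \<Rightarrow> 'e) \<Rightarrow> ('e \<Rightarrow> 'w) \<Rightarrow> bool" where
  "extension R V W E \<iota> \<pi> \<longleftrightarrow>
     conformal_module R V \<and> conformal_module R W \<and> conformal_module R E \<and>
     conformal_hom V E \<iota> \<and> conformal_hom E W \<pi> \<and>
     inj \<iota> \<and> range \<iota> = {e. \<pi> e = 0} \<and> surj \<pi>"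

definition ext_equiv ::
    "('r, 'e::ab_group_add) cmod \<Rightarrow> ('v \<Rightarrow> 'e) \<Rightarrow> ('e \<Rightarrow> 'w) \<Rightarrow>
     ('r, 'f::ab_group_add) cmod \<Rightarrow> ('v \<Rightarrow> 'f) \<Rightarrow> ('f \<Rightarrow> 'w) \<Rightarrow> bool" where
  "ext_equiv E \<iota> \<pi> E' \<iota>' \<pi>' \<longleftrightarrow> (\<exists>h. conformal_hom E E' h \<and> h \<circ> \<iota> = \<iota>' \<and> \<pi>' \<circ> h = \<pi>)"

text \<open>
  The \<open>\<complex>[\<partial>]\<close>-module \<open>V \<oplus> W\<close> with \<open>a\<^sub>\<lambda>(v, w) = (a\<^sub>\<lambda> v + \<gamma>\<^sub>\<lambda>(a) w, a\<^sub>\<lambda> w)\<close>.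
\<close>

definition twisted_sum ::
    "('r, 'v::ab_group_add) cmod \<Rightarrow> ('r, 'w::ab_group_add) cmod \<Rightarrow> ('r \<Rightarrow> 'w \<Rightarrow> 'v poly) \<Rightarrow>
     ('r, 'v \<times> 'w) cmod" where
  "twisted_sum V W \<gamma> =
     \<lparr>cscale = (\<lambda>q (v, w). (cscale V q v, cscale W q w)),
      cact = (\<lambda>a (v, w). map_poly (\<lambda>x. (x, 0)) (cact V a v + \<gamma> a w)
                       + map_poly (\<lambda>y. (0, y)) (cact W a w))\<rparr>"

definition direct_sum ::
    "('r, 'v::ab_group_add) cmod \<Rightarrow> ('r, 'w::ab_group_add) cmod \<Rightarrow> ('r, 'v \<times> 'w) cmod" where
  "direct_sum V W = twisted_sum V W (\<lambda>_ _. 0)"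

definition trivial_ext ::
    "('r, 'v::ab_group_add) cmod \<Rightarrow> ('r, 'w::ab_group_add) cmod \<Rightarrow>
     ('r, 'e::ab_group_add) cmod \<Rightarrow> ('v \<Rightarrow> 'e) \<Rightarrow> ('e \<Rightarrow> 'w) \<Rightarrow> bool" where
  "trivial_ext V W E \<iota> \<pi> \<longleftrightarrow> ext_equiv E \<iota> \<pi> (direct_sum V W) (\<lambda>v. (v, 0)) snd"

text \<open>
  Every extension of \<open>W\<close> by \<open>V\<close> with \<open>W\<close> free over \<open>\<complex>[\<partial>]\<close> is \<open>V \<oplus> W\<close> as a \<open>\<complex>[\<partial>]\<close>-module, so its
  action differs from that of the direct sum by a cocycle \<open>\<gamma>\<close> with values in \<open>V[\<lambda>]\<close>.
\<close>

definition ext_cocycles ::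
    "('r::ab_group_add, 'r) cmod \<Rightarrow> ('r, 'v::ab_group_add) cmod \<Rightarrow> ('r, 'w::ab_group_add) cmod \<Rightarrow>
     ('r \<Rightarrow> 'w \<Rightarrow> 'v poly) set" where
  "ext_cocycles R V W = {\<gamma>. extension R V W (twisted_sum V W \<gamma>) (\<lambda>v. (v, 0)) snd}"

definition trivial_cocycles ::
    "('r::ab_group_add, 'r) cmod \<Rightarrow> ('r, 'v::ab_group_add) cmod \<Rightarrow> ('r, 'w::ab_group_add) cmod \<Rightarrow>
     ('r \<Rightarrow> 'w \<Rightarrow> 'v poly) set" where
  "trivial_cocycles R V W =
     {\<gamma> \<in> ext_cocycles R V W. trivial_ext V W (twisted_sum V W \<gamma>) (\<lambda>v. (v, 0)) snd}"

text \<open>\<open>Ext(W, V)\<close> as the set of cosets in the quotient space; note the order of the arguments.\<close>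

definition Ext_space ::
    "('r::ab_group_add, 'r) cmod \<Rightarrow> ('r, 'w::ab_group_add) cmod \<Rightarrow> ('r, 'v::ab_group_add) cmod \<Rightarrow>
     ('r \<Rightarrow> 'w \<Rightarrow> 'v poly) set set" where
  "Ext_space R W V = ext_cocycles R V W //
     {(\<gamma>, \<delta>). \<gamma> \<in> ext_cocycles R V W \<and> \<delta> \<in> ext_cocycles R V W \<and>
        (\<lambda>a w. \<gamma> a w - \<delta> a w) \<in> trivial_cocycles R V W}"

text \<open>
  Finitely many classes, given by representatives \<open>\<delta> \<in> F\<close>, span \<open>Ext(W, V)\<close> over \<open>\<complex>\<close>: a coset equals
  a linear combination of them iff it contains the same combination of the representatives.
\<close>

definition Ext_finite_dim ::
    "('r::ab_group_add, 'r) cmod \<Rightarrow> ('r, 'w::ab_group_add) cmod \<Rightarrow> ('r, 'v::ab_group_add) cmod \<Rightarrow> bool"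
  where
  "Ext_finite_dim R W V \<longleftrightarrow>
     (\<exists>F. finite F \<and> F \<subseteq> ext_cocycles R V W \<and>
        (\<forall>X \<in> Ext_space R W V. \<exists>c :: ('r \<Rightarrow> 'w \<Rightarrow> 'v poly) \<Rightarrow> complex.
           (\<lambda>a w. \<Sum>\<delta>\<in>F. map_poly (cscale V [:c \<delta>:]) (\<delta> a w)) \<in> X))"

section \<open>Solvable rank two Lie conformal algebras and their rank one modules\<close>

definition free_basis :: "(complex poly \<Rightarrow> 'm::ab_group_add \<Rightarrow> 'm) \<Rightarrow> 'm set \<Rightarrow> bool" where
  "free_basis sM S \<longleftrightarrow> \<not> module.dependent sM S \<and> module.span sM S = UNIV"

definition derived_part :: "('r::ab_group_add, 'r) cmod \<Rightarrow> 'r set \<Rightarrow> 'r set" where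
  "derived_part R S = module.span (cscale R) {coeff (cact R a b) i | a b i. a \<in> S \<and> b \<in> S}"

definition solvable_lca :: "('r::ab_group_add, 'r) cmod \<Rightarrow> bool" where
  "solvable_lca R \<longleftrightarrow> (\<exists>n. (derived_part R ^^ n) UNIV = {0})"

text \<open>
  A solvable rank two Lie conformal algebra together with a basis in normal form. Solvability also
  follows from the form of the brackets. The skew-symmetry is \<open>Q(\<partial>, \<lambda>) = - Q(\<partial>, - \<lambda> - \<partial>)\<close>.
\<close>

definition solvable_rank_two ::
    "('r::ab_group_add, 'r) cmod \<Rightarrow> 'r \<Rightarrow> 'r \<Rightarrow> complex poly \<Rightarrow> complex poly poly \<Rightarrow> bool" where
  "solvable_rank_two R A B p Q \<longleftrightarrow>
     lie_conformal_algebra R \<and> solvable_lca R \<and>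
     A \<noteq> B \<and> free_basis (cscale R) {A, B} \<and>
     cact R A A = times_vec (cscale R) Q B \<and>
     cact R A B = times_vec (cscale R) (in_lam p) B \<and>
     cact R B B = 0 \<and>
     Q = - pcompose Q [:[:0, - 1:], - 1:] \<and>
     in_lam p * Q = 0"

definition nontrivial_irreducible :: "('r, 'm::ab_group_add) cmod \<Rightarrow> bool" where
  "nontrivial_irreducible M \<longleftrightarrow>
     (\<exists>a m. cact M a m \<noteq> 0) \<and>
     (\<forall>S. module.subspace (cscale M) S \<and> (\<forall>a. \<forall>m\<in>S. \<forall>i. coeff (cact M a m) i \<in> S) \<longrightarrow>
        S = {0} \<or> S = UNIV)"

text \<open>
  The module \<open>V\<^bsub>\<phi>A,\<phi>B\<^esub> = \<complex>[\<partial>] v\<close>. Given the other clauses, \<open>nontrivial_irreducible\<close> and the last two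
  clauses on \<open>\<phi>A\<close>, \<open>\<phi>B\<close> express the same requirement.
\<close>

definition irreducible_rank_one ::
    "('r::ab_group_add, 'r) cmod \<Rightarrow> 'r \<Rightarrow> 'r \<Rightarrow> complex poly \<Rightarrow> complex poly poly \<Rightarrow>
     complex poly \<Rightarrow> complex poly \<Rightarrow> ('r, 'v::ab_group_add) cmod \<Rightarrow> 'v \<Rightarrow> bool" where
  "irreducible_rank_one R A B p Q \<phi>A \<phi>B V v \<longleftrightarrow>
     conformal_module R V \<and> nontrivial_irreducible V \<and>
     free_basis (cscale V) {v} \<and>
     cact V A v = times_vec (cscale V) (in_lam \<phi>A) v \<and>
     cact V B v = times_vec (cscale V) (in_lam \<phi>B) v \<and>
     (\<phi>A \<noteq> 0 \<or> \<phi>B \<noteq> 0) \<and>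
     (\<phi>B \<noteq> 0 \<longrightarrow> p = 0 \<and> Q = 0)"

text \<open>
  \<open>E\<close> is an extension of \<open>W = \<complex>[\<partial>] w\<close> by \<open>V = \<complex>[\<partial>] v\<close> which is \<open>\<complex>[\<partial>] v \<oplus> \<complex>[\<partial>] w\<close> with
  \<open>A\<^sub>\<lambda> v = \<phi>A(\<lambda>) v\<close>, \<open>B\<^sub>\<lambda> v = \<phi>B(\<lambda>) v\<close>, \<open>A\<^sub>\<lambda> w = \<psi>A(\<lambda>) w + f(\<partial>,\<lambda>) v\<close>, \<open>B\<^sub>\<lambda> w = \<psi>B(\<lambda>) w + g(\<partial>,\<lambda>) v\<close>;
  in \<open>E\<close> the generator \<open>v\<close> is \<open>\<iota> v\<close>, and \<open>w\<close> is some preimage \<open>u\<close> of \<open>w\<close> under \<open>\<pi>\<close>.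
\<close>

definition ext_of_form ::
    "('r::ab_group_add, 'r) cmod \<Rightarrow> 'r \<Rightarrow> 'r \<Rightarrow>
     complex poly \<Rightarrow> complex poly \<Rightarrow> complex poly \<Rightarrow> complex poly \<Rightarrow>
     ('r, 'v::ab_group_add) cmod \<Rightarrow> 'v \<Rightarrow> ('r, 'w::ab_group_add) cmod \<Rightarrow> 'w \<Rightarrow>
     ('r, 'e::ab_group_add) cmod \<Rightarrow> ('v \<Rightarrow> 'e) \<Rightarrow> ('e \<Rightarrow> 'w) \<Rightarrow>
     complex poly poly \<Rightarrow> complex poly poly \<Rightarrow> bool" where
  "ext_of_form R A B \<phi>A \<phi>B \<psi>A \<psi>B V v W w E \<iota> \<pi> f g \<longleftrightarrow>
     extension R V W E \<iota> \<pi> \<and>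
     (\<exists>u. \<pi> u = w \<and> \<iota> v \<noteq> u \<and> free_basis (cscale E) {\<iota> v, u} \<and>
        cact E A (\<iota> v) = times_vec (cscale E) (in_lam \<phi>A) (\<iota> v) \<and>
        cact E B (\<iota> v) = times_vec (cscale E) (in_lam \<phi>B) (\<iota> v) \<and>
        cact E A u = times_vec (cscale E) (in_lam \<psi>A) u + times_vec (cscale E) f (\<iota> v) \<and>
        cact E B u = times_vec (cscale E) (in_lam \<psi>B) u + times_vec (cscale E) g (\<iota> v))"

section \<open>The data describing the nontrivial extensions\<close>

text \<open>
  Here \<open>\<phi>A, \<phi>B\<close> belong to the submodule and \<open>\<psi>A, \<psi>B\<close> to the quotient module.
\<close>

definition data_1_i where
  "data_1_i p Q \<phi>A \<phi>B \<psi>A \<psi>B f g \<longleftrightarrow>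
     (p :: complex poly) = 0 \<and> (Q :: complex poly poly) = 0 \<and>
     (\<phi>A :: complex poly) = 0 \<and> (\<psi>A :: complex poly) = 0 \<and> \<phi>B = \<psi>B \<and> \<phi>B \<noteq> 0 \<and>
     (\<exists>s t. f = in_lam s \<and> g = in_lam t \<and> (s \<noteq> 0 \<or> (\<nexists>c. t = smult c ([:0, 1:] * \<phi>B))))"

definition data_1_ii where
  "data_1_ii p Q \<phi>A \<phi>B \<psi>A \<psi>B f g \<longleftrightarrow>
     (p :: complex poly) = 0 \<and> (Q :: complex poly poly) = 0 \<and>
     \<phi>A = \<psi>A \<and> \<phi>A \<noteq> 0 \<and> (\<phi>B :: complex poly) = 0 \<and> (\<psi>B :: complex poly) = 0 \<and>
     (\<exists>s t. f = in_lam s \<and> g = in_lam t \<and> (t \<noteq> 0 \<or> (\<nexists>c. s = smult c ([:0, 1:] * \<phi>A))))"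

definition data_1_iii where
  "data_1_iii p Q \<phi>A \<phi>B \<psi>A \<psi>B f g \<longleftrightarrow>
     (p :: complex poly) = 0 \<and> (Q :: complex poly poly) = 0 \<and>
     \<phi>A = \<psi>A \<and> \<phi>A \<noteq> 0 \<and> \<phi>B = \<psi>B \<and> \<phi>B \<noteq> 0 \<and>
     (\<exists>s t. f = in_lam s \<and> g = in_lam t \<and>
        (\<nexists>c. s = smult c ([:0, 1:] * \<phi>A) \<and> t = smult c ([:0, 1:] * \<phi>B)))"

definition data_2_i where
  "data_2_i p Q \<phi>A \<phi>B \<psi>A \<psi>B f g \<longleftrightarrow>
     (p :: complex poly) = 0 \<and> (Q :: complex poly poly) \<noteq> 0 \<and>
     (\<phi>B :: complex poly) = 0 \<and> (\<psi>B :: complex poly) = 0 \<and> \<phi>A = \<psi>A \<and> \<phi>A \<noteq> 0 \<and>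
     (g :: complex poly poly) = 0 \<and>
     (\<exists>s. f = in_lam s \<and> (\<nexists>c. s = smult c ([:0, 1:] * \<phi>A)))"

text \<open>
  The polynomial \<open>Q(- \<lambda> - \<mu>, \<lambda>) t(\<lambda> + \<mu>)\<close>, with outer indeterminate \<open>\<mu>\<close> and inner indeterminate \<open>\<lambda>\<close>.
\<close>

definition structure_poly2 :: "complex poly poly \<Rightarrow> complex poly \<Rightarrow> complex poly poly" where
  "structure_poly2 Q t =
     poly (map_poly (\<lambda>q. pcompose (in_lam q) [:[:0, - 1:], - 1:]) Q) [:[:0, 1:]:] *
     pcompose (in_lam t) [:[:0, 1:], 1:]"

text \<open>The \<open>j\<close>-th column \<open>\<Sum>\<^sub>k q\<^sub>k\<^sub>j \<lambda>\<^sup>k\<close> of \<open>M = (q\<^sub>i\<^sub>j)\<close> and the entry \<open>q\<^sub>i\<^sub>j\<close>.\<close>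

definition M_col :: "complex poly poly \<Rightarrow> complex poly \<Rightarrow> nat \<Rightarrow> complex poly" where
  "M_col Q t j = coeff (structure_poly2 Q t) j"

definition M_entry :: "complex poly poly \<Rightarrow> complex poly \<Rightarrow> nat \<Rightarrow> nat \<Rightarrow> complex" where
  "M_entry Q t i j = coeff (M_col Q t j) i"

text \<open>\<open>M\<close> has finitely many nonzero entries; its rank is the dimension of its column space.\<close>

definition M_rank :: "complex poly poly \<Rightarrow> complex poly \<Rightarrow> nat" where
  "M_rank Q t = vector_space.dim (smult :: complex \<Rightarrow> complex poly \<Rightarrow> complex poly) (range (M_col Q t))"

definition coeff_pred :: "complex poly \<Rightarrow> nat \<Rightarrow> complex" where
  "coeff_pred \<phi> i = (if i = 0 then 0 else coeff \<phi> (i - 1))"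

definition data_2_ii where
  "data_2_ii i0 j0 p Q \<phi>A \<phi>B \<psi>A \<psi>B f g \<longleftrightarrow>
     (p :: complex poly) = 0 \<and> (Q :: complex poly poly) \<noteq> 0 \<and>
     (\<phi>B :: complex poly) = 0 \<and> (\<psi>B :: complex poly) = 0 \<and> \<phi>A = \<psi>A \<and> \<phi>A \<noteq> 0 \<and>
     (\<exists>s t. t \<noteq> 0 \<and> g = in_lam t \<and>
        M_rank Q t = 2 \<and> i0 < j0 \<and> M_entry Q t i0 j0 \<noteq> 0 \<and>
        [:0, 1:] * \<phi>A =
          smult (coeff_pred \<phi>A i0 / M_entry Q t i0 j0) (M_col Q t j0)
          - smult (coeff_pred \<phi>A j0 / M_entry Q t i0 j0) (M_col Q t i0) \<and>
        (coeff_pred \<phi>A i0 \<noteq> 0 \<or> coeff_pred \<phi>A j0 \<noteq> 0) \<and>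
        f = (if coeff_pred \<phi>A i0 \<noteq> 0
             then in_lam (smult (- 1 / coeff_pred \<phi>A i0) (M_col Q t i0)) * [:[:0, 1:]:] + in_lam s
             else in_lam (smult (- 1 / coeff_pred \<phi>A j0) (M_col Q t j0)) * [:[:0, 1:]:] + in_lam s))"

definition data_3_i where
  "data_3_i p Q \<phi>A \<phi>B \<psi>A \<psi>B f g \<longleftrightarrow>
     (p :: complex poly) \<noteq> 0 \<and> (Q :: complex poly poly) = 0 \<and>
     (\<phi>B :: complex poly) = 0 \<and> (\<psi>B :: complex poly) = 0 \<and> \<phi>A = \<psi>A \<and> \<phi>A \<noteq> 0 \<and>
     (g :: complex poly poly) = 0 \<and>
     (\<exists>s. f = in_lam s \<and> (\<nexists>c. s = smult c ([:0, 1:] * \<phi>A)))"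

definition data_3_ii where
  "data_3_ii p Q \<phi>A \<phi>B \<psi>A \<psi>B f g \<longleftrightarrow>
     (p :: complex poly) \<noteq> 0 \<and> (Q :: complex poly poly) = 0 \<and>
     (\<phi>B :: complex poly) = 0 \<and> (\<psi>B :: complex poly) = 0 \<and> \<phi>A \<noteq> \<psi>A \<and>
     (f :: complex poly poly) = 0 \<and> \<phi>A - \<psi>A = p \<and> g \<noteq> 0 \<and>
     ((\<exists>r k1 k2. p = smult r \<phi>A \<and> r \<noteq> 1 \<and> g = [:[:k2, k1:], [:k1 / r:]:]) \<or>
      (\<exists>k1. (\<nexists>r. p = smult r \<phi>A) \<and> g = [:[:k1:]:]))"

end

theory Submission
  imports Defs
begin

text \<open>
  Let \<open>u\<close> be a lift to \<open>E\<close> of the generator \<open>w\<close> of the quotient. The action of the generators \<open>A\<close>, \<open>B\<close> on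
  \<open>u\<close> is a pair of polynomials \<open>(f, g)\<close>, the module axiom on \<open>u\<close> is a system of three functional equations
  for \<open>(f, g)\<close>, and replacing \<open>u\<close> by \<open>u + h(\<partial>) v\<close> subtracts from \<open>(f, g)\<close> the coboundary
  \<open>\<psi>(\<lambda>) h(\<partial>) - \<phi>(\<lambda>) h(\<partial> + \<lambda>)\<close>. Extensions up to equivalence are therefore the solutions of the three
  equations modulo coboundaries (\<open>form_cocycle\<close>, \<open>cocycle_sum_form\<close>, \<open>ext_equiv_iff\<close>), and what remains is a
  problem about polynomials.

  The main device is to freeze one parameter. For a fixed value \<open>c\<close> of \<open>\<lambda>\<close> the coboundary is the operator
  \<open>h \<mapsto> \<psi>(c) h(\<partial>) - \<phi>(c) h(\<partial> + c)\<close> on \<open>\<complex>[\<partial>]\<close>, called \<open>twist\<close>. If \<open>c \<noteq> 0\<close> and \<open>\<phi>(c)\<close>, \<open>\<psi>(c)\<close> are not both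
  \<open>0\<close>, it is onto (\<open>twist_surj\<close>) and its kernel consists of constants, and it is injective if
  \<open>\<phi>(c) \<noteq> \<psi>(c)\<close>. So a suitable coboundary makes one component of the cocycle vanish at \<open>\<lambda> = c\<close>, and the
  equations with one parameter equal to \<open>c\<close> say that the same operator kills all the other values, up to
  the inhomogeneous term that comes from the bracket.

  If \<open>p = Q = 0\<close> there is no inhomogeneous term: every cocycle is a coboundary unless the two modules are
  equal, and then \<open>f\<close> and \<open>g\<close> can be made independent of \<open>\<partial>\<close> (\<open>cocycle_abelian\<close>).

  If \<open>Q \<noteq> 0\<close>, then \<open>B\<close> acts by zero on both modules, and the equation for \<open>g\<close> leaves two possibilities. Either
  \<open>g = 0\<close>, and \<open>f\<close> is treated as in the abelian case, or the modules are equal and \<open>g = t(\<lambda>)\<close>. Then the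
  inhomogeneous term does not involve \<open>\<partial>\<close>, and so \<open>f = \<alpha>(\<lambda>) \<partial> + s(\<lambda>)\<close> up to coboundaries. The equation becomes \<open>Q(-\<lambda>-\<mu>, \<lambda>) t(\<lambda>+\<mu>) = X(\<lambda>) \<alpha>(\<mu>) - \<alpha>(\<lambda>) X(\<mu>)\<close> with \<open>X = \<lambda> \<phi>\<^sub>A\<close>. It says that the
  coefficient matrix of the left side is the skew-symmetric rank two matrix \<open>X \<alpha>\<^sup>T - \<alpha> X\<^sup>T\<close>, whose columns
  \<open>i\<^sub>0\<close>, \<open>j\<^sub>0\<close> determine \<open>\<alpha>\<close> up to multiples of \<open>X\<close>; these multiples are coboundaries modulo polynomials in
  \<open>\<lambda>\<close> (\<open>data_2_ii_of_wedge\<close>, \<open>wedge_of_data_2_ii\<close>).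

  If \<open>p \<noteq> 0\<close>, comparing leading coefficients first in \<open>\<partial>\<close> and then in \<open>\<lambda>\<close> gives \<open>\<phi>\<^sub>A - \<psi>\<^sub>A = p\<close> unless \<open>g = 0\<close>.
  The equation for \<open>g\<close> then says that its finite differences in the two variables are proportional, with
  ratio \<open>p / \<phi>\<^sub>A\<close>. A \<open>g\<close> that depends on \<open>\<partial>\<close> forces this ratio to be a constant \<open>r\<close>
  (\<open>proportional_or_constant\<close>), and if the ratio is constant, \<open>r (r - 1)\<close> times any
  second difference of \<open>g\<close> in \<open>\<lambda>\<close> vanishes, so that \<open>g\<close> is affine (\<open>proportional_affine\<close>).

  For the dimensions: when the two modules are equal, every \<open>(s(\<lambda>), 0)\<close> is a cocycle, and a coboundary whose
  degree in \<open>\<partial>\<close> is bounded has bounded degree in \<open>\<lambda>\<close>, so no finite set of classes spans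
  (\<open>Ext_infinite_dim\<close>). In the last subcase at most two explicit cocycles span.
\<close>

section \<open>Translation and the twisted difference operator on \<open>\<complex>[\<partial>]\<close>\<close>

definition translate :: "complex \<Rightarrow> complex poly \<Rightarrow> complex poly" where
  "translate c q = pcompose q [:c, 1:]"

lemma poly_translate [simp]: "poly (translate c q) x = poly q (x + c)"
  by (simp add: translate_def poly_pcompose add.commute)

lemma translate_simps [simp]:
  "translate c 0 = 0" "translate c 1 = 1" "translate c [:a:] = [:a:]"
  "translate c [:a, b:] = [:a + b * c, b:]"
  "translate c (q + q') = translate c q + translate c q'"
  "translate c (q - q') = translate c q - translate c q'"
  "translate c (- q) = - translate c q"
  "translate c (smult a q) = smult a (translate c q)"
  "translate c (q * q') = translate c q * translate c q'"
  "translate c (translate d q) = translate (c + d) q"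
  "translate 0 q = q"
  by (simp_all add: poly_eq_poly_eq_iff[symmetric] fun_eq_iff algebra_simps)

lemma degree_translate [simp]: "degree (translate c q) = degree q"
  by (simp add: translate_def degree_pcompose)

lemma coeff_translate_top: "degree q \<le> n \<Longrightarrow> coeff (translate c q) n = coeff q n"
proof (cases "degree q = n")
  case True
  then have "coeff (translate c q) n = lead_coeff (translate c q)" by simp
  also have "\<dots> = lead_coeff q" unfolding translate_def by (subst lead_coeff_comp) auto
  finally show ?thesis using True by simp
next
  case False
  assume "degree q \<le> n"
  with False show ?thesis by (simp add: coeff_eq_0)
qed

text \<open>
  A periodic polynomial takes the value \<open>q(0)\<close> at all multiples of the period.
\<close>

lemma translate_periodic_imp_const:
  assumes "c \<noteq> 0" "translate c q = q"
  shows "q = [:poly q 0:]"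
proof (rule ccontr)
  assume neq: "q \<noteq> [:poly q 0:]"
  have per: "poly q (of_nat n * c) = poly q 0" for n
  proof (induction n)
    case (Suc n)
    have "poly q (of_nat (Suc n) * c) = poly (translate c q) (of_nat n * c)"
      by (simp add: algebra_simps)
    with Suc assms(2) show ?case by simp
  qed simp
  have "finite {x. poly (q - [:poly q 0:]) x = 0}" using neq by (intro poly_roots_finite) auto
  moreover have "range (\<lambda>n::nat. of_nat n * c) \<subseteq> {x. poly (q - [:poly q 0:]) x = 0}"
    using per by auto
  ultimately have "finite (range (\<lambda>n::nat. of_nat n * c))" by (rule rev_finite_subset)
  moreover have "inj (\<lambda>n::nat. of_nat n * c)" using assms(1) by (auto simp: inj_on_def)
  ultimately show False using finite_imageD by blast
qed

lemma translate_step_const_imp_affine: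
  assumes "c \<noteq> 0" "translate c q - q = [:k:]"
  shows "q = [:poly q 0, k / c:]"
proof -
  let ?r = "q - [:0, k / c:]"
  have "translate c ?r = ?r"
    using assms by (simp add: algebra_simps eq_diff_eq)
  from translate_periodic_imp_const[OF assms(1) this]
  show ?thesis by (simp add: algebra_simps)
qed

text \<open>
  For \<open>a = \<psi>(c)\<close> and \<open>b = \<phi>(c)\<close> this is the coboundary of \<open>q\<close> at \<open>\<lambda> = c\<close>; for \<open>a = b = -1\<close> it is the
  difference operator with step \<open>c\<close>.
\<close>

definition twist :: "complex \<Rightarrow> complex \<Rightarrow> complex \<Rightarrow> complex poly \<Rightarrow> complex poly" where
  "twist a b c q = smult a q - smult b (translate c q)"

lemma twist_simps:
  "twist a b c 0 = 0"
  "twist a b c (q + q') = twist a b c q + twist a b c q'"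
  "twist a b c (q - q') = twist a b c q - twist a b c q'"
  "twist a b c (smult k q) = smult k (twist a b c q)"
  "twist 0 0 c q = 0"
  by (simp_all add: twist_def smult_add_right smult_diff_right mult.commute)

text \<open>
  All these operators are polynomials in translations. The commutation is what makes a coboundary
  satisfy the cocycle equations.
\<close>

lemma twist_commute: "twist a b c (twist a' b' c' q) = twist a' b' c' (twist a b c q)"
  by (simp add: twist_def smult_diff_right mult.commute add.commute)

text \<open>
  Translation preserves the leading coefficient, so \<open>twist\<close> multiplies it by \<open>a - b\<close>.
\<close>

lemma twist_eq_0_imp_0:
  assumes "a \<noteq> b" "twist a b c q = 0"
  shows "q = 0"
proof -
  have "(a - b) * lead_coeff q = coeff (twist a b c q) (degree q)"
    by (simp add: twist_def coeff_translate_top algebra_simps)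
  with assms show ?thesis by simp
qed

lemma twist_eq_0_imp_const:
  assumes "c \<noteq> 0" "a \<noteq> 0 \<or> b \<noteq> 0" "twist a b c q = 0"
  shows "q = [:poly q 0:]"
proof (cases "a = b")
  case True
  with assms show ?thesis by (intro translate_periodic_imp_const) (auto simp: twist_def smult_diff_right[symmetric])
next
  case False
  with twist_eq_0_imp_0 assms have "q = 0" by blast
  then show ?thesis by simp
qed

text \<open>
  The falling factorials with step \<open>c\<close>: on this basis of \<open>\<complex>[\<partial>]\<close> the difference operator acts as the
  derivative does on powers.
\<close>

definition falling :: "complex \<Rightarrow> nat \<Rightarrow> complex poly" where
  "falling c n = (\<Prod>i<n. [:- (of_nat i * c), 1:])"

lemma monic_falling: "degree (falling c n) = n \<and> coeff (falling c n) n = 1"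
proof (induction n)
  case (Suc n)
  have e: "falling c (Suc n) = falling c n * [:- (of_nat n * c), 1:]" by (simp add: falling_def)
  from Suc have "falling c n \<noteq> 0" by auto
  then have "degree (falling c (Suc n)) = Suc n" using Suc unfolding e
    by (subst degree_mult_eq) auto
  moreover have "lead_coeff (falling c (Suc n)) = 1"
    unfolding e lead_coeff_mult using Suc by simp
  ultimately show ?case by simp
qed (simp add: falling_def)

lemma translate_falling:
  "translate c (falling c (Suc n)) - falling c (Suc n) = smult (of_nat (Suc n) * c) (falling c n)"
proof -
  have "translate c (falling c (Suc n)) = falling c n * [:c, 1:]"
  proof (induction n)
    case (Suc n)
    have e: "falling c (Suc m) = falling c m * [:- (of_nat m * c), 1:]" for m
      by (simp add: falling_def)
    have "translate c (falling c (Suc (Suc n))) =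
        translate c (falling c (Suc n)) * translate c [:- (of_nat (Suc n) * c), 1:]"
      by (simp only: e[of "Suc n"] translate_simps)
    also have "translate c [:- (of_nat (Suc n) * c), 1:] = [:- (of_nat n * c), 1:]"
      by (simp add: algebra_simps)
    also have "translate c (falling c (Suc n)) * [:- (of_nat n * c), 1:] = falling c (Suc n) * [:c, 1:]"
      unfolding Suc by (simp only: e ac_simps)
    finally show ?case .
  qed (simp add: falling_def)
  moreover have "falling c (Suc n) = falling c n * [:- (of_nat n * c), 1:]" by (simp add: falling_def)
  moreover have "falling c n * [:c, 1:] - falling c n * [:- (of_nat n * c), 1:] = falling c n * [:of_nat (Suc n) * c:]"
    by (simp only: right_diff_distrib[symmetric]) (simp add: algebra_simps)
  ultimately show ?thesis by simp
qed

text \<open>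
  Surjectivity is by triangularity. If \<open>a \<noteq> b\<close> the operator preserves degrees and multiplies leading
  coefficients by \<open>a - b\<close>; if \<open>a = b\<close> it is a multiple of the difference operator, lowers degrees by one, and
  falling factorials give explicit preimages of monic polynomials of every degree. The degree bound
  serves to bound coboundaries when the dimension of \<open>Ext\<close> is computed.
\<close>

lemma twist_surj:
  assumes "c \<noteq> 0" "a \<noteq> 0 \<or> b \<noteq> 0"
  shows "\<exists>h. twist a b c h = q \<and> degree h \<le> Suc (degree q)"
proof -
  have main: "\<exists>h. twist a b c h = q \<and> degree h \<le> n" if "degree q < n" for q n
    using that
  proof (induction n arbitrary: q)
    case (Suc n)
    have "\<exists>h0. degree h0 \<le> Suc n \<and> degree (twist a b c h0) \<le> n \<and> coeff (twist a b c h0) n = 1"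
    proof (cases "a = b")
      case True
      let ?h = "smult (- 1 / (a * of_nat (Suc n) * c)) (falling c (Suc n))"
      from True assms have nz: "a * of_nat (Suc n) * c \<noteq> 0" by (auto simp del: of_nat_Suc)
      have "twist a b c ?h = smult (- a * (- 1 / (a * of_nat (Suc n) * c))) (translate c (falling c (Suc n)) - falling c (Suc n))"
        by (simp only: twist_simps) (simp add: twist_def True smult_diff_right)
      also have "\<dots> = falling c n" using nz unfolding translate_falling by (simp add: field_simps del: of_nat_Suc)
      finally show ?thesis using monic_falling[of c n] monic_falling[of c "Suc n"]
        by (intro exI[of _ ?h]) (auto simp: degree_smult_eq)
    next
      case False
      let ?h = "smult (1 / (a - b)) (falling c n)"
      have "degree (twist a b c ?h) \<le> n"
        unfolding twist_def using monic_falling[of c n]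
        by (intro degree_diff_le order_trans[OF degree_smult_le]) auto
      moreover have "coeff (twist a b c ?h) n = 1"
        using False monic_falling[of c n]
        by (simp add: twist_def coeff_translate_top diff_divide_distrib[symmetric])
      ultimately show ?thesis using monic_falling[of c n]
        by (intro exI[of _ ?h]) (auto simp: degree_smult_eq)
    qed
    then obtain h0 where h0: "degree h0 \<le> Suc n" "degree (twist a b c h0) \<le> n" "coeff (twist a b c h0) n = 1"
      by blast
    \<comment> \<open>\<open>h0\<close> maps to a monic polynomial of degree \<open>n\<close>, so this polynomial has lower degree.\<close>
    let ?q = "q - smult (coeff q n) (twist a b c h0)"
    have "degree ?q \<le> n" using Suc.prems h0(2)
      by (intro degree_diff_le order_trans[OF degree_smult_le]) auto
    moreover have "coeff ?q n = 0" using h0(3) by simp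
    ultimately consider "degree ?q < n" | "?q = 0"
      by (metis le_neq_implies_less leading_coeff_0_iff)
    then obtain h1 where "twist a b c h1 = ?q" "degree h1 \<le> n"
    proof cases
      case 2
      then show ?thesis using that[of 0] by (simp add: twist_simps)
    qed (use Suc.IH in blast)
    then have "twist a b c (h1 + smult (coeff q n) h0) = q" by (simp add: twist_simps)
    moreover have "degree (h1 + smult (coeff q n) h0) \<le> Suc n"
      using h0(1) \<open>degree h1 \<le> n\<close> by (intro degree_add_le order_trans[OF degree_smult_le]) auto
    ultimately show ?case by blast
  qed simp
  from main[of q "Suc (degree q)"] show ?thesis by simp
qed

section \<open>Polynomials in \<open>\<partial>\<close> and \<open>\<lambda>\<close>\<close>

text \<open>
  A nonzero polynomial over the integral domain \<open>\<complex>[\<partial>]\<close> has finitely many roots, and there are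
  infinitely many constants. So an element of \<open>\<complex>[\<partial>,\<lambda>]\<close> may be handled as the family of its values
  in \<open>\<complex>[\<partial>]\<close> at complex \<open>\<lambda>\<close>.
\<close>

lemma poly_poly_eqI:
  fixes f g :: "complex poly poly"
  assumes "\<And>l. poly f [:l:] = poly g [:l:]"
  shows "f = g"
proof (rule ccontr)
  assume "f \<noteq> g"
  then have "finite {x. poly (f - g) x = 0}" by (intro poly_roots_finite) auto
  moreover have "range (\<lambda>l. [:l:]) \<subseteq> {x. poly (f - g) x = 0}" using assms by auto
  ultimately have "finite (range (\<lambda>l::complex. [:l:]))" by (rule rev_finite_subset)
  then have "finite (UNIV :: complex set)" by (rule finite_imageD) (auto simp: inj_on_def)
  then show False by (simp add: infinite_UNIV_char_0)
qed

lemma coeff_in_lam [simp]: "coeff (in_lam s) i = [:coeff s i:]"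
  by (simp add: in_lam_def coeff_map_poly)
lemma degree_in_lam [simp]: "degree (in_lam s) = degree s"
  unfolding in_lam_def by (rule degree_map_poly) auto
lemma in_lam_pCons [simp]: "in_lam (pCons a s) = pCons [:a:] (in_lam s)"
  by (rule poly_eqI) (auto simp: coeff_pCons split: nat.splits)
lemma in_lam_simps [simp]: "in_lam 0 = 0" "in_lam 1 = 1"
  "in_lam s = in_lam t \<longleftrightarrow> s = t" "in_lam s = 0 \<longleftrightarrow> s = 0"
  by (auto simp: poly_eq_iff[of _ t] poly_eq_iff[of _ "0 :: complex poly poly"]
      poly_eq_iff[of _ "0 :: complex poly"] poly_eq_iff[of _ "1 :: complex poly poly"] coeff_pCons
      poly_eq_iff[of _ "in_lam t"] split: nat.splits)
lemma in_lam_linear: "in_lam (s + t) = in_lam s + in_lam t" "in_lam (s - t) = in_lam s - in_lam t"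
  "in_lam (smult c s) = smult [:c:] (in_lam s)"
  by (auto intro!: poly_eqI simp: mult.commute)
lemma poly_in_lam: "poly (in_lam s) q = pcompose s q"
  by (induction s) (auto simp: pcompose_pCons)
lemma poly_in_lam_const [simp]: "poly (in_lam s) [:l:] = [:poly s l:]"
  by (induction s) auto

text \<open>
  The polynomial \<open>q(\<partial> + \<lambda>)\<close>.
\<close>

definition taylor :: "complex poly \<Rightarrow> complex poly poly" where
  "taylor q = pcompose (in_lam q) [:[:0, 1:], 1:]"

lemma poly_taylor [simp]: "poly (taylor q) [:l:] = translate l q"
  by (simp add: taylor_def poly_pcompose poly_in_lam translate_def)

lemma coeff_poly_const: "coeff (poly f [:l:]) i = poly (map_poly (\<lambda>q. coeff q i) f) l"
  by (induction f) (auto simp: map_poly_pCons)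

lemma const_coeffs_imp_in_lam:
  assumes "\<And>l. degree (poly f [:l:]) = 0"
  obtains s where "f = in_lam s"
proof
  show "f = in_lam (map_poly (\<lambda>q. coeff q 0) f)"
    by (rule poly_poly_eqI, rule poly_eqI)
      (auto simp: coeff_pCons coeff_poly_const[symmetric] assms coeff_eq_0 split: nat.splits)
qed

lemma affine_coeffs_imp_form:
  assumes "\<And>l. degree (poly f [:l:]) \<le> 1"
  obtains a s where "f = in_lam a * [:[:0, 1:]:] + in_lam s"
proof
  show "f = in_lam (map_poly (\<lambda>q. coeff q 1) f) * [:[:0, 1:]:] + in_lam (map_poly (\<lambda>q. coeff q 0) f)"
  proof (rule poly_poly_eqI, rule poly_eqI)
    fix l i
    have "coeff (poly f [:l:]) i = 0" if "i > 1" using assms[of l] that by (simp add: coeff_eq_0)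
    then show "coeff (poly f [:l:]) i = coeff (poly (in_lam (map_poly (\<lambda>q. coeff q 1) f) * [:[:0, 1:]:] + in_lam (map_poly (\<lambda>q. coeff q 0) f)) [:l:]) i"
      by (auto simp: coeff_pCons coeff_poly_const[symmetric] split: nat.splits)
  qed
qed

section \<open>Polynomials with coefficients in a \<open>\<complex>[\<partial>]\<close>-module\<close>

text \<open>
  A \<open>\<complex>[\<partial>]\<close>-module \<open>M\<close> together with the evaluation \<open>ev\<close> of elements of \<open>M[\<lambda>]\<close> at complex numbers.
\<close>

locale poly_module = module sM for sM :: "complex poly \<Rightarrow> 'm::ab_group_add \<Rightarrow> 'm"
begin

abbreviation ev :: "'m poly \<Rightarrow> complex \<Rightarrow> 'm" where
  "ev P l \<equiv> subst_lam sM P [:l:]"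

lemma subst_lam_upto: "degree P \<le> n \<Longrightarrow> subst_lam sM P q = (\<Sum>i\<le>n. sM (q ^ i) (coeff P i))"
  unfolding subst_lam_def
  by (rule sum.mono_neutral_left) (auto simp: coeff_eq_0)

lemma subst_lam_0 [simp]: "subst_lam sM 0 q = 0"
  by (simp add: subst_lam_def)

lemma subst_lam_add: "subst_lam sM (P + P') q = subst_lam sM P q + subst_lam sM P' q"
  using degree_add_le_max[of P P']
  by (simp add: subst_lam_upto[of _ "max (degree P) (degree P')"] scale_right_distrib sum.distrib)

lemma subst_lam_diff: "subst_lam sM (P - P') q = subst_lam sM P q - subst_lam sM P' q"
  using subst_lam_add[of "P - P'" P' q] by simp

lemma ev_scale: "ev (map_poly (sM [:c:]) P) l = sM [:c:] (ev P l)"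
proof -
  have "ev (map_poly (sM [:c:]) P) l = (\<Sum>i\<le>degree P. sM ([:l:] ^ i) (sM [:c:] (coeff P i)))"
    by (subst subst_lam_upto[of _ "degree P"]) (auto simp: coeff_map_poly map_poly_degree_leq)
  then show ?thesis by (simp add: subst_lam_def scale_sum_right mult.commute)
qed

text \<open>
  Replacing \<open>l\<close> by \<open>2 l\<close> and subtracting \<open>2\<^sup>n\<close> times the original identity removes the top term and
  multiplies the \<open>i\<close>-th coefficient by \<open>2\<^sup>i - 2\<^sup>n \<noteq> 0\<close>, which allows induction on \<open>n\<close>.
\<close>

lemma ev_eq_0_imp_coeff_0:
  assumes "\<And>l::complex. (\<Sum>i\<le>n. sM ([:l:] ^ i) (c i)) = 0" "i \<le> n"
  shows "c i = 0"
  using assms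
proof (induction n arbitrary: c i)
  case (Suc n)
  \<comment> \<open>The coefficients of the identity at \<open>2 l\<close> minus \<open>2\<^bsup>n+1\<^esup>\<close> times the identity at \<open>l\<close>.\<close>
  let ?d = "\<lambda>i. sM [:2 ^ i - 2 ^ Suc n:] (c i)"
  have "(\<Sum>i\<le>n. sM ([:l:] ^ i) (?d i)) = 0" for l
  proof -
    have "0 = (\<Sum>i\<le>Suc n. sM ([:2 * l:] ^ i) (c i)) - sM [:2 ^ Suc n:] (\<Sum>i\<le>Suc n. sM ([:l:] ^ i) (c i))"
      using Suc.prems(1) by simp
    also have "\<dots> = (\<Sum>i\<le>Suc n. sM ([:l:] ^ i) (?d i))"
      unfolding scale_sum_right sum_subtractf[symmetric]
      by (rule sum.cong)
        (auto simp: poly_const_pow power_mult_distrib scale_left_diff_distrib[symmetric] algebra_simps)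
    finally show ?thesis by simp
  qed
  from Suc.IH[OF this] have z: "?d i = 0" if "i \<le> n" for i using that .
  have lower: "c i = 0" if "i \<le> n" for i
  proof -
    let ?k = "2 ^ i - 2 ^ Suc n :: complex"
    have "(2::real) ^ i < 2 ^ Suc n" using that by (intro power_strict_increasing) auto
    then have "norm ((2::complex) ^ i) \<noteq> norm ((2::complex) ^ Suc n)" by (simp only: norm_power norm_numeral)
    then have "(2::complex) ^ i \<noteq> 2 ^ Suc n" by metis
    then have "?k \<noteq> 0" by simp
    have "sM [:1 / ?k:] (?d i) = 0" using z[OF that] by simp
    with \<open>?k \<noteq> 0\<close> show ?thesis by (simp add: one_pCons[symmetric])
  qed
  from Suc.prems(1)[of 1] lower have "c (Suc n) = 0" by (simp add: one_pCons[symmetric])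
  with lower Suc.prems(2) show ?case by (cases "i = Suc n") auto
next
  case 0
  from "0.prems"(1)[of 1] "0.prems"(2) show ?case by simp
qed

text \<open>
  Identities in \<open>M[\<lambda>]\<close> can be checked at complex values of \<open>\<lambda>\<close>. All computations with actions below are
  made with values, and this lemma brings them back to \<open>\<lambda>\<close>-polynomials.
\<close>

lemma vec_poly_eqI:
  assumes "\<And>l. ev P l = ev P' l"
  shows "P = P'"
proof -
  have "coeff (P - P') i = 0" for i
  proof (cases "i \<le> degree (P - P')")
    case True
    have "(\<Sum>i\<le>degree (P - P'). sM ([:l:] ^ i) (coeff (P - P') i)) = 0" for l
      using subst_lam_diff[of P P' "[:l:]"] assms[of l] by (simp add: subst_lam_def)
    from ev_eq_0_imp_coeff_0[OF this True] show ?thesis .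
  next
    case False
    then show ?thesis by (intro coeff_eq_0) simp
  qed
  then show ?thesis by (simp add: poly_eq_iff)
qed

lemma subst_lam_times_vec [simp]: "subst_lam sM (times_vec sM f m) q = sM (poly f q) m"
proof -
  have "degree (times_vec sM f m) \<le> degree f" unfolding times_vec_def by (rule map_poly_degree_leq)
  then have "subst_lam sM (times_vec sM f m) q = (\<Sum>i\<le>degree f. sM (q ^ i * coeff f i) m)"
    by (simp add: subst_lam_upto times_vec_def coeff_map_poly)
  also have "\<dots> = sM (poly f q) m"
    by (simp add: poly_altdef scale_sum_left mult.commute)
  finally show ?thesis .
qed

end

lemma subst_lam_hom:
  assumes "module_hom sM sN h"
  shows "subst_lam sN (map_poly h P) q = h (subst_lam sM P q)"
proof -
  interpret module_hom sM sN h by fact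
  interpret N: poly_module sN by unfold_locales
  have "subst_lam sN (map_poly h P) q = (\<Sum>i\<le>degree P. sN (q ^ i) (h (coeff P i)))"
    by (subst N.subst_lam_upto[of _ "degree P"]) (auto simp: coeff_map_poly map_poly_degree_leq)
  also have "\<dots> = h (subst_lam sM P q)" by (simp add: subst_lam_def sum scale)
  finally show ?thesis .
qed

section \<open>Conformal actions in terms of their values\<close>

locale conf_action =
  fixes R :: "('r::ab_group_add, 'r) cmod" and M :: "('r, 'm::ab_group_add) cmod"
  assumes R_module: "module (cscale R)" and action: "conformal_action R M"
begin

sublocale poly_module "cscale M"
  using action unfolding conformal_action_def poly_module_def by (rule conjunct1)

lemmas axioms = action[unfolded conformal_action_def]

lemmas cact_add_left = axioms[THEN conjunct2, THEN conjunct1, rule_format]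
lemmas cact_add_right = axioms[THEN conjunct2, THEN conjunct2, THEN conjunct1, rule_format]
lemmas cact_scale_left = axioms[THEN conjunct2, THEN conjunct2, THEN conjunct2, THEN conjunct1, rule_format]
lemmas cact_scale_right = axioms[THEN conjunct2, THEN conjunct2, THEN conjunct2, THEN conjunct2, THEN conjunct1, rule_format]
lemmas act_deriv_left = axioms[THEN conjunct2, THEN conjunct2, THEN conjunct2, THEN conjunct2, THEN conjunct2, THEN conjunct1, rule_format]
lemmas act_deriv_right = axioms[THEN conjunct2, THEN conjunct2, THEN conjunct2, THEN conjunct2, THEN conjunct2, THEN conjunct2, THEN conjunct1, rule_format]
lemmas act_act = axioms[THEN conjunct2, THEN conjunct2, THEN conjunct2, THEN conjunct2, THEN conjunct2, THEN conjunct2, THEN conjunct2, rule_format]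

lemma act_add_left: "act_at M (a + b) l m = act_at M a l m + act_at M b l m"
  by (simp add: act_at_def cact_add_left cact_add_right subst_lam_add)

lemma act_add_right: "act_at M a l (m + n) = act_at M a l m + act_at M a l n"
  by (simp add: act_at_def cact_add_left cact_add_right subst_lam_add)

lemma act_0_left [simp]: "act_at M 0 l m = 0"
  using act_add_left[of 0 0 l m] by simp

lemma act_0_right [simp]: "act_at M a l 0 = 0"
  using act_add_right[of a l 0 0] by simp

text \<open>
  Sesquilinearity for an arbitrary \<open>q \<in> \<complex>[\<partial>]\<close>: \<open>\<partial>\<close> on the algebra acts as \<open>- \<lambda>\<close>, and on the module (next
  lemma) it is translated by \<open>\<lambda>\<close>.
\<close>

lemma act_scale_left: "act_at M (cscale R q a) l m = cscale M [:poly q (- l):] (act_at M a l m)"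
proof -
  interpret R: poly_module "cscale R" using R_module by (simp add: poly_module_def)
  show ?thesis
  proof (induction q)
    case (pCons c q)
    have "cscale R (pCons c q) a = cscale R [:c:] a + cscale R [:0, 1:] (cscale R q a)"
      by (simp add: R.scale_left_distrib[symmetric])
    moreover have "act_at M (cscale R [:c:] a) l m = cscale M [:c:] (act_at M a l m)"
      by (simp add: act_at_def cact_scale_left ev_scale)
    moreover have "act_at M (cscale R [:0, 1:] (cscale R q a)) l m = cscale M [:- l:] (act_at M (cscale R q a) l m)"
      by (rule act_deriv_left)
    ultimately show ?case
      using pCons.IH by (simp add: act_add_left scale_left_distrib[symmetric] mult.commute)
  qed simp
qed

lemma act_scale_right: "act_at M a l (cscale M q m) = cscale M (translate l q) (act_at M a l m)"
proof (induction q)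
  case (pCons c q)
  have "cscale M (pCons c q) m = cscale M [:c:] m + cscale M [:0, 1:] (cscale M q m)"
    by (simp add: scale_left_distrib[symmetric])
  moreover have "act_at M a l (cscale M [:c:] m) = cscale M [:c:] (act_at M a l m)"
    by (simp add: act_at_def cact_scale_right ev_scale)
  moreover have "act_at M a l (cscale M [:0, 1:] (cscale M q m)) = cscale M [:l, 1:] (act_at M a l (cscale M q m))"
    by (rule act_deriv_right)
  moreover have "translate l (pCons c q) = [:c:] + [:l, 1:] * translate l q"
    by (simp add: poly_eq_poly_eq_iff[symmetric] fun_eq_iff algebra_simps)
  ultimately show ?case
    by (simp only: act_add_right pCons.IH scale_left_distrib scale_scale)
qed simp

end

text \<open>
  The axioms for \<open>\<lambda>\<close>-polynomials follow from the corresponding identities for values.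
\<close>

lemma conformal_actionI:
  assumes "module (cscale M)"
    and "\<And>a b l m. act_at M (a + b) l m = act_at M a l m + act_at M b l m"
    and "\<And>a l m n. act_at M a l (m + n) = act_at M a l m + act_at M a l n"
    and "\<And>q a l m. act_at M (cscale R q a) l m = cscale M [:poly q (- l):] (act_at M a l m)"
    and "\<And>q a l m. act_at M a l (cscale M q m) = cscale M (translate l q) (act_at M a l m)"
    and "\<And>a b l k m. act_at M a l (act_at M b k m) =
      act_at M (act_at R a l b) (l + k) m + act_at M b k (act_at M a l m)"
  shows "conformal_action R M"
proof -
  interpret poly_module "cscale M" using assms(1) by (simp add: poly_module_def)
  note act = assms(2-5)[unfolded act_at_def]
  show ?thesis unfolding conformal_action_def
  proof (intro conjI allI)
  show "cact M (a + b) m = cact M a m + cact M b m" for a b m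
    by (rule vec_poly_eqI) (simp add: subst_lam_add act)
  show "cact M a (m + n) = cact M a m + cact M a n" for a m n
    by (rule vec_poly_eqI) (simp add: subst_lam_add act)
  show "cact M (cscale R [:c:] a) m = map_poly (cscale M [:c:]) (cact M a m)" for c a m
    by (rule vec_poly_eqI) (simp add: ev_scale act)
  show "cact M a (cscale M [:c:] m) = map_poly (cscale M [:c:]) (cact M a m)" for c a m
    by (rule vec_poly_eqI) (simp add: ev_scale act)
  show "act_at M (cscale R [:0, 1:] a) l m = cscale M [:- l:] (act_at M a l m)" for a l m
    by (simp add: assms(4))
  show "act_at M a l (cscale M [:0, 1:] m) = cscale M [:l, 1:] (act_at M a l m)" for a l m
    by (simp add: assms(5))
  qed (rule assms)+
qed

text \<open>
  A module homomorphism commutes with evaluation of \<open>\<lambda>\<close>-polynomials, and these are determined by their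
  values.
\<close>

lemma conformal_hom_iff:
  assumes "module_hom (cscale M) (cscale N) h"
  shows "conformal_hom M N h \<longleftrightarrow> (\<forall>a m l. act_at N a l (h m) = h (act_at M a l m))"
proof -
  interpret module_hom "cscale M" "cscale N" h by fact
  interpret N: poly_module "cscale N" by unfold_locales
  have "cact N a (h m) = map_poly h (cact M a m) \<longleftrightarrow> (\<forall>l. act_at N a l (h m) = h (act_at M a l m))" for a m
    unfolding act_at_def subst_lam_hom[OF assms, symmetric] using N.vec_poly_eqI by metis
  with assms show ?thesis by (auto simp: conformal_hom_def)
qed

section \<open>Coordinates in free modules of rank one and two\<close>

context poly_module begin

lemma free_basis_1:
  assumes "free_basis sM {v}"
  shows "\<exists>q. x = sM q v" "sM q v = sM q' v \<longleftrightarrow> q = q'"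
proof -
  have ind: "independent {v}" and sp: "span {v} = UNIV" using assms by (auto simp: free_basis_def)
  show "\<exists>q. x = sM q v" using sp unfolding span_singleton by blast
  have "r = 0" if "sM r v = 0" for r
    using ind[unfolded independent_explicit_module, rule_format, of "{v}" "\<lambda>_. r" v] that by simp
  from this[of "q - q'"] show "sM q v = sM q' v \<longleftrightarrow> q = q'" by (auto simp: scale_left_diff_distrib)
qed

lemma free_basis_2:
  assumes "free_basis sM {v, u}" "v \<noteq> u"
  shows "\<exists>p q. x = sM p v + sM q u" "sM p v + sM q u = sM p' v + sM q' u \<longleftrightarrow> p = p' \<and> q = q'"
proof -
  have ind: "independent {v, u}" and sp: "span {v, u} = UNIV" using assms by (auto simp: free_basis_def)
  have "x \<in> span {v, u}" using sp by simp
  then obtain a b where "x - sM a v = sM b u" unfolding span_insert span_singleton[of u] by auto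
  then show "\<exists>p q. x = sM p v + sM q u" by (metis diff_add_cancel add.commute)
  have "r = 0 \<and> s = 0" if "sM r v + sM s u = 0" for r s
  proof -
    let ?f = "\<lambda>z. if z = v then r else s"
    have sum: "(\<Sum>z\<in>{v, u}. sM (?f z) z) = 0" using that assms(2) by simp
    note ind' = ind[unfolded independent_explicit_module, rule_format, OF _ subset_refl sum]
    from ind'[of v] ind'[of u] assms(2) show ?thesis by simp
  qed
  from this[of "p - p'" "q - q'"] show "sM p v + sM q u = sM p' v + sM q' u \<longleftrightarrow> p = p' \<and> q = q'"
    by (auto simp: scale_left_diff_distrib algebra_simps)
qed

lemma free_basis_2I:
  assumes "\<And>x. \<exists>p q. x = sM p v + sM q u" "\<And>p q. sM p v + sM q u = 0 \<Longrightarrow> p = 0 \<and> q = 0"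
  shows "v \<noteq> u" "free_basis sM {v, u}"
proof -
  show ne: "v \<noteq> u" using assms(2)[of 1 "-1"] by auto
  have "independent {v, u}" unfolding independent_explicit_module
  proof (intro allI impI)
    fix t f z assume t: "finite t" "t \<subseteq> {v, u}" "(\<Sum>w\<in>t. sM (f w) w) = 0" "z \<in> t"
    let ?g = "\<lambda>w. if w \<in> t then f w else 0"
    have "(\<Sum>w\<in>{v, u}. sM (?g w) w) = (\<Sum>w\<in>t. sM (f w) w)"
      by (rule sum.mono_neutral_cong_right) (use t in auto)
    with t(3) ne have "sM (?g v) v + sM (?g u) u = 0" by simp
    from assms(2)[OF this] t(2,4) show "f z = 0" by auto
  qed
  moreover have "x \<in> span {v, u}" for x
  proof -
    obtain p q where "x = sM p v + sM q u" using assms(1) by blast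
    then show ?thesis by (auto intro: span_add span_scale span_base)
  qed
  ultimately show "free_basis sM {v, u}" by (auto simp: free_basis_def)
qed

definition coord :: "'m \<Rightarrow> 'm \<Rightarrow> complex poly" where
  "coord v x = (THE q. x = sM q v)"

lemma coord:
  assumes "free_basis sM {v}"
  shows "sM (coord v x) v = x" "coord v (sM q v) = q"
proof -
  show *: "coord v (sM q v) = q" for q
    unfolding coord_def using free_basis_1(2)[OF assms] by auto
  obtain q where "x = sM q v" using free_basis_1(1)[OF assms] by blast
  then show "sM (coord v x) v = x" using * by simp
qed

lemma coord_linear:
  assumes "free_basis sM {v}"
  shows "coord v (x + y) = coord v x + coord v y" "coord v (sM q x) = q * coord v x" "coord v 0 = 0" "coord v v = 1"
proof -
  note c = coord[OF assms]
  show "coord v (x + y) = coord v x + coord v y" by (metis c scale_left_distrib)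
  show "coord v (sM q x) = q * coord v x" by (metis c scale_scale)
  show "coord v 0 = 0" using c(2)[of 0] by simp
  show "coord v v = 1" using c(2)[of 1] by simp
qed

lemma times_vec_inj:
  assumes "free_basis sM {v}" "times_vec sM f v = times_vec sM g v"
  shows "f = g"
proof (rule poly_poly_eqI)
  fix l
  have "sM (poly f [:l:]) v = sM (poly g [:l:]) v"
    using assms(2) by (metis subst_lam_times_vec)
  then show "poly f [:l:] = poly g [:l:]" using free_basis_1(2)[OF assms(1)] by simp
qed

text \<open>
  Every element of \<open>M[\<lambda>]\<close> for \<open>M = \<complex>[\<partial>] v\<close> comes from a polynomial of \<open>\<complex>[\<partial>,\<lambda>]\<close>; for a cocycle, this
  polynomial is \<open>f\<close> or \<open>g\<close>.
\<close>

lemma vec_poly_eq_times_vec: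
  assumes "free_basis sM {v}"
  obtains f where "P = times_vec sM f v"
proof
  have "coord v 0 = 0" by (rule coord_linear[OF assms])
  then show "P = times_vec sM (map_poly (coord v) P) v"
    by (intro poly_eqI) (simp add: times_vec_def coeff_map_poly coord[OF assms])
qed

end

section \<open>Actions of a solvable rank two algebra\<close>

lemma poly_poly_collapse: "poly (poly F q) x = poly (poly F [:poly q x:]) x"
  by (induction F) auto

locale rank_two =
  fixes R :: "('r::ab_group_add, 'r) cmod" and A B :: 'r and p :: "complex poly" and Q :: "complex poly poly"
  assumes rank_two: "solvable_rank_two R A B p Q"
begin

lemma lie: "lie_conformal_algebra R"
  using rank_two by (simp add: solvable_rank_two_def)

lemma conf_actionI: "conformal_action R M \<Longrightarrow> conf_action R M"
  using lie unfolding conf_action_def lie_conformal_algebra_def conformal_action_def by blast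

sublocale R: conf_action R R
  using lie unfolding lie_conformal_algebra_def by (intro conf_actionI) blast

lemma basis: "free_basis (cscale R) {A, B}" "A \<noteq> B"
  using rank_two by (simp_all add: solvable_rank_two_def)

definition coordA :: "'r \<Rightarrow> complex poly" where
  "coordA a = (THE x. \<exists>y. a = cscale R x A + cscale R y B)"
definition coordB :: "'r \<Rightarrow> complex poly" where
  "coordB a = (THE y. \<exists>x. a = cscale R x A + cscale R y B)"

lemma coordAB_unique: "coordA (cscale R x A + cscale R y B) = x" "coordB (cscale R x A + cscale R y B) = y"
  unfolding coordA_def coordB_def using R.free_basis_2(2)[OF basis] by auto

lemma coordAB_expand: "cscale R (coordA a) A + cscale R (coordB a) B = a"
  using R.free_basis_2(1)[OF basis] coordAB_unique by metis

lemma coordAB_simps [simp]: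
  "coordA (a + b) = coordA a + coordA b" "coordB (a + b) = coordB a + coordB b"
  "coordA (cscale R q a) = q * coordA a" "coordB (cscale R q a) = q * coordB a"
  "coordA A = 1" "coordB A = 0" "coordA B = 0" "coordB B = 1"
proof -
  have "a + b = cscale R (coordA a + coordA b) A + cscale R (coordB a + coordB b) B"
    by (subst coordAB_expand[of a, symmetric], subst coordAB_expand[of b, symmetric]) (simp add: R.scale_left_distrib)
  then show "coordA (a + b) = coordA a + coordA b" "coordB (a + b) = coordB a + coordB b" using coordAB_unique by metis+
  have "cscale R q a = cscale R (q * coordA a) A + cscale R (q * coordB a) B"
    by (subst coordAB_expand[of a, symmetric]) (simp only: R.scale_right_distrib R.scale_scale)
  then show "coordA (cscale R q a) = q * coordA a" "coordB (cscale R q a) = q * coordB a" using coordAB_unique by metis+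
  show "coordA A = 1" "coordB A = 0" "coordA B = 0" "coordB B = 1"
    using coordAB_unique[of 1 0] coordAB_unique[of 0 1] by simp_all
qed

text \<open>
  \<open>Q(-\<lambda>-\<mu>, \<lambda>)\<close>: by sesquilinearity this is the factor by which \<open>[A\<^sub>\<lambda> A] = Q(\<partial>, \<lambda>) B\<close> acts through
  \<open>B\<^bsub>\<lambda>+\<mu>\<^esub>\<close>.
\<close>

definition Q_at :: "complex \<Rightarrow> complex \<Rightarrow> complex" where
  "Q_at l k = poly (poly Q [:l:]) (- l - k)"

text \<open>
  Skew-symmetry of \<open>Q\<close>, evaluated at \<open>\<partial> = -\<lambda>-\<mu>\<close>, where the substitution \<open>\<lambda> \<mapsto> -\<lambda>-\<partial>\<close> is \<open>\<lambda> \<mapsto> \<mu>\<close>.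
\<close>

lemma Q_at_skew: "Q_at k l = - Q_at l k"
proof -
  have "Q = - pcompose Q [:[:0, - 1:], - 1:]"
    using rank_two unfolding solvable_rank_two_def by blast
  then have "poly Q [:l:] = poly (- pcompose Q [:[:0, - 1:], - 1:]) [:l:]" by (rule arg_cong)
  then have "Q_at l k = - poly (poly Q [:- l, - 1:]) (- l - k)"
    by (simp add: Q_at_def poly_pcompose)
  also have "\<dots> = - Q_at k l"
    unfolding Q_at_def by (subst poly_poly_collapse) (simp add: minus_diff_commute)
  finally show ?thesis by simp
qed

lemma p_eq_0_or_Q_eq_0: "p = 0 \<or> Q = 0"
  using rank_two by (simp add: solvable_rank_two_def)

lemma brackets:
  "act_at R A l A = cscale R (poly Q [:l:]) B"
  "act_at R A l B = cscale R [:poly p l:] B"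
  "act_at R B l B = 0"
  "act_at R B l A = - cscale R (pcompose p [:- l, - 1:]) B"
proof -
  have "act_at R B l A = - subst_lam (cscale R) (cact R A B) [:- l, - 1:]"
    using lie unfolding lie_conformal_algebra_def by blast
  moreover have "cact R A B = times_vec (cscale R) (in_lam p) B"
    using rank_two by (simp add: solvable_rank_two_def)
  ultimately show "act_at R B l A = - cscale R (pcompose p [:- l, - 1:]) B"
    by (simp add: poly_in_lam)
qed (use rank_two in \<open>simp_all add: solvable_rank_two_def act_at_def\<close>)

lemma act_at_generators:
  assumes "conformal_action R M"
  shows "act_at M a l m = cscale M [:poly (coordA a) (- l):] (act_at M A l m) +
    cscale M [:poly (coordB a) (- l):] (act_at M B l m)"
proof -
  interpret M: conf_action R M using assms by (rule conf_actionI)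
  show ?thesis
    by (subst coordAB_expand[of a, symmetric]) (simp only: M.act_add_left M.act_scale_left)
qed

text \<open>
  The only consequences of the Jacobi identity that carry information, one for each unordered pair of
  generators.
\<close>

lemma commutators:
  assumes "conformal_action R M"
  shows "act_at M A l (act_at M A k m) = cscale M [:Q_at l k:] (act_at M B (l + k) m) + act_at M A k (act_at M A l m)"
    and "act_at M A l (act_at M B k m) = cscale M [:poly p l:] (act_at M B (l + k) m) + act_at M B k (act_at M A l m)"
    and "act_at M B l (act_at M B k m) = act_at M B k (act_at M B l m)"
proof -
  interpret M: conf_action R M using assms by (rule conf_actionI)
  show "act_at M A l (act_at M A k m) = cscale M [:Q_at l k:] (act_at M B (l + k) m) + act_at M A k (act_at M A l m)"
    by (subst M.act_act) (simp add: brackets M.act_scale_left Q_at_def)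
  show "act_at M A l (act_at M B k m) = cscale M [:poly p l:] (act_at M B (l + k) m) + act_at M B k (act_at M A l m)"
    by (subst M.act_act) (simp add: brackets M.act_scale_left)
  show "act_at M B l (act_at M B k m) = act_at M B k (act_at M B l m)"
    by (subst M.act_act) (simp add: brackets)
qed

text \<open>
  Conversely, operators \<open>\<alpha>\<^sub>\<lambda>\<close>, \<open>\<beta>\<^sub>\<lambda>\<close> that satisfy the commutation relations of \<open>A\<close> and \<open>B\<close> extend to an
  action of the algebra: both sides of the Jacobi identity are sesquilinear in the two algebra elements,
  so the four pairs of generators suffice, and the pair \<open>(B, A)\<close> follows from \<open>(A, B)\<close>.
\<close>

lemma conformal_action_from_generators:
  fixes M :: "('r, 'm::ab_group_add) cmod"
  assumes M: "module (cscale M)"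
    and \<alpha>_add: "\<And>l m n. \<alpha> l (m + n) = \<alpha> l m + \<alpha> l n"
    and \<beta>_add: "\<And>l m n. \<beta> l (m + n) = \<beta> l m + \<beta> l n"
    and \<alpha>_scale: "\<And>l q m. \<alpha> l (cscale M q m) = cscale M (translate l q) (\<alpha> l m)"
    and \<beta>_scale: "\<And>l q m. \<beta> l (cscale M q m) = cscale M (translate l q) (\<beta> l m)"
    and act: "\<And>a l m. act_at M a l m = cscale M [:poly (coordA a) (- l):] (\<alpha> l m) + cscale M [:poly (coordB a) (- l):] (\<beta> l m)"
    and AA: "\<And>l k m. \<alpha> l (\<alpha> k m) = cscale M [:Q_at l k:] (\<beta> (l + k) m) + \<alpha> k (\<alpha> l m)"
    and AB: "\<And>l k m. \<alpha> l (\<beta> k m) = cscale M [:poly p l:] (\<beta> (l + k) m) + \<beta> k (\<alpha> l m)"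
    and BB: "\<And>l k m. \<beta> l (\<beta> k m) = \<beta> k (\<beta> l m)"
  shows "conformal_action R M"
proof (rule conformal_actionI[OF M])
  interpret poly_module "cscale M" using M by (simp add: poly_module_def)
  fix a b :: 'r and l k :: complex and m :: 'm and q
  have sp: "cscale M [:u + u':] z = cscale M [:u:] z + cscale M [:u':] z" for u u' z
    by (simp add: scale_left_distrib[symmetric])
  show "act_at M (a + b) l m = act_at M a l m + act_at M b l m"
    by (simp add: act sp ac_simps)
  show "act_at M a l (m + n) = act_at M a l m + act_at M a l n" for n
    by (simp add: act scale_right_distrib \<alpha>_add \<beta>_add ac_simps)
  show "act_at M (cscale R q a) l m = cscale M [:poly q (- l):] (act_at M a l m)"
    by (simp add: act scale_right_distrib mult.commute)
  show "act_at M a l (cscale M q m) = cscale M (translate l q) (act_at M a l m)"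
    by (simp add: act scale_right_distrib \<alpha>_scale \<beta>_scale mult.commute)
  define x y x' y' where "x = poly (coordA a) (- l)" "y = poly (coordB a) (- l)"
    "x' = poly (coordA b) (- k)" "y' = poly (coordB b) (- k)"
  have c: "\<alpha> l (cscale M [:c:] m) = cscale M [:c:] (\<alpha> l m)" "\<beta> l (cscale M [:c:] m) = cscale M [:c:] (\<beta> l m)" for c l m
    by (simp_all add: \<alpha>_scale \<beta>_scale)
  \<comment> \<open>The coefficient of \<open>B\<close> in \<open>[a\<^sub>\<lambda> b]\<close>; the coefficient of \<open>A\<close> is \<open>0\<close>.\<close>
  let ?Z = "smult x (translate l (coordA b) * poly Q [:l:] + smult (poly p l) (translate l (coordB b)))
     - smult y (translate l (coordA b) * pcompose p [:- l, - 1:])"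
  have bil: "act_at R a l b = cscale R ?Z B"
  proof -
    have "act_at R a l b = cscale R [:x:] (act_at R A l b) + cscale R [:y:] (act_at R B l b)"
      unfolding x_y_x'_y'_def by (rule act_at_generators) (use lie lie_conformal_algebra_def in blast)
    also have "act_at R A l b = cscale R (translate l (coordA b) * poly Q [:l:] + translate l (coordB b) * [:poly p l:]) B"
      by (subst coordAB_expand[of b, symmetric])
        (simp only: R.act_add_right R.act_scale_right brackets R.scale_scale R.scale_left_distrib)
    also have "act_at R B l b = cscale R (- (translate l (coordA b) * pcompose p [:- l, - 1:])) B"
      by (subst coordAB_expand[of b, symmetric])
        (simp add: R.act_add_right R.act_scale_right brackets)
    also have "cscale R [:x:] (cscale R (translate l (coordA b) * poly Q [:l:] + translate l (coordB b) * [:poly p l:]) B) +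
        cscale R [:y:] (cscale R (- (translate l (coordA b) * pcompose p [:- l, - 1:])) B) = cscale R ?Z B"
      unfolding R.scale_scale R.scale_left_distrib[symmetric] by (simp add: smult_add_right)
    finally show ?thesis .
  qed
  have Z: "poly ?Z (- (l + k)) = x * x' * Q_at l k + x * y' * poly p l - y * x' * poly p k"
    by (simp add: Q_at_def x_y_x'_y'_def poly_pcompose algebra_simps minus_diff_commute)
  have "act_at M (act_at R a l b) (l + k) m = cscale M [:poly ?Z (- (l + k)):] (\<beta> (l + k) m)"
    unfolding bil act by (simp del: minus_add_distrib)
  also have "\<dots> = cscale M [:x * x' * Q_at l k:] (\<beta> (l + k) m) + cscale M [:x * y' * poly p l:] (\<beta> (l + k) m)
      - cscale M [:y * x' * poly p k:] (\<beta> (l + k) m)"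
    unfolding Z by (simp add: scale_left_distrib[symmetric] scale_left_diff_distrib[symmetric])
  finally have br: "act_at M (act_at R a l b) (l + k) m = \<dots>" .
  have BA: "\<beta> l (\<alpha> k m) = \<alpha> k (\<beta> l m) - cscale M [:poly p k:] (\<beta> (l + k) m)"
    using AB[of k l m] by (simp add: add.commute)
  have ab: "act_at M a l m = cscale M [:x:] (\<alpha> l m) + cscale M [:y:] (\<beta> l m)"
    "act_at M b k m = cscale M [:x':] (\<alpha> k m) + cscale M [:y':] (\<beta> k m)" for m
    by (simp_all add: act x_y_x'_y'_def)
  show "act_at M a l (act_at M b k m) = act_at M (act_at R a l b) (l + k) m + act_at M b k (act_at M a l m)"
    unfolding br ab
    by (simp add: \<alpha>_add \<beta>_add c scale_right_distrib scale_right_diff_distrib AA[of l k] AB[of l k] BA BB[of l k] algebra_simps)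
qed

end

section \<open>Cocycles and coboundaries\<close>

text \<open>
  The polynomial \<open>\<psi>(\<lambda>) h(\<partial>) - \<phi>(\<lambda>) h(\<partial> + \<lambda>)\<close> in \<open>\<partial>\<close> and \<open>\<lambda>\<close>: the effect on \<open>f\<close> or \<open>g\<close> of subtracting
  \<open>h(\<partial>) v\<close> from the lift.
\<close>

definition coboundary :: "complex poly \<Rightarrow> complex poly \<Rightarrow> complex poly \<Rightarrow> complex poly poly" where
  "coboundary \<psi> \<phi> h = in_lam \<psi> * [:h:] - in_lam \<phi> * taylor h"

lemma poly_coboundary [simp]: "poly (coboundary \<psi> \<phi> h) [:l:] = twist (poly \<psi> l) (poly \<phi> l) l h"
  by (simp add: coboundary_def twist_def)

lemma coboundary_linear: "coboundary \<psi> \<phi> 0 = 0" "coboundary \<psi> \<phi> (h + h') = coboundary \<psi> \<phi> h + coboundary \<psi> \<phi> h'"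
  "coboundary \<psi> \<phi> (- h) = - coboundary \<psi> \<phi> h" "coboundary 0 0 h = 0"
proof -
  show "coboundary \<psi> \<phi> 0 = 0" "coboundary \<psi> \<phi> (h + h') = coboundary \<psi> \<phi> h + coboundary \<psi> \<phi> h'" "coboundary 0 0 h = 0"
    by (auto intro!: poly_poly_eqI simp: twist_simps)
  from twist_simps(3)[of _ _ _ 0 h] show "coboundary \<psi> \<phi> (- h) = - coboundary \<psi> \<phi> h"
    by (intro poly_poly_eqI) (simp add: twist_simps)
qed

text \<open>
  The module axiom for \<open>(A, A)\<close>, \<open>(A, B)\<close> and \<open>(B, B)\<close> on the lift \<open>u\<close>, read off at the generator \<open>v\<close> of the
  submodule. With \<open>D\<^sub>A(\<lambda>)\<close>, \<open>D\<^sub>B(\<lambda>)\<close> for the two operators \<open>twist\<close> at \<open>\<lambda>\<close> and \<open>f\<^sub>\<lambda> = f(\<partial>, \<lambda>)\<close>, they are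
  \<open>D\<^sub>A(\<mu>) f\<^sub>\<lambda> - D\<^sub>A(\<lambda>) f\<^sub>\<mu> = Q(-\<lambda>-\<mu>, \<lambda>) g\<^bsub>\<lambda>+\<mu>\<^esub>\<close>, \<open>D\<^sub>B(\<mu>) f\<^sub>\<lambda> - D\<^sub>A(\<lambda>) g\<^sub>\<mu> = p(\<lambda>) g\<^bsub>\<lambda>+\<mu>\<^esub>\<close> and
  \<open>D\<^sub>B(\<mu>) g\<^sub>\<lambda> = D\<^sub>B(\<lambda>) g\<^sub>\<mu>\<close>.
\<close>

definition cocycle ::
    "complex poly \<Rightarrow> complex poly poly \<Rightarrow> complex poly \<Rightarrow> complex poly \<Rightarrow> complex poly \<Rightarrow> complex poly \<Rightarrow>
     complex poly poly \<Rightarrow> complex poly poly \<Rightarrow> bool" where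
  "cocycle p Q \<phi>A \<phi>B \<psi>A \<psi>B f g \<longleftrightarrow>
     (\<forall>l m. twist (poly \<psi>A m) (poly \<phi>A m) m (poly f [:l:]) - twist (poly \<psi>A l) (poly \<phi>A l) l (poly f [:m:]) =
        smult (poly (poly Q [:l:]) (- l - m)) (poly g [:l + m:])) \<and>
     (\<forall>l m. twist (poly \<psi>B m) (poly \<phi>B m) m (poly f [:l:]) - twist (poly \<psi>A l) (poly \<phi>A l) l (poly g [:m:]) =
        smult (poly p l) (poly g [:l + m:])) \<and>
     (\<forall>l m. twist (poly \<psi>B m) (poly \<phi>B m) m (poly g [:l:]) = twist (poly \<psi>B l) (poly \<phi>B l) l (poly g [:m:]))"

section \<open>Extensions of rank one modules and their cocycles\<close>

locale rank_one = rank_two R A B p Q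
  for R :: "('r::ab_group_add, 'r) cmod" and A B p Q +
  fixes \<phi>A \<phi>B :: "complex poly" and V :: "('r, 'v::ab_group_add) cmod" and v :: 'v
  assumes rank_one: "irreducible_rank_one R A B p Q \<phi>A \<phi>B V v"
begin

lemma module_V: "conformal_module R V"
  using rank_one by (simp add: irreducible_rank_one_def)

sublocale conf_action R V
  using module_V by (intro conf_actionI) (simp add: conformal_module_def)

lemma V_basis: "free_basis (cscale V) {v}"
  using rank_one by (simp add: irreducible_rank_one_def)

lemma \<phi>_nonzero: "\<phi>A \<noteq> 0 \<or> \<phi>B \<noteq> 0" and \<phi>B_nonzero: "\<phi>B \<noteq> 0 \<Longrightarrow> p = 0 \<and> Q = 0"
  using rank_one unfolding irreducible_rank_one_def by blast+

lemma act_generator: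
  "act_at V A l (cscale V r v) = cscale V (smult (poly \<phi>A l) (translate l r)) v"
  "act_at V B l (cscale V r v) = cscale V (smult (poly \<phi>B l) (translate l r)) v"
proof -
  have "cact V A v = times_vec (cscale V) (in_lam \<phi>A) v" "cact V B v = times_vec (cscale V) (in_lam \<phi>B) v"
    using rank_one by (auto simp: irreducible_rank_one_def)
  then show "act_at V A l (cscale V r v) = cscale V (smult (poly \<phi>A l) (translate l r)) v"
    "act_at V B l (cscale V r v) = cscale V (smult (poly \<phi>B l) (translate l r)) v"
    unfolding act_scale_right by (simp_all add: act_at_def mult.commute)
qed

lemma coord_act:
  "coord v (act_at V A l x) = smult (poly \<phi>A l) (translate l (coord v x))"
  "coord v (act_at V B l x) = smult (poly \<phi>B l) (translate l (coord v x))"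
  using act_generator[of l "coord v x"] coord[OF V_basis] by metis+

end

locale rank_one_pair =
  rank_two R A B p Q + V: rank_one R A B p Q \<phi>A \<phi>B V v + W: rank_one R A B p Q \<psi>A \<psi>B W w
  for R :: "('r::ab_group_add, 'r) cmod" and A B p Q \<phi>A \<phi>B and V :: "('r, 'v::ab_group_add) cmod" and v
    and \<psi>A \<psi>B and W :: "('r, 'w::ab_group_add) cmod" and w
begin

abbreviation ext_form ::
    "('r, 'e::ab_group_add) cmod \<Rightarrow> ('v \<Rightarrow> 'e) \<Rightarrow> ('e \<Rightarrow> 'w) \<Rightarrow> complex poly poly \<Rightarrow> complex poly poly \<Rightarrow> bool" where
  "ext_form \<equiv> ext_of_form R A B \<phi>A \<phi>B \<psi>A \<psi>B V v W w"

abbreviation is_cocycle :: "complex poly poly \<Rightarrow> complex poly poly \<Rightarrow> bool" where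
  "is_cocycle \<equiv> cocycle p Q \<phi>A \<phi>B \<psi>A \<psi>B"

end

locale rank_one_ext = rank_one_pair R A B p Q \<phi>A \<phi>B V v \<psi>A \<psi>B W w
  for R :: "('r::ab_group_add, 'r) cmod" and A B p Q \<phi>A \<phi>B and V :: "('r, 'v::ab_group_add) cmod" and v
    and \<psi>A \<psi>B and W :: "('r, 'w::ab_group_add) cmod" and w +
  fixes E :: "('r, 'e::ab_group_add) cmod" and \<iota> \<pi>
  assumes ext: "extension R V W E \<iota> \<pi>"
begin

lemma action_E: "conformal_action R E"
  using ext unfolding extension_def conformal_module_def by blast

sublocale E: conf_action R E
  using action_E by (rule conf_actionI)

sublocale \<iota>: module_hom "cscale V" "cscale E" \<iota>
  using ext unfolding extension_def conformal_hom_def by blast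

sublocale \<pi>: module_hom "cscale E" "cscale W" \<pi>
  using ext unfolding extension_def conformal_hom_def by blast

lemma \<iota>_act: "act_at E a l (\<iota> x) = \<iota> (act_at V a l x)"
  using ext conformal_hom_iff[OF \<iota>.module_hom_axioms] unfolding extension_def by blast

lemma \<pi>_act: "\<pi> (act_at E a l x) = act_at W a l (\<pi> x)"
  using ext conformal_hom_iff[OF \<pi>.module_hom_axioms] unfolding extension_def by metis

lemma \<pi>_\<iota> [simp]: "\<pi> (\<iota> x) = 0"
  using ext unfolding extension_def by blast

lemma kernel:
  assumes "\<pi> y = 0"
  obtains q where "y = cscale E q (\<iota> v)"
proof -
  from assms ext obtain x where "y = \<iota> x" unfolding extension_def by blast
  moreover obtain q where "x = cscale V q v" using V.free_basis_1(1)[OF V.V_basis] by blast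
  ultimately show ?thesis using that \<iota>.scale by auto
qed

text \<open>
  Both ends of the exact sequence are free, so the generator of the submodule and any lift of the
  generator of the quotient form a basis.
\<close>

lemma lift_basis:
  assumes "\<pi> u = w"
  shows "\<iota> v \<noteq> u" "free_basis (cscale E) {\<iota> v, u}"
proof -
  have sp: "\<exists>r q. x = cscale E r (\<iota> v) + cscale E q u" for x
  proof -
    obtain q where "\<pi> x = cscale W q w" using W.free_basis_1(1)[OF W.V_basis] by blast
    then have "\<pi> (x - cscale E q u) = 0" using assms by (simp add: \<pi>.diff \<pi>.scale)
    then obtain r where "x - cscale E q u = cscale E r (\<iota> v)" by (rule kernel)
    then show ?thesis by (metis diff_add_cancel)
  qed
  have ind: "r = 0 \<and> q = 0" if *: "cscale E r (\<iota> v) + cscale E q u = 0" for r q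
  proof -
    have "cscale W q w = cscale W 0 w" 
      using arg_cong[OF *, of \<pi>] assms by (simp add: \<pi>.add \<pi>.scale)
    then have q: "q = 0" by (simp only: W.free_basis_1(2)[OF W.V_basis])
    with * have "\<iota> (cscale V r v) = \<iota> (cscale V 0 v)" by (simp add: \<iota>.scale)
    then have "cscale V r v = cscale V 0 v" using ext unfolding extension_def by (blast dest: injD)
    then show ?thesis using q by (simp only: V.free_basis_1(2)[OF V.V_basis])
  qed
  show "\<iota> v \<noteq> u" "free_basis (cscale E) {\<iota> v, u}" using E.free_basis_2I[OF sp ind] by auto
qed

lemma act_\<iota>v:
  "act_at E A l (cscale E r (\<iota> v)) = cscale E (smult (poly \<phi>A l) (translate l r)) (\<iota> v)"
  "act_at E B l (cscale E r (\<iota> v)) = cscale E (smult (poly \<phi>B l) (translate l r)) (\<iota> v)"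
  unfolding \<iota>.scale[symmetric] \<iota>_act V.act_generator by simp_all

lemma ext_formI:
  assumes "\<pi> u = w"
    and "\<And>l. act_at E A l u = cscale E [:poly \<psi>A l:] u + cscale E (poly f [:l:]) (\<iota> v)"
    and "\<And>l. act_at E B l u = cscale E [:poly \<psi>B l:] u + cscale E (poly g [:l:]) (\<iota> v)"
  shows "ext_form E \<iota> \<pi> f g"
  unfolding ext_of_form_def
proof (intro conjI exI[of _ u] ext assms(1) lift_basis[OF assms(1)])
  note act = act_\<iota>v[of _ 1, simplified]
  show "cact E A (\<iota> v) = times_vec (cscale E) (in_lam \<phi>A) (\<iota> v)"
    by (rule E.vec_poly_eqI) (use act(1) in \<open>simp add: act_at_def\<close>)
  show "cact E B (\<iota> v) = times_vec (cscale E) (in_lam \<phi>B) (\<iota> v)"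
    by (rule E.vec_poly_eqI) (use act(2) in \<open>simp add: act_at_def\<close>)
  show "cact E A u = times_vec (cscale E) (in_lam \<psi>A) u + times_vec (cscale E) f (\<iota> v)"
    by (rule E.vec_poly_eqI) (use assms(2) in \<open>simp add: act_at_def E.subst_lam_add\<close>)
  show "cact E B u = times_vec (cscale E) (in_lam \<psi>B) u + times_vec (cscale E) g (\<iota> v)"
    by (rule E.vec_poly_eqI) (use assms(3) in \<open>simp add: act_at_def E.subst_lam_add\<close>)
qed

lemma ext_formE:
  assumes "ext_form E \<iota> \<pi> f g"
  obtains u where "\<pi> u = w"
    "\<And>l r q. act_at E A l (cscale E r (\<iota> v) + cscale E q u) =
       cscale E (smult (poly \<phi>A l) (translate l r) + translate l q * poly f [:l:]) (\<iota> v)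
       + cscale E (smult (poly \<psi>A l) (translate l q)) u"
    "\<And>l r q. act_at E B l (cscale E r (\<iota> v) + cscale E q u) =
       cscale E (smult (poly \<phi>B l) (translate l r) + translate l q * poly g [:l:]) (\<iota> v)
       + cscale E (smult (poly \<psi>B l) (translate l q)) u"
proof -
  from assms obtain u where u: "\<pi> u = w"
    "cact E A u = times_vec (cscale E) (in_lam \<psi>A) u + times_vec (cscale E) f (\<iota> v)"
    "cact E B u = times_vec (cscale E) (in_lam \<psi>B) u + times_vec (cscale E) g (\<iota> v)"
    unfolding ext_of_form_def by blast
  have "act_at E A l u = cscale E [:poly \<psi>A l:] u + cscale E (poly f [:l:]) (\<iota> v)"
    "act_at E B l u = cscale E [:poly \<psi>B l:] u + cscale E (poly g [:l:]) (\<iota> v)" for l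
    by (simp_all add: act_at_def u E.subst_lam_add)
  with u(1) show ?thesis
    by (intro that[of u])
      (simp_all add: E.act_add_right E.act_scale_right[of _ _ _ u] act_\<iota>v E.scale_right_distrib E.scale_left_distrib
        mult.commute add_ac)
qed

text \<open>
  The difference \<open>a\<^sub>\<lambda> u - \<chi>(\<lambda>) u\<close> is killed by \<open>\<pi>\<close>, so all its coefficients are multiples of \<open>\<iota> v\<close>.
\<close>

lemma form_exists: "\<exists>f g. ext_form E \<iota> \<pi> f g"
proof -
  obtain u where u: "\<pi> u = w" using ext unfolding extension_def by (metis surjD)
  have "\<exists>f. \<forall>l. act_at E a l u = cscale E [:poly \<chi> l:] u + cscale E (poly f [:l:]) (\<iota> v)"
    if a: "\<And>l. act_at W a l w = cscale W [:poly \<chi> l:] w" for a \<chi>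
  proof -
    define P where "P = cact E a u - times_vec (cscale E) (in_lam \<chi>) u"
    have ev: "E.ev P l = act_at E a l u - cscale E [:poly \<chi> l:] u" for l
      by (simp add: P_def E.subst_lam_diff act_at_def)
    have "map_poly \<pi> P = 0"
      by (rule W.vec_poly_eqI, unfold subst_lam_hom[OF \<pi>.module_hom_axioms] ev)
        (simp add: \<pi>.diff \<pi>.scale \<pi>_act u a)
    then have z: "\<pi> (coeff P i) = 0" for i by (metis coeff_0 coeff_map_poly \<pi>.zero)
    then have "\<forall>i. \<exists>q. coeff P i = cscale E q (\<iota> v)" using kernel by metis
    then obtain c where c: "\<And>i. coeff P i = cscale E (c i) (\<iota> v)" by metis
    define f where "f = (\<Sum>i\<le>degree P. monom (c i) i)"
    have "P = times_vec (cscale E) f (\<iota> v)"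
    proof (rule poly_eqI)
      fix i
      have "coeff f i = (if i \<le> degree P then c i else 0)" by (simp add: f_def coeff_sum)
      then show "coeff P i = coeff (times_vec (cscale E) f (\<iota> v)) i"
        unfolding times_vec_def by (subst coeff_map_poly) (auto simp: c[symmetric] coeff_eq_0)
    qed
    then have "E.ev P l = cscale E (poly f [:l:]) (\<iota> v)" for l by simp
    then show ?thesis unfolding ev by (intro exI[of _ f]) (simp add: algebra_simps)
  qed
  from this[of A \<psi>A] this[of B \<psi>B] W.act_generator[of _ 1] ext_formI[OF u] show ?thesis by simp metis
qed

text \<open>
  The commutation relations on \<open>u\<close>, with the coefficients of \<open>\<iota> v\<close> compared. Those of \<open>u\<close> only repeat the
  module axiom of the quotient.
\<close>

lemma form_cocycle:
  assumes "ext_form E \<iota> \<pi> f g"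
  shows "is_cocycle f g"
proof -
  from assms obtain u where u: "\<pi> u = w" and act:
    "\<And>l r q. act_at E A l (cscale E r (\<iota> v) + cscale E q u) =
       cscale E (smult (poly \<phi>A l) (translate l r) + translate l q * poly f [:l:]) (\<iota> v)
       + cscale E (smult (poly \<psi>A l) (translate l q)) u"
    "\<And>l r q. act_at E B l (cscale E r (\<iota> v) + cscale E q u) =
       cscale E (smult (poly \<phi>B l) (translate l r) + translate l q * poly g [:l:]) (\<iota> v)
       + cscale E (smult (poly \<psi>B l) (translate l q)) u" by (rule ext_formE) blast
  note eq = E.free_basis_2(2)[OF lift_basis(2,1)[OF u]]
  have sc: "cscale E s (cscale E r (\<iota> v) + cscale E q u) = cscale E (s * r) (\<iota> v) + cscale E (s * q) u"
    "(cscale E r (\<iota> v) + cscale E q u) + (cscale E r' (\<iota> v) + cscale E q' u) =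
      cscale E (r + r') (\<iota> v) + cscale E (q + q') u" for s r q r' q'
    by (simp_all add: E.scale_right_distrib E.scale_left_distrib add_ac)
  note comm = commutators[OF action_E, of _ _ "cscale E 0 (\<iota> v) + cscale E 1 u"]
  note c = comm[unfolded act sc eq, simplified]
  show ?thesis unfolding cocycle_def
    using c(1)[THEN conjunct1] c(2)[THEN conjunct1] c(3)
    by (auto simp: twist_def Q_at_def algebra_simps)
qed

end

section \<open>Equivalence of extensions\<close>

context rank_one_pair begin

text \<open>
  An equivalence fixes \<open>\<iota> v\<close> and sends the lift \<open>u\<close> to some lift \<open>u' + h(\<partial>) \<iota>' v\<close>; it is a homomorphism
  precisely if \<open>f\<close>, \<open>g\<close> change by the coboundary of this \<open>h\<close>.
\<close>

lemma ext_equiv_iff: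
  assumes E: "ext_form E \<iota> \<pi> f g" and E': "ext_form E' \<iota>' \<pi>' f' g'"
  shows "ext_equiv E \<iota> \<pi> E' \<iota>' \<pi>' \<longleftrightarrow> (\<exists>h. f' = f + coboundary \<psi>A \<phi>A h \<and> g' = g + coboundary \<psi>B \<phi>B h)"
proof -
  interpret E: rank_one_ext R A B p Q \<phi>A \<phi>B V v \<psi>A \<psi>B W w E \<iota> \<pi>
    using E by unfold_locales (simp add: ext_of_form_def)
  interpret E': rank_one_ext R A B p Q \<phi>A \<phi>B V v \<psi>A \<psi>B W w E' \<iota>' \<pi>'
    using E' by unfold_locales (simp add: ext_of_form_def)
  from E obtain u where u: "\<pi> u = w" and act:
    "\<And>l r q. act_at E A l (cscale E r (\<iota> v) + cscale E q u) =
       cscale E (smult (poly \<phi>A l) (translate l r) + translate l q * poly f [:l:]) (\<iota> v)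
       + cscale E (smult (poly \<psi>A l) (translate l q)) u"
    "\<And>l r q. act_at E B l (cscale E r (\<iota> v) + cscale E q u) =
       cscale E (smult (poly \<phi>B l) (translate l r) + translate l q * poly g [:l:]) (\<iota> v)
       + cscale E (smult (poly \<psi>B l) (translate l q)) u" by (rule E.ext_formE) blast
  from E' obtain u' where u': "\<pi>' u' = w" and act':
    "\<And>l r q. act_at E' A l (cscale E' r (\<iota>' v) + cscale E' q u') =
       cscale E' (smult (poly \<phi>A l) (translate l r) + translate l q * poly f' [:l:]) (\<iota>' v)
       + cscale E' (smult (poly \<psi>A l) (translate l q)) u'"
    "\<And>l r q. act_at E' B l (cscale E' r (\<iota>' v) + cscale E' q u') =
       cscale E' (smult (poly \<phi>B l) (translate l r) + translate l q * poly g' [:l:]) (\<iota>' v)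
       + cscale E' (smult (poly \<psi>B l) (translate l q)) u'" by (rule E'.ext_formE) blast
  note basis = E.lift_basis(2,1)[OF u] and basis' = E'.lift_basis(2,1)[OF u']
  note eq = E.E.free_basis_2(2)[OF basis] and eq' = E'.E.free_basis_2(2)[OF basis']
  have mk: "cscale E' r (\<iota>' v) + cscale E' q (cscale E' h (\<iota>' v) + u') =
      cscale E' (r + q * h) (\<iota>' v) + cscale E' q u'" for r q h
    by (simp add: E'.E.scale_right_distrib E'.E.scale_left_distrib add_ac)
  have mk2: "cscale E' r (\<iota>' v) + cscale E' q u' + (cscale E' r' (\<iota>' v) + cscale E' q' u') =
      cscale E' (r + r') (\<iota>' v) + cscale E' (q + q') u'"
    "cscale E' s (cscale E' r (\<iota>' v) + cscale E' q u') = cscale E' (s * r) (\<iota>' v) + cscale E' (s * q) u'"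
    for r r' q q' s
    by (simp_all add: E'.E.scale_right_distrib E'.E.scale_left_distrib add_ac)
  show ?thesis
  proof
    assume "ext_equiv E \<iota> \<pi> E' \<iota>' \<pi>'"
    then obtain H where H: "conformal_hom E E' H" "\<And>x. H (\<iota> x) = \<iota>' x" "\<And>x. \<pi>' (H x) = \<pi> x"
      by (auto simp: ext_equiv_def fun_eq_iff)
    interpret H: module_hom "cscale E" "cscale E'" H using H(1) by (simp add: conformal_hom_def)
    have Hact: "act_at E' a l (H x) = H (act_at E a l x)" for a l x
      using H(1) conformal_hom_iff[OF H.module_hom_axioms] by blast
    have "\<pi>' (H u - u') = 0" by (simp add: E'.\<pi>.diff H(3) u u')
    then obtain h where "H u - u' = cscale E' h (\<iota>' v)" by (rule E'.kernel)
    then have "H u = cscale E' h (\<iota>' v) + u'" by (simp add: algebra_simps)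
    then have Hx: "H (cscale E r (\<iota> v) + cscale E q u) = cscale E' (r + q * h) (\<iota>' v) + cscale E' q u'" for r q
      by (simp only: H.add H.scale H(2) mk)
    have "poly f' [:l:] = poly (f + coboundary \<psi>A \<phi>A h) [:l:]" "poly g' [:l:] = poly (g + coboundary \<psi>B \<phi>B h) [:l:]" for l
      using Hact[of A l "cscale E 0 (\<iota> v) + cscale E 1 u"] Hact[of B l "cscale E 0 (\<iota> v) + cscale E 1 u"]
      unfolding act Hx act' eq' by (simp_all add: twist_def algebra_simps)
    then have "f' = f + coboundary \<psi>A \<phi>A h" "g' = g + coboundary \<psi>B \<phi>B h" by (auto intro: poly_poly_eqI)
    then show "\<exists>h. f' = f + coboundary \<psi>A \<phi>A h \<and> g' = g + coboundary \<psi>B \<phi>B h" by blast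
  next
    assume "\<exists>h. f' = f + coboundary \<psi>A \<phi>A h \<and> g' = g + coboundary \<psi>B \<phi>B h"
    then obtain h where h: "f' = f + coboundary \<psi>A \<phi>A h" "g' = g + coboundary \<psi>B \<phi>B h" by blast
    \<comment> \<open>The map is defined through coordinates, whose uniqueness makes it well defined.\<close>
    have "\<exists>H. \<forall>r q. H (cscale E r (\<iota> v) + cscale E q u) = cscale E' (r + q * h) (\<iota>' v) + cscale E' q u'"
    proof (intro exI allI)
      fix r q
      show "(\<lambda>x. THE y. \<exists>r q. x = cscale E r (\<iota> v) + cscale E q u \<and> y = cscale E' (r + q * h) (\<iota>' v) + cscale E' q u')
        (cscale E r (\<iota> v) + cscale E q u) = cscale E' (r + q * h) (\<iota>' v) + cscale E' q u'"
        unfolding eq by (rule the_equality) auto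
    qed
    then obtain H where H: "\<And>r q. H (cscale E r (\<iota> v) + cscale E q u) = cscale E' (r + q * h) (\<iota>' v) + cscale E' q u'"
      by blast
    have sp: "\<exists>r q. x = cscale E r (\<iota> v) + cscale E q u" for x by (rule E.E.free_basis_2(1)[OF basis])
    have hom: "module_hom (cscale E) (cscale E') H"
    proof unfold_locales
      fix x y s
      from sp obtain r q r' q' where x: "x = cscale E r (\<iota> v) + cscale E q u" "y = cscale E r' (\<iota> v) + cscale E q' u"
        by metis
      have xy: "x + y = cscale E (r + r') (\<iota> v) + cscale E (q + q') u"
        "cscale E s x = cscale E (s * r) (\<iota> v) + cscale E (s * q) u"
        by (simp_all add: x E.E.scale_left_distrib E.E.scale_right_distrib add_ac)
      have Hxy: "H x = cscale E' (r + q * h) (\<iota>' v) + cscale E' q u'" "H y = cscale E' (r' + q' * h) (\<iota>' v) + cscale E' q' u'"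
        "H (cscale E (r + r') (\<iota> v) + cscale E (q + q') u) = cscale E' ((r + r') + (q + q') * h) (\<iota>' v) + cscale E' (q + q') u'"
        "H (cscale E (s * r) (\<iota> v) + cscale E (s * q) u) = cscale E' ((s * r) + (s * q) * h) (\<iota>' v) + cscale E' (s * q) u'"
        unfolding x by (rule H)+
      show "H (x + y) = H x + H y" "H (cscale E s x) = cscale E' s (H x)"
        by (simp_all only: xy Hxy mk2 eq') (simp_all add: algebra_simps)
    qed
    interpret H: module_hom "cscale E" "cscale E'" H by (rule hom)
    have gen: "act_at E' A l (H x) = H (act_at E A l x) \<and> act_at E' B l (H x) = H (act_at E B l x)" for l x
    proof -
      from sp obtain r q where x: "x = cscale E r (\<iota> v) + cscale E q u" by metis
      show ?thesis unfolding x H act act' eq' by (simp add: h twist_def smult_add_right algebra_simps)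
    qed
    have "act_at E' a l (H x) = H (act_at E a l x)" for a l x
      by (simp add: act_at_generators[OF E.action_E, of a] act_at_generators[OF E'.action_E, of a] gen H.add H.scale)
    then have "conformal_hom E E' H" using conformal_hom_iff[OF hom] by blast
    moreover have "H (\<iota> x) = \<iota>' x" for x
    proof -
      obtain r where "x = cscale V r v" using V.free_basis_1(1)[OF V.V_basis] by blast
      then show ?thesis using H[of r 0] by (simp add: E.\<iota>.scale E'.\<iota>.scale)
    qed
    moreover have "\<pi>' (H x) = \<pi> x" for x
    proof -
      from sp obtain r q where x: "x = cscale E r (\<iota> v) + cscale E q u" by metis
      show ?thesis unfolding x H by (simp add: E.\<pi>.add E'.\<pi>.add E.\<pi>.scale E'.\<pi>.scale u u')
    qed
    ultimately show "ext_equiv E \<iota> \<pi> E' \<iota>' \<pi>'" unfolding ext_equiv_def by (auto simp: fun_eq_iff)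
  qed
qed

end

section \<open>Extensions constructed from cocycles\<close>

lemma cscale_twisted_sum [simp]: "cscale (twisted_sum V W \<gamma>) q (x, y) = (cscale V q x, cscale W q y)"
  by (simp add: twisted_sum_def)

lemma module_twisted_sum:
  assumes "module (cscale V)" "module (cscale W)"
  shows "module (cscale (twisted_sum V W \<gamma>))"
proof -
  interpret V: module "cscale V" by fact
  interpret W: module "cscale W" by fact
  show ?thesis
    by unfold_locales (auto simp: V.scale_left_distrib V.scale_right_distrib W.scale_left_distrib W.scale_right_distrib)
qed

lemma act_at_twisted_sum:
  assumes "module (cscale V)" "module (cscale W)"
  shows "act_at (twisted_sum V W \<gamma>) a l (x, y) =
    (act_at V a l x + subst_lam (cscale V) (\<gamma> a y) [:l:], act_at W a l y)"
proof -
  let ?E = "twisted_sum V W \<gamma>"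
  interpret V: poly_module "cscale V" using assms by (simp add: poly_module_def)
  interpret W: poly_module "cscale W" using assms by (simp add: poly_module_def)
  interpret E: poly_module "cscale ?E" using module_twisted_sum[OF assms] by (simp add: poly_module_def)
  interpret i: module_hom "cscale V" "cscale ?E" "\<lambda>x. (x, 0)" by unfold_locales auto
  interpret j: module_hom "cscale W" "cscale ?E" "\<lambda>y. (0, y)" by unfold_locales auto
  have "cact ?E a (x, y) = map_poly (\<lambda>x. (x, 0)) (cact V a x + \<gamma> a y) + map_poly (\<lambda>y. (0, y)) (cact W a y)"
    by (simp add: twisted_sum_def)
  then show ?thesis
    by (simp add: act_at_def E.subst_lam_add subst_lam_hom[OF i.module_hom_axioms]
        subst_lam_hom[OF j.module_hom_axioms] V.subst_lam_add)
qed

context rank_one_pair begin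

text \<open>
  The sesquilinear extension of \<open>(f, g)\<close> from the generators \<open>A\<close>, \<open>B\<close> and \<open>w\<close>: for \<open>a = x(\<partial>) A + y(\<partial>) B\<close> the
  value at \<open>q(\<partial>) w\<close> is \<open>(x(-\<lambda>) f + y(-\<lambda>) g) q(\<partial> + \<lambda>) v\<close>.
\<close>

definition cocycle_map :: "complex poly poly \<Rightarrow> complex poly poly \<Rightarrow> 'r \<Rightarrow> 'w \<Rightarrow> 'v poly" where
  "cocycle_map f g a y = times_vec (cscale V)
     ((in_lam (pcompose (coordA a) [:0, - 1:]) * f + in_lam (pcompose (coordB a) [:0, - 1:]) * g) * taylor (W.coord w y)) v"

lemma ev_cocycle_map: "V.ev (cocycle_map f g a y) l = cscale V ((smult (poly (coordA a) (- l)) (poly f [:l:]) +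
    smult (poly (coordB a) (- l)) (poly g [:l:])) * translate l (W.coord w y)) v"
  by (simp add: cocycle_map_def poly_pcompose)

lemma cocycle_map_generators:
  "cocycle_map f g A w = times_vec (cscale V) f v" "cocycle_map f g B w = times_vec (cscale V) g v"
  by (rule V.vec_poly_eqI, simp add: ev_cocycle_map W.coord_linear[OF W.V_basis])+

lemma cocycle_map_eq_iff: "cocycle_map f g = cocycle_map f' g' \<longleftrightarrow> f = f' \<and> g = g'"
  using cocycle_map_generators[of f g] cocycle_map_generators[of f' g'] V.times_vec_inj[OF V.V_basis]
  by metis

lemma modules: "module (cscale V)" "module (cscale W)"
  by (rule V.module_axioms W.module_axioms)+

lemma act_cocycle_sum:
  "act_at (twisted_sum V W (cocycle_map f g)) a l (x, y) =
    (act_at V a l x + cscale V ((smult (poly (coordA a) (- l)) (poly f [:l:]) +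
      smult (poly (coordB a) (- l)) (poly g [:l:])) * translate l (W.coord w y)) v, act_at W a l y)"
  by (simp add: act_at_twisted_sum[OF modules] ev_cocycle_map)

lemma twisted_sum_extension:
  assumes "conformal_action R (twisted_sum V W \<gamma>)" and \<gamma>0: "\<And>a l. V.ev (\<gamma> a 0) l = 0"
  shows "extension R V W (twisted_sum V W \<gamma>) (\<lambda>v. (v, 0)) snd"
proof -
  let ?E = "twisted_sum V W \<gamma>"
  interpret E: module "cscale ?E" using module_twisted_sum[OF modules] .
  have i: "module_hom (cscale V) (cscale ?E) (\<lambda>x. (x, 0))" by unfold_locales auto
  have p: "module_hom (cscale ?E) (cscale W) snd" by unfold_locales auto
  have "conformal_hom V ?E (\<lambda>x. (x, 0))"
    unfolding conformal_hom_iff[OF i] by (simp add: act_at_twisted_sum[OF modules] \<gamma>0)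
  moreover have "conformal_hom ?E W snd"
    unfolding conformal_hom_iff[OF p] by (simp add: act_at_twisted_sum[OF modules] split_paired_all)
  ultimately show ?thesis
    using V.module_V W.module_V lie assms(1) unfolding extension_def conformal_module_def
    by (auto simp: inj_def)
qed

text \<open>
  On \<open>q(\<partial>) w\<close> the commutation relations of the twisted sum differ from those of \<open>V\<close> and \<open>W\<close> by the cocycle
  equations multiplied by \<open>q(\<partial> + \<lambda> + \<mu>)\<close>.
\<close>

lemma cocycle_sum_action:
  assumes "is_cocycle f g"
  shows "conformal_action R (twisted_sum V W (cocycle_map f g))"
proof -
  let ?E = "twisted_sum V W (cocycle_map f g)"
  note wlin = W.coord_linear[OF W.V_basis]
  define \<alpha> where "\<alpha> l = (\<lambda>(x, y). (act_at V A l x + cscale V (poly f [:l:] * translate l (W.coord w y)) v, act_at W A l y))" for l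
  define \<beta> where "\<beta> l = (\<lambda>(x, y). (act_at V B l x + cscale V (poly g [:l:] * translate l (W.coord w y)) v, act_at W B l y))" for l
  have step: "cscale V P v + cscale V P' v = cscale V S v + (cscale V U v + cscale V U' v)" if "P + P' = S + (U + U')" for P P' S U U'
    using that by (simp add: V.scale_left_distrib[symmetric])
  have coc: 
    "smult (poly \<psi>A m) (poly f [:l:]) + smult (poly \<phi>A l) (translate l (poly f [:m:])) = 
     smult (poly \<psi>A l) (poly f [:m:]) + smult (poly \<phi>A m) (translate m (poly f [:l:])) + smult (Q_at l m) (poly g [:l + m:])"
    "smult (poly \<psi>B m) (poly f [:l:]) + smult (poly \<phi>A l) (translate l (poly g [:m:])) = 
     smult (poly \<psi>A l) (poly g [:m:]) + smult (poly \<phi>B m) (translate m (poly f [:l:])) + smult (poly p l) (poly g [:l + m:])"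
    "smult (poly \<psi>B m) (poly g [:l:]) + smult (poly \<phi>B l) (translate l (poly g [:m:])) = 
     smult (poly \<psi>B l) (poly g [:m:]) + smult (poly \<phi>B m) (translate m (poly g [:l:]))" for l m
    using assms unfolding cocycle_def twist_def Q_at_def by (simp_all add: algebra_simps)
  show ?thesis
  proof (rule conformal_action_from_generators[where \<alpha> = \<alpha> and \<beta> = \<beta>])
    show "module (cscale ?E)" by (rule module_twisted_sum[OF modules])
    fix l k a m n q
    show "\<alpha> l (m + n) = \<alpha> l m + \<alpha> l n" "\<beta> l (m + n) = \<beta> l m + \<beta> l n"
      by (cases m; cases n; simp add: \<alpha>_def \<beta>_def V.act_add_right W.act_add_right wlin V.scale_left_distrib distrib_left)+
    show "\<alpha> l (cscale ?E q m) = cscale ?E (translate l q) (\<alpha> l m)"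
      "\<beta> l (cscale ?E q m) = cscale ?E (translate l q) (\<beta> l m)"
      by (cases m; simp add: \<alpha>_def \<beta>_def V.act_scale_right W.act_scale_right wlin V.scale_right_distrib mult_ac)+
    show "act_at ?E a l m = cscale ?E [:poly (coordA a) (- l):] (\<alpha> l m) + cscale ?E [:poly (coordB a) (- l):] (\<beta> l m)"
      by (cases m; simp add: \<alpha>_def \<beta>_def act_cocycle_sum act_at_generators[OF V.action, of a] act_at_generators[OF W.action, of a]
           V.scale_right_distrib V.scale_left_distrib distrib_right add_ac)
    obtain x y where m: "m = (x, y)" by (cases m)
    define q where "q = W.coord w y"
    have c1: "\<alpha> l (\<alpha> k m) = (act_at V A l (act_at V A k x) +
        cscale V ((smult (poly \<psi>A k) (poly f [:l:]) + smult (poly \<phi>A l) (translate l (poly f [:k:]))) * translate (l + k) q) v,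
        act_at W A l (act_at W A k y))" for l k
      by (simp add: m \<alpha>_def V.act_add_right V.act_generator W.coord_act q_def V.scale_left_distrib distrib_right distrib_left mult_ac)
    show "\<alpha> l (\<alpha> k m) = cscale ?E [:Q_at l k:] (\<beta> (l + k) m) + \<alpha> k (\<alpha> l m)"
      using c1[of l k, unfolded coc(1)[of k l]] c1[of k l]
      by (simp add: m \<beta>_def q_def[symmetric] V.scale_left_distrib V.scale_right_distrib distrib_right
        commutators(1)[OF V.action, of l k] commutators(1)[OF W.action, of l k] add_ac)
    have c2: "\<alpha> l (\<beta> k m) = (act_at V A l (act_at V B k x) +
        cscale V ((smult (poly \<psi>B k) (poly f [:l:]) + smult (poly \<phi>A l) (translate l (poly g [:k:]))) * translate (l + k) q) v,
        act_at W A l (act_at W B k y))"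
     "\<beta> k (\<alpha> l m) = (act_at V B k (act_at V A l x) +
        cscale V ((smult (poly \<psi>A l) (poly g [:k:]) + smult (poly \<phi>B k) (translate k (poly f [:l:]))) * translate (l + k) q) v,
        act_at W B k (act_at W A l y))"
      by (simp_all add: m \<alpha>_def \<beta>_def V.act_add_right V.act_generator W.coord_act q_def V.scale_left_distrib distrib_right distrib_left mult_ac add_ac)
    show "\<alpha> l (\<beta> k m) = cscale ?E [:poly p l:] (\<beta> (l + k) m) + \<beta> k (\<alpha> l m)"
      using c2(1)[unfolded coc(2)[of k l]] c2(2)
      by (simp add: m \<beta>_def q_def[symmetric] V.scale_left_distrib V.scale_right_distrib distrib_right
        commutators(2)[OF V.action, of l k] commutators(2)[OF W.action, of l k] add_ac)
    have c3: "\<beta> l (\<beta> k m) = (act_at V B l (act_at V B k x) +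
        cscale V ((smult (poly \<psi>B k) (poly g [:l:]) + smult (poly \<phi>B l) (translate l (poly g [:k:]))) * translate (l + k) q) v,
        act_at W B l (act_at W B k y))" for l k
      by (simp add: m \<beta>_def V.act_add_right V.act_generator W.coord_act q_def V.scale_left_distrib distrib_right distrib_left mult_ac)
    show "\<beta> l (\<beta> k m) = \<beta> k (\<beta> l m)"
      using c3[of l k, unfolded coc(3)[of k l]] c3[of k l]
      by (simp add: commutators(3)[OF V.action, of l k] commutators(3)[OF W.action, of l k] add_ac)
  qed
qed

lemma cocycle_sum_form:
  assumes "is_cocycle f g"
  shows "ext_form (twisted_sum V W (cocycle_map f g)) (\<lambda>v. (v, 0)) snd f g"
proof -
  note wlin = W.coord_linear[OF W.V_basis]
  have "extension R V W (twisted_sum V W (cocycle_map f g)) (\<lambda>v. (v, 0)) snd"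
    by (rule twisted_sum_extension[OF cocycle_sum_action[OF assms]]) (simp add: ev_cocycle_map wlin)
  then interpret E: rank_one_ext R A B p Q \<phi>A \<phi>B V v \<psi>A \<psi>B W w "twisted_sum V W (cocycle_map f g)" "\<lambda>v. (v, 0)" snd
    by unfold_locales
  show ?thesis
    by (rule E.ext_formI[of "(0, w)"])
     (use W.act_generator[of _ 1] in \<open>simp_all add: act_cocycle_sum wlin\<close>)
qed

lemma cocycle_0: "is_cocycle 0 0"
  by (simp add: cocycle_def twist_simps)

lemma direct_sum_form: "ext_form (direct_sum V W) (\<lambda>v. (v, 0)) snd 0 0"
proof -
  have "direct_sum V W = twisted_sum V W (cocycle_map 0 0)"
    by (simp add: direct_sum_def cocycle_map_def[abs_def] times_vec_def)
  then show ?thesis using cocycle_sum_form[OF cocycle_0] by simp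
qed

lemma trivial_ext_iff:
  assumes "ext_form E \<iota> \<pi> f g"
  shows "trivial_ext V W E \<iota> \<pi> \<longleftrightarrow> (\<exists>h. f = coboundary \<psi>A \<phi>A h \<and> g = coboundary \<psi>B \<phi>B h)"
proof -
  have "trivial_ext V W E \<iota> \<pi> \<longleftrightarrow> (\<exists>h. 0 = f + coboundary \<psi>A \<phi>A h \<and> 0 = g + coboundary \<psi>B \<phi>B h)"
    unfolding trivial_ext_def by (rule ext_equiv_iff[OF assms direct_sum_form])
  also have "\<dots> \<longleftrightarrow> (\<exists>h. f = coboundary \<psi>A \<phi>A (- h) \<and> g = coboundary \<psi>B \<phi>B (- h))"
    by (simp add: coboundary_linear eq_neg_iff_add_eq_0 eq_commute[of 0])
  also have "\<dots> \<longleftrightarrow> (\<exists>h. f = coboundary \<psi>A \<phi>A h \<and> g = coboundary \<psi>B \<phi>B h)" by (metis minus_minus)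
  finally show ?thesis .
qed

text \<open>
  A cocycle is determined by its values at \<open>(A, w)\<close> and \<open>(B, w)\<close>, because the action on the twisted sum is
  sesquilinear.
\<close>

lemma ext_cocycles_eq: "ext_cocycles R V W = {cocycle_map f g | f g. is_cocycle f g}"
proof (intro set_eqI iffI)
  fix \<gamma> assume "\<gamma> \<in> ext_cocycles R V W"
  then interpret E: rank_one_ext R A B p Q \<phi>A \<phi>B V v \<psi>A \<psi>B W w "twisted_sum V W \<gamma>" "\<lambda>v. (v, 0)" snd
    by unfold_locales (simp add: ext_cocycles_def)
  let ?E = "twisted_sum V W \<gamma>"
  obtain f where f: "\<gamma> A w = times_vec (cscale V) f v" by (rule V.vec_poly_eq_times_vec[OF V.V_basis])
  obtain g where g: "\<gamma> B w = times_vec (cscale V) g v" by (rule V.vec_poly_eq_times_vec[OF V.V_basis])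
  have "ext_form ?E (\<lambda>v. (v, 0)) snd f g"
    by (rule E.ext_formI[of "(0, w)"])
      (use W.act_generator[of _ 1] in \<open>simp_all add: act_at_twisted_sum[OF modules] f g\<close>)
  then have "is_cocycle f g" by (rule E.form_cocycle)
  moreover have "\<gamma> = cocycle_map f g"
  proof (intro ext V.vec_poly_eqI)
    fix a y l
    have ev: "V.ev (\<gamma> b z) l = fst (act_at ?E b l (0, z))" for b z
      by (simp add: act_at_twisted_sum[OF modules])
    define q where "q = W.coord w y"
    have y: "(0, y) = cscale ?E q (0, w)" using W.coord(1)[OF W.V_basis] by (simp add: q_def)
    have fst_scale: "fst (cscale ?E s z) = cscale V s (fst z)" for s z by (cases z) simp
    have "V.ev (\<gamma> a y) l = cscale V [:poly (coordA a) (- l):] (cscale V (translate l q) (V.ev (\<gamma> A w) l)) +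
        cscale V [:poly (coordB a) (- l):] (cscale V (translate l q) (V.ev (\<gamma> B w) l))"
      unfolding ev y by (subst act_at_generators[OF E.action_E]) (simp only: E.E.act_scale_right fst_scale fst_add)
    then show "V.ev (\<gamma> a y) l = V.ev (cocycle_map f g a y) l"
      unfolding ev_cocycle_map f g q_def by (simp add: V.scale_left_distrib distrib_right distrib_left mult_ac)
  qed
  ultimately show "\<gamma> \<in> {cocycle_map f g | f g. is_cocycle f g}" by blast
qed (use cocycle_sum_form in \<open>auto simp: ext_cocycles_def ext_of_form_def\<close>)

lemma trivial_cocycles_eq:
  "trivial_cocycles R V W = {cocycle_map (coboundary \<psi>A \<phi>A h) (coboundary \<psi>B \<phi>B h) | h. is_cocycle (coboundary \<psi>A \<phi>A h) (coboundary \<psi>B \<phi>B h)}"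
  unfolding trivial_cocycles_def ext_cocycles_eq using trivial_ext_iff[OF cocycle_sum_form] by auto

end

section \<open>Cocycles of an abelian algebra\<close>

text \<open>
  The parameter at which a cocycle is normalised must be nonzero, since translation by \<open>0\<close> is trivial.
\<close>

lemma poly_nonzero_point:
  fixes q :: "complex poly"
  assumes "q \<noteq> 0"
  obtains c where "c \<noteq> 0" "poly q c \<noteq> 0"
proof -
  from assms have "[:0, 1:] * q \<noteq> 0" by simp
  then obtain c where "poly ([:0, 1:] * q) c \<noteq> 0" using poly_all_0_iff_0 by blast
  then show ?thesis using that[of c] by auto
qed

text \<open>
  Choose \<open>h\<close> so that subtracting its coboundary makes the component \<open>Y\<close> vanish at \<open>\<lambda> = c\<close>. The relation
  between the components \<open>X\<close> at \<open>l\<close> and \<open>Y\<close> at \<open>c\<close> then loses its right side.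
\<close>

lemma commuting_cocycle_gauge:
  fixes \<Phi> \<Psi> :: "'i \<Rightarrow> complex poly" and F :: "'i \<Rightarrow> complex poly poly"
  assumes coc: "\<And>X Y l m. twist (poly (\<Psi> Y) m) (poly (\<Phi> Y) m) m (poly (F X) [:l:]) =
      twist (poly (\<Psi> X) l) (poly (\<Phi> X) l) l (poly (F Y) [:m:])"
    and "c \<noteq> 0" "poly (\<Psi> Y) c \<noteq> 0 \<or> poly (\<Phi> Y) c \<noteq> 0"
  obtains h where "\<And>X l. twist (poly (\<Psi> Y) c) (poly (\<Phi> Y) c) c (poly (F X - coboundary (\<Psi> X) (\<Phi> X) h) [:l:]) = 0"
proof -
  obtain h where "twist (poly (\<Psi> Y) c) (poly (\<Phi> Y) c) c h = poly (F Y) [:c:]"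
    using twist_surj[OF assms(2,3)] by blast
  then have "twist (poly (\<Psi> Y) c) (poly (\<Phi> Y) c) c (poly (F X - coboundary (\<Psi> X) (\<Phi> X) h) [:l:]) = 0" for X l
    using coc[of Y c X l] twist_commute[of "poly (\<Psi> Y) c" "poly (\<Phi> Y) c" c "poly (\<Psi> X) l" "poly (\<Phi> X) l" l h]
    by (simp add: twist_simps)
  then show ?thesis by (rule that)
qed

lemma commuting_cocycle_distinct:
  fixes \<Phi> \<Psi> :: "'i \<Rightarrow> complex poly" and F :: "'i \<Rightarrow> complex poly poly"
  assumes coc: "\<And>X Y l m. twist (poly (\<Psi> Y) m) (poly (\<Phi> Y) m) m (poly (F X) [:l:]) =
      twist (poly (\<Psi> X) l) (poly (\<Phi> X) l) l (poly (F Y) [:m:])"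
    and "\<Psi> Y \<noteq> \<Phi> Y"
  shows "\<exists>h. \<forall>X. F X = coboundary (\<Psi> X) (\<Phi> X) h"
proof -
  obtain c where c: "c \<noteq> 0" "poly (\<Psi> Y - \<Phi> Y) c \<noteq> 0" using poly_nonzero_point assms(2) by (metis right_minus_eq)
  obtain h where h: "\<And>X l. twist (poly (\<Psi> Y) c) (poly (\<Phi> Y) c) c (poly (F X - coboundary (\<Psi> X) (\<Phi> X) h) [:l:]) = 0"
    by (rule commuting_cocycle_gauge[where Y = Y and \<Psi> = \<Psi> and \<Phi> = \<Phi> and F = F, OF coc c(1)]) (use c(2) in auto)
  have "poly (F X - coboundary (\<Psi> X) (\<Phi> X) h) [:l:] = 0" for X l
    by (rule twist_eq_0_imp_0[OF _ h]) (use c(2) in auto)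
  then have "F X = coboundary (\<Psi> X) (\<Phi> X) h" for X by (intro poly_poly_eqI) simp
  then show ?thesis by blast
qed

lemma commuting_cocycle_equal:
  fixes \<Phi> :: "'i \<Rightarrow> complex poly" and F :: "'i \<Rightarrow> complex poly poly"
  assumes coc: "\<And>X Y l m. twist (poly (\<Phi> Y) m) (poly (\<Phi> Y) m) m (poly (F X) [:l:]) =
      twist (poly (\<Phi> X) l) (poly (\<Phi> X) l) l (poly (F Y) [:m:])"
    and "\<Phi> Y \<noteq> 0"
  shows "\<exists>h s. \<forall>X. F X = in_lam (s X) + coboundary (\<Phi> X) (\<Phi> X) h"
proof -
  obtain c where c: "c \<noteq> 0" "poly (\<Phi> Y) c \<noteq> 0" using poly_nonzero_point assms(2) by metis
  obtain h where h: "\<And>X l. twist (poly (\<Phi> Y) c) (poly (\<Phi> Y) c) c (poly (F X - coboundary (\<Phi> X) (\<Phi> X) h) [:l:]) = 0"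
    by (rule commuting_cocycle_gauge[where Y = Y and \<Psi> = \<Phi> and \<Phi> = \<Phi> and F = F, OF coc c(1)]) (use c(2) in auto)
  have "\<exists>s. F X - coboundary (\<Phi> X) (\<Phi> X) h = in_lam s" for X
  proof -
    have "degree (poly (F X - coboundary (\<Phi> X) (\<Phi> X) h) [:l:]) = 0" for l
      using twist_eq_0_imp_const[OF c(1) _ h] c(2) by (metis degree_pCons_0)
    then show ?thesis using const_coeffs_imp_in_lam by blast
  qed
  then obtain s where "\<And>X. F X - coboundary (\<Phi> X) (\<Phi> X) h = in_lam (s X)" by metis
  then have "F X = in_lam (s X) + coboundary (\<Phi> X) (\<Phi> X) h" for X by (metis diff_add_cancel)
  then show ?thesis by blast
qed

text \<open>
  The two preceding lemmas for the family indexed by the generators \<open>A\<close>, \<open>B\<close>. With \<open>\<phi>\<^sub>B = \<psi>\<^sub>B = 0\<close> and \<open>g = 0\<close> it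
  also treats a single generator, and in this form it serves the other cases.
\<close>

lemma cocycle_abelian:
  assumes "cocycle 0 0 \<phi>A \<phi>B \<psi>A \<psi>B f g" "\<phi>A \<noteq> 0 \<or> \<phi>B \<noteq> 0"
  shows "(\<exists>h. f = coboundary \<psi>A \<phi>A h \<and> g = coboundary \<psi>B \<phi>B h) \<or>
    \<phi>A = \<psi>A \<and> \<phi>B = \<psi>B \<and> (\<exists>h s t. f = in_lam s + coboundary \<psi>A \<phi>A h \<and> g = in_lam t + coboundary \<psi>B \<phi>B h)"
proof -
  let ?\<Phi> = "\<lambda>b. if b then \<phi>A else \<phi>B" and ?\<Psi> = "\<lambda>b. if b then \<psi>A else \<psi>B" and ?F = "\<lambda>b. if b then f else g"
  have coc: "twist (poly (?\<Psi> Y) m) (poly (?\<Phi> Y) m) m (poly (?F X) [:l:]) =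
      twist (poly (?\<Psi> X) l) (poly (?\<Phi> X) l) l (poly (?F Y) [:m:])" for X Y l m
    using assms(1) by (auto simp: cocycle_def)
  show ?thesis
  proof (cases "\<phi>A = \<psi>A \<and> \<phi>B = \<psi>B")
    case True
    have coc': "twist (poly (?\<Phi> Y) m) (poly (?\<Phi> Y) m) m (poly (?F X) [:l:]) =
      twist (poly (?\<Phi> X) l) (poly (?\<Phi> X) l) l (poly (?F Y) [:m:])" for X Y l m
      using coc[of Y m X l] True by (simp split: if_splits)
    have "(if \<phi>A \<noteq> 0 then \<phi>A else \<phi>B) \<noteq> 0" using assms(2) by simp
    from commuting_cocycle_equal[where \<Phi> = ?\<Phi> and F = ?F and Y = "\<phi>A \<noteq> 0", OF coc' this]
    obtain h s where "\<And>X. ?F X = in_lam (s X) + coboundary (?\<Phi> X) (?\<Phi> X) h" by auto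
    from this[of True] this[of False] True show ?thesis by auto
  next
    case False
    then have "(if \<psi>A \<noteq> \<phi>A then \<psi>A else \<psi>B) \<noteq> (if \<psi>A \<noteq> \<phi>A then \<phi>A else \<phi>B)" by auto
    from commuting_cocycle_distinct[where \<Psi> = ?\<Psi> and \<Phi> = ?\<Phi> and F = ?F and Y = "\<psi>A \<noteq> \<phi>A", OF coc this]
    obtain h where "\<forall>X. ?F X = coboundary (?\<Psi> X) (?\<Phi> X) h" by blast
    then have "\<And>X. ?F X = coboundary (?\<Psi> X) (?\<Phi> X) h" by blast
    from this[of True] this[of False] show ?thesis by auto
  qed
qed

lemma coboundary_of_affine: "coboundary \<phi> \<phi> [:d, c:] = in_lam (smult (- c) ([:0, 1:] * \<phi>))"
  by (rule poly_poly_eqI) (simp add: twist_def algebra_simps)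

lemma coboundary_in_lam_imp_affine:
  assumes "\<phi> \<noteq> 0" "coboundary \<phi> \<phi> h = in_lam s"
  obtains c where "h = [:poly h 0, c:]"
proof -
  obtain l where l: "l \<noteq> 0" "poly \<phi> l \<noteq> 0" using poly_nonzero_point assms(1) by metis
  have "smult (poly \<phi> l) (h - translate l h) = [:poly s l:]"
    using arg_cong[OF assms(2), of "\<lambda>f. poly f [:l:]"] by (simp add: twist_def smult_diff_right)
  then have "smult (- 1 / poly \<phi> l) (smult (poly \<phi> l) (h - translate l h)) = [:- poly s l / poly \<phi> l:]" by simp
  then have "translate l h - h = [:- poly s l / poly \<phi> l:]" using l(2) by simp
  from translate_step_const_imp_affine[OF l(1) this] that show ?thesis by blast
qed

text \<open>
  If the coboundary of \<open>h\<close> does not involve \<open>\<partial>\<close>, then \<open>h\<close> has constant differences, so it is affine, and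
  the coboundary of \<open>c \<partial> + d\<close> is \<open>- c \<lambda> \<phi>(\<lambda>)\<close>.
\<close>

lemma in_lam_coboundary_iff:
  assumes "\<phi>A \<noteq> 0 \<or> \<phi>B \<noteq> 0"
  shows "(\<exists>h. in_lam s = coboundary \<phi>A \<phi>A h \<and> in_lam t = coboundary \<phi>B \<phi>B h) \<longleftrightarrow>
    (\<exists>c. s = smult c ([:0, 1:] * \<phi>A) \<and> t = smult c ([:0, 1:] * \<phi>B))"
proof
  assume "\<exists>h. in_lam s = coboundary \<phi>A \<phi>A h \<and> in_lam t = coboundary \<phi>B \<phi>B h"
  then obtain h where h: "in_lam s = coboundary \<phi>A \<phi>A h" "in_lam t = coboundary \<phi>B \<phi>B h" by blast
  obtain c where "h = [:poly h 0, c:]" using assms coboundary_in_lam_imp_affine h by metis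
  with h coboundary_of_affine have "s = smult (- c) ([:0, 1:] * \<phi>A) \<and> t = smult (- c) ([:0, 1:] * \<phi>B)"
    by (metis in_lam_simps(3))
  then show "\<exists>c. s = smult c ([:0, 1:] * \<phi>A) \<and> t = smult c ([:0, 1:] * \<phi>B)" by blast
next
  assume "\<exists>c. s = smult c ([:0, 1:] * \<phi>A) \<and> t = smult c ([:0, 1:] * \<phi>B)"
  then obtain c where "s = smult c ([:0, 1:] * \<phi>A)" "t = smult c ([:0, 1:] * \<phi>B)" by blast
  then have "in_lam s = coboundary \<phi>A \<phi>A [:0, - c:] \<and> in_lam t = coboundary \<phi>B \<phi>B [:0, - c:]" unfolding coboundary_of_affine by simp
  then show "\<exists>h. in_lam s = coboundary \<phi>A \<phi>A h \<and> in_lam t = coboundary \<phi>B \<phi>B h" by blast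
qed

lemma twist_const [simp]: "twist a a c [:k:] = 0"
  by (simp add: twist_def)

lemma in_lam_cocycle:
  assumes "p = 0 \<and> Q = 0 \<or> t = 0"
  shows "cocycle p Q \<phi>A \<phi>B \<phi>A \<phi>B (in_lam s) (in_lam t)"
  using assms by (auto simp: cocycle_def)

text \<open>
  The equation for \<open>(A, B)\<close> has this form when \<open>p = 0\<close> and \<open>B\<close> acts by zero on both modules.
\<close>

lemma killed_component:
  assumes "\<And>l m. twist (poly \<psi> l) (poly \<phi> l) l (poly g [:m:]) = 0" "\<phi> \<noteq> 0" "g \<noteq> 0"
  shows "\<phi> = \<psi> \<and> (\<exists>t. g = in_lam t)"
proof -
  have "\<phi> = \<psi>"
  proof (rule ccontr)
    assume "\<phi> \<noteq> \<psi>"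
    then obtain c where "poly (\<psi> - \<phi>) c \<noteq> 0" using poly_nonzero_point by (metis right_minus_eq)
    then have "poly g [:m:] = 0" for m by (intro twist_eq_0_imp_0[OF _ assms(1)]) auto
    then have "g = 0" by (intro poly_poly_eqI) simp
    with assms(3) show False by simp
  qed
  moreover obtain c where c: "c \<noteq> 0" "poly \<phi> c \<noteq> 0" using poly_nonzero_point assms(2) by metis
  have "degree (poly g [:m:]) = 0" for m
    using twist_eq_0_imp_const[OF c(1) _ assms(1)] c(2) by (metis degree_pCons_0)
  then have "\<exists>t. g = in_lam t" using const_coeffs_imp_in_lam by blast
  ultimately show ?thesis by blast
qed

section \<open>Cocycles when \<open>p = 0\<close> and \<open>Q \<noteq> 0\<close>\<close>

lemma poly_structure_poly2:
  "poly (poly (structure_poly2 Q t) [:m:]) l = poly (poly Q [:l:]) (- l - m) * poly t (l + m)"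
proof -
  have "poly (poly (poly (map_poly (\<lambda>q. pcompose (in_lam q) [:[:0, - 1:], - 1:]) Q) [:[:0, 1:]:]) [:m:]) l
      = poly (poly Q [:l:]) (- l - m)"
    by (induction Q) (auto simp: map_poly_pCons poly_pcompose poly_in_lam algebra_simps)
  then show ?thesis by (simp add: structure_poly2_def poly_pcompose poly_in_lam algebra_simps)
qed

text \<open>
  After the gauge that makes \<open>f\<close> vanish at \<open>\<lambda> = c\<close>, the difference of \<open>f\<close> in \<open>\<partial>\<close> with step \<open>c\<close> is the
  constant polynomial given by \<open>P\<close>, so \<open>f\<close> is affine in \<open>\<partial>\<close>.
\<close>

lemma cocycle_normalize_affine:
  assumes f: "\<And>l m. twist (poly \<phi> m) (poly \<phi> m) m (poly f [:l:]) - twist (poly \<phi> l) (poly \<phi> l) l (poly f [:m:]) = [:P l m:]"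
    and "\<phi> \<noteq> 0"
  shows "\<exists>h \<alpha> s. f = in_lam \<alpha> * [:[:0, 1:]:] + in_lam s + coboundary \<phi> \<phi> h"
proof -
  obtain c where c: "c \<noteq> 0" "poly \<phi> c \<noteq> 0" using poly_nonzero_point assms(2) by metis
  obtain h where h: "twist (poly \<phi> c) (poly \<phi> c) c h = poly f [:c:]" using twist_surj c by blast
  let ?f = "f - coboundary \<phi> \<phi> h"
  have "degree (poly ?f [:l:]) \<le> 1" for l
  proof -
    have "twist (poly \<phi> c) (poly \<phi> c) c (poly ?f [:l:]) = [:P l c:]"
      using f[of c l] h twist_commute[of "poly \<phi> c" "poly \<phi> c" c "poly \<phi> l" "poly \<phi> l" l h]
      by (simp add: twist_simps)
    then have "smult (- 1 / poly \<phi> c) (smult (poly \<phi> c) (poly ?f [:l:] - translate c (poly ?f [:l:]))) = [:- P l c / poly \<phi> c:]"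
      by (simp add: twist_def smult_diff_right)
    then have "translate c (poly ?f [:l:]) - poly ?f [:l:] = [:- P l c / poly \<phi> c:]" using c(2) by simp
    from translate_step_const_imp_affine[OF c(1) this] show ?thesis by (metis degree_pCons_le degree_pCons_0 One_nat_def)
  qed
  then obtain \<alpha> s where "?f = in_lam \<alpha> * [:[:0, 1:]:] + in_lam s" by (rule affine_coeffs_imp_form)
  then have "f = in_lam \<alpha> * [:[:0, 1:]:] + in_lam s + coboundary \<phi> \<phi> h" by (metis diff_add_cancel)
  then show ?thesis by blast
qed

lemma twist_affine:
  "twist (poly \<phi> m) (poly \<phi> m) m (poly (in_lam \<alpha> * [:[:0, 1:]:] + in_lam s) [:l:]) = [:- (m * poly \<phi> m * poly \<alpha> l):]"
  by (simp add: twist_def algebra_simps)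

lemma bivariate_eqI:
  fixes f g :: "complex poly poly"
  assumes "\<And>l x. poly (poly f [:l:]) x = poly (poly g [:l:]) x"
  shows "f = g"
  using assms by (intro poly_poly_eqI) (simp add: poly_eq_poly_eq_iff[symmetric] fun_eq_iff)

text \<open>
  The polynomial \<open>T\<close> of the proof is \<open>S\<close> with its two indeterminates exchanged.
\<close>

lemma skew_coeffs:
  fixes S :: "complex poly poly"
  assumes "\<And>l m. poly (poly S [:m:]) l = - poly (poly S [:l:]) m"
  shows "coeff (coeff S j) i = - coeff (coeff S i) j"
proof -
  define T where "T = (\<Sum>k\<le>degree S. in_lam (coeff S k) * [:monom 1 k:])"
  have "S = - T"
  proof (rule bivariate_eqI)
    fix m l
    have "poly (poly T [:m:]) l = poly (poly S [:l:]) m"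
      by (simp add: T_def poly_sum poly_monom poly_altdef[of S] poly_const_pow mult.commute)
    then show "poly (poly S [:m:]) l = poly (poly (- T) [:m:]) l" using assms[of m l] by simp
  qed
  moreover have "coeff (coeff T j) i = coeff (coeff S i) j" 
  proof -
    have "coeff (coeff T j) i = (\<Sum>k\<le>degree S. if k = i then coeff (coeff S k) j else 0)"
      by (simp only: T_def coeff_sum) (rule sum.cong, auto)
    also have "\<dots> = coeff (coeff S i) j" by (subst sum.delta) (auto simp: coeff_eq_0)
    finally show ?thesis .
  qed
  ultimately show ?thesis by simp
qed

text \<open>
  With the indeterminates \<open>\<lambda>\<close> and \<open>\<mu>\<close> this says \<open>Q(-\<lambda>-\<mu>, \<lambda>) t(\<lambda>+\<mu>) = X(\<lambda>) \<alpha>(\<mu>) - \<alpha>(\<lambda>) X(\<mu>)\<close>, or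
  \<open>M = X \<and> \<alpha>\<close> for the coefficient matrix \<open>M\<close> of the left side.
\<close>

definition wedge :: "complex poly poly \<Rightarrow> complex poly \<Rightarrow> complex poly \<Rightarrow> complex poly \<Rightarrow> bool" where
  "wedge Q t X \<alpha> \<longleftrightarrow> (\<forall>l m. poly (poly Q [:l:]) (- l - m) * poly t (l + m) = poly X l * poly \<alpha> m - poly \<alpha> l * poly X m)"

lemma wedge_M_col:
  assumes "wedge Q t X \<alpha>"
  shows "M_col Q t j = smult (coeff \<alpha> j) X - smult (coeff X j) \<alpha>"
proof -
  have "structure_poly2 Q t = [:X:] * in_lam \<alpha> - [:\<alpha>:] * in_lam X"
    using assms by (intro bivariate_eqI) (simp add: poly_structure_poly2 wedge_def)
  then show ?thesis by (simp add: M_col_def mult.commute)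
qed

context
  fixes Q :: "complex poly poly" and t :: "complex poly"
  assumes skew: "\<And>l m. poly (poly Q [:m:]) (- m - l) = - poly (poly Q [:l:]) (- l - m)"
begin

lemma M_entry_skew: "M_entry Q t j i = - M_entry Q t i j"
  unfolding M_entry_def M_col_def
proof (rule skew_coeffs)
  show "poly (poly (structure_poly2 Q t) [:m:]) l = - poly (poly (structure_poly2 Q t) [:l:]) m" for l m
    unfolding poly_structure_poly2 using skew[of m l] by (simp add: add.commute)
qed

lemma M_entry_diag [simp]: "M_entry Q t i i = 0"
  using M_entry_skew[of i i] by simp

text \<open>
  The left side is a product of nonzero factors, so some entry is nonzero. It is off the diagonal by
  skew-symmetry, which also allows exchanging \<open>i\<close> and \<open>j\<close>.
\<close>

lemma M_entry_nonzero_exists: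
  assumes "Q \<noteq> 0" "t \<noteq> 0"
  obtains i j where "i < j" "M_entry Q t i j \<noteq> 0"
proof -
  obtain l where l: "poly Q [:l:] \<noteq> 0" using assms(1) poly_poly_eqI[of Q 0] by auto
  have "pcompose (poly Q [:l:]) [:- l, - 1:] * translate l t \<noteq> 0"
    using l assms(2) degree_translate[of l t] by (auto simp: pcompose_eq_0_iff translate_def)
  then obtain m where "poly (pcompose (poly Q [:l:]) [:- l, - 1:] * translate l t) m \<noteq> 0"
    using poly_all_0_iff_0 by blast
  then have "poly (poly (structure_poly2 Q t) [:m:]) l \<noteq> 0"
    by (simp add: poly_structure_poly2 poly_pcompose add.commute)
  then have "structure_poly2 Q t \<noteq> 0" by auto
  then obtain i j where ij: "M_entry Q t i j \<noteq> 0"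
    unfolding M_entry_def M_col_def by (metis leading_coeff_0_iff)
  then consider "i < j" | "j < i" by (metis M_entry_diag linorder_neqE_nat)
  then show ?thesis using ij that[of i j] that[of j i] M_entry_skew[of j i] by cases auto
qed

interpretation cpoly: vector_space "smult :: complex \<Rightarrow> complex poly \<Rightarrow> complex poly"
  by unfold_locales (auto simp: smult_add_right smult_add_left)

text \<open>
  The diagonal entry in row \<open>i\<close> vanishes and the entry in column \<open>j\<close> does not.
\<close>

lemma columns_independent:
  assumes "M_entry Q t i j \<noteq> 0"
  shows "cpoly.independent {M_col Q t i, M_col Q t j}" "M_col Q t i \<noteq> M_col Q t j"
proof -
  have z: "coeff (M_col Q t i) i = 0" using M_entry_diag[of i] by (simp add: M_entry_def)
  have nz: "coeff (M_col Q t j) i \<noteq> 0" using assms by (simp add: M_entry_def)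
  have "coeff (M_col Q t i) j \<noteq> 0" using assms M_entry_skew[of j i] by (simp add: M_entry_def)
  then have nz': "M_col Q t i \<noteq> 0" by auto
  show "M_col Q t i \<noteq> M_col Q t j" using z nz by auto
  have "M_col Q t j \<notin> cpoly.span {M_col Q t i}" using z nz by (auto simp: cpoly.span_singleton)
  then have "cpoly.independent {M_col Q t j, M_col Q t i}"
    using nz' by (simp add: cpoly.independent_insert)
  then show "cpoly.independent {M_col Q t i, M_col Q t j}" by (simp add: insert_commute)
qed

text \<open>
  If \<open>M = X \<and> \<alpha>\<close>, then column \<open>j\<close> is \<open>\<alpha>\<^sub>j X - X\<^sub>j \<alpha>\<close>. Two columns with nonzero minor \<open>q\<^sub>i\<^sub>j\<close> can be solved for
  \<open>X\<close> and \<open>\<alpha>\<close>, so they span the column space.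
\<close>

lemma wedge_rank_two:
  assumes w: "wedge Q t X \<alpha>" and q: "M_entry Q t i j \<noteq> 0"
  shows "smult (M_entry Q t i j) X = smult (coeff X i) (M_col Q t j) - smult (coeff X j) (M_col Q t i)"
    and "M_rank Q t = 2"
proof -
  let ?q = "M_entry Q t i j"
  have q_eq: "?q = coeff \<alpha> j * coeff X i - coeff X j * coeff \<alpha> i"
    by (simp add: M_entry_def wedge_M_col[OF w])
  show X: "smult ?q X = smult (coeff X i) (M_col Q t j) - smult (coeff X j) (M_col Q t i)"
    unfolding q_eq wedge_M_col[OF w] by (rule poly_eqI) (simp add: algebra_simps)
  have \<alpha>: "smult ?q \<alpha> = smult (coeff \<alpha> i) (M_col Q t j) - smult (coeff \<alpha> j) (M_col Q t i)"
    unfolding q_eq wedge_M_col[OF w] by (rule poly_eqI) (simp add: algebra_simps)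
  let ?S = "cpoly.span {M_col Q t i, M_col Q t j}"
  have "smult (1 / ?q) (smult ?q X) \<in> ?S" "smult (1 / ?q) (smult ?q \<alpha>) \<in> ?S"
    unfolding X \<alpha> by (auto intro!: cpoly.span_scale cpoly.span_diff intro: cpoly.span_base)
  then have "X \<in> ?S" "\<alpha> \<in> ?S" using q by simp_all
  then have "range (M_col Q t) \<subseteq> ?S"
    by (auto simp: wedge_M_col[OF w] intro!: cpoly.span_scale cpoly.span_diff)
  then show "M_rank Q t = 2" unfolding M_rank_def
    using columns_independent[OF q] by (intro cpoly.dim_unique[of "{M_col Q t i, M_col Q t j}"]) auto
qed

text \<open>
  Conversely, the columns \<open>c\<^sub>i\<close> and \<open>c\<^sub>j\<close> span the column space of a skew-symmetric matrix of rank two with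
  \<open>q\<^sub>i\<^sub>j \<noteq> 0\<close>. The coordinates of column \<open>k\<close> can be read off from the rows \<open>i\<close> and \<open>j\<close>, and by skew-symmetry
  they are again entries of these two columns, whence \<open>M = c\<^sub>i \<and> c\<^sub>j / q\<^sub>i\<^sub>j\<close>.
\<close>

lemma rank_two_wedge:
  assumes rank: "M_rank Q t = 2" and q: "M_entry Q t i j \<noteq> 0"
  shows "wedge Q t (smult (1 / M_entry Q t i j) (M_col Q t i)) (M_col Q t j)"
proof -
  let ?q = "M_entry Q t i j" and ?S = "{M_col Q t i, M_col Q t j}"
  have col: "M_col Q t k = smult (coeff (M_col Q t j) k / ?q) (M_col Q t i) - smult (coeff (M_col Q t i) k / ?q) (M_col Q t j)" for k
  proof -
    have "M_col Q t k \<in> cpoly.span ?S"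
    proof (rule ccontr)
      assume k: "M_col Q t k \<notin> cpoly.span ?S"
      obtain B where B: "range (M_col Q t) \<subseteq> cpoly.span B" "card B = cpoly.dim (range (M_col Q t))"
        by (rule cpoly.basis_exists[of "range (M_col Q t)"])
      then have card: "card B = 2" using rank unfolding M_rank_def by simp
      then have "finite B" by (intro card_ge_0_finite) simp
      moreover have notin: "M_col Q t k \<notin> ?S" using k cpoly.span_base by metis
      moreover have "cpoly.independent (insert (M_col Q t k) ?S)"
        by (subst cpoly.independent_insert, subst if_not_P[OF notin]) (intro conjI columns_independent(1)[OF q] k)
      moreover have "insert (M_col Q t k) ?S \<subseteq> cpoly.span B"
        using B(1) by (meson insert_subset empty_subsetI rangeI subsetD)
      ultimately have "card (insert (M_col Q t k) ?S) \<le> card B"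
        by (intro conjunct2[OF cpoly.independent_span_bound])
      moreover have "card ?S = 2" using columns_independent(2)[OF q] by (simp only: card_2_iff) blast
      then have "card (insert (M_col Q t k) ?S) = 3" using notin by (subst card_insert_disjoint) auto
      ultimately show False using card by simp
    qed
    then obtain a b where "M_col Q t k - smult a (M_col Q t i) = smult b (M_col Q t j)"
      unfolding cpoly.span_insert cpoly.span_singleton by auto
    then have k: "M_col Q t k = smult a (M_col Q t i) + smult b (M_col Q t j)" by (simp add: algebra_simps)
    have "M_entry Q t i k = b * ?q" "M_entry Q t j k = a * M_entry Q t j i"
      using M_entry_diag[of i] M_entry_diag[of j] by (simp_all add: M_entry_def k)
    moreover have "M_entry Q t i k = - coeff (M_col Q t i) k" "M_entry Q t j k = - coeff (M_col Q t j) k"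
      "M_entry Q t j i = - ?q"
      using M_entry_skew[of i k] M_entry_skew[of j k] M_entry_skew[of j i] by (simp_all only: M_entry_def)
    ultimately have "b * ?q = - coeff (M_col Q t i) k" "a * ?q = coeff (M_col Q t j) k" by simp_all
    then have "b = - coeff (M_col Q t i) k / ?q" "a = coeff (M_col Q t j) k / ?q"
      using q by (metis nonzero_eq_divide_eq)+
    with k show ?thesis by simp
  qed
  have "structure_poly2 Q t = [:smult (1 / ?q) (M_col Q t i):] * in_lam (M_col Q t j) - [:M_col Q t j:] * in_lam (smult (1 / ?q) (M_col Q t i))"
  proof (rule poly_eqI)
    fix k
    have "coeff (structure_poly2 Q t) k = M_col Q t k" by (simp add: M_col_def)
    also note col[of k]
    finally show "coeff (structure_poly2 Q t) k = coeff ([:smult (1 / ?q) (M_col Q t i):] * in_lam (M_col Q t j) -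
        [:M_col Q t j:] * in_lam (smult (1 / ?q) (M_col Q t i))) k"
      by (simp add: mult.commute)
  qed
  then show ?thesis unfolding wedge_def poly_structure_poly2[symmetric] by (simp add: mult.commute)
qed

end

lemma coeff_pred_eq: "coeff_pred \<phi> i = coeff ([:0, 1:] * \<phi>) i"
  by (cases i) (auto simp: coeff_pred_def)

text \<open>
  Differences of the affine polynomial \<open>\<alpha>(\<lambda>) \<partial> + s(\<lambda>)\<close> only see its slope.
\<close>

lemma cocycle_affine_iff:
  "cocycle 0 Q \<phi> 0 \<phi> 0 (in_lam \<alpha> * [:[:0, 1:]:] + in_lam s) (in_lam t) \<longleftrightarrow> wedge Q t ([:0, 1:] * \<phi>) \<alpha>"
proof -
  have "(twist (poly \<phi> m) (poly \<phi> m) m (poly (in_lam \<alpha> * [:[:0, 1:]:] + in_lam s) [:l:]) -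
      twist (poly \<phi> l) (poly \<phi> l) l (poly (in_lam \<alpha> * [:[:0, 1:]:] + in_lam s) [:m:]) =
      smult (poly (poly Q [:l:]) (- l - m)) (poly (in_lam t) [:l + m:])) \<longleftrightarrow>
    (poly (poly Q [:l:]) (- l - m) * poly t (l + m) =
       poly ([:0, 1:] * \<phi>) l * poly \<alpha> m - poly \<alpha> l * poly ([:0, 1:] * \<phi>) m)" for l m
    unfolding twist_affine by (auto simp: algebra_simps)
  then show ?thesis by (simp add: cocycle_def wedge_def twist_simps(5))
qed

text \<open>
  The coboundary of \<open>- k \<partial>\<^sup>2 / 2\<close> is \<open>k \<lambda> \<phi>(\<lambda>) \<partial>\<close> up to a polynomial in \<open>\<lambda>\<close>. So the slope \<open>\<alpha>\<close> matters only
  modulo multiples of \<open>X = \<lambda> \<phi>\<close>.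
\<close>

lemma linear_coeff_coboundary:
  "in_lam (smult k ([:0, 1:] * \<phi>)) * [:[:0, 1:]:] =
    coboundary \<phi> \<phi> [:0, 0, - k / 2:] + in_lam (smult (- k / 2) ([:0, 0, 1:] * \<phi>))"
proof (rule bivariate_eqI)
  fix l x
  show "poly (poly (in_lam (smult k ([:0, 1:] * \<phi>)) * [:[:0, 1:]:]) [:l:]) x =
    poly (poly (coboundary \<phi> \<phi> [:0, 0, - k / 2:] + in_lam (smult (- k / 2) ([:0, 0, 1:] * \<phi>))) [:l:]) x"
    by (simp add: twist_def algebra_simps add_divide_distrib)
qed

context
  fixes Q :: "complex poly poly"
  assumes skew: "\<And>l m. poly (poly Q [:m:]) (- m - l) = - poly (poly Q [:l:]) (- l - m)"
begin

text \<open>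
  If \<open>X\<^sub>n \<noteq> 0\<close>, column \<open>c\<^sub>n\<close>, which is \<open>\<alpha>\<^sub>n X - X\<^sub>n \<alpha>\<close>, agrees with \<open>- X\<^sub>n \<alpha>\<close> modulo \<open>X\<close>. The slope can therefore be
  replaced by \<open>- c\<^sub>n / X\<^sub>n\<close> for \<open>n = i\<close> or \<open>n = j\<close>, and \<open>X\<^sub>i\<close>, \<open>X\<^sub>j\<close> are not both \<open>0\<close> because the two columns
  express \<open>X\<close> with these coefficients.
\<close>

lemma data_2_ii_of_wedge:
  assumes w: "wedge Q t ([:0, 1:] * \<phi>) \<alpha>" and nz: "Q \<noteq> 0" "\<phi> \<noteq> 0" "t \<noteq> 0"
    and ij: "i < j" "M_entry Q t i j \<noteq> 0"
  shows "\<exists>h. data_2_ii i j 0 Q \<phi> 0 \<phi> 0 (in_lam \<alpha> * [:[:0, 1:]:] + in_lam s + coboundary \<phi> \<phi> h) (in_lam t)"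
proof -
  let ?X = "[:0, 1:] * \<phi>" and ?q = "M_entry Q t i j"
  note qX = wedge_rank_two[OF skew w ij(2)]
  have X: "?X = smult (coeff_pred \<phi> i / ?q) (M_col Q t j) - smult (coeff_pred \<phi> j / ?q) (M_col Q t i)"
  proof -
    have "?X = smult (1 / ?q) (smult ?q ?X)" using ij(2) by simp
    then show ?thesis unfolding qX(1) coeff_pred_eq by (simp add: smult_diff_right)
  qed
  have ne: "coeff_pred \<phi> i \<noteq> 0 \<or> coeff_pred \<phi> j \<noteq> 0" using X nz(2) by auto
  define n where "n = (if coeff_pred \<phi> i \<noteq> 0 then i else j)"
  define k where "k = - coeff \<alpha> n / coeff_pred \<phi> n"
  have n: "coeff_pred \<phi> n \<noteq> 0" using ne by (auto simp: n_def)
  have \<alpha>: "\<alpha> + smult k ?X = smult (- 1 / coeff_pred \<phi> n) (M_col Q t n)"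
    unfolding wedge_M_col[OF w, of n] coeff_pred_eq[symmetric] k_def using n
    by (simp add: smult_diff_right)
  have eq: "in_lam \<alpha> * [:[:0, 1:]:] + in_lam s - coboundary \<phi> \<phi> [:0, 0, k / 2:] = 
      in_lam (\<alpha> + smult k ?X) * [:[:0, 1:]:] + in_lam (s - smult (- k / 2) ([:0, 0, 1:] * \<phi>))"
  proof -
    have "coboundary \<phi> \<phi> [:0, 0, - k / 2:] = - coboundary \<phi> \<phi> [:0, 0, k / 2:]"
      using coboundary_linear(3)[of \<phi> \<phi> "[:0, 0, k / 2:]"] by simp
    then show ?thesis
      unfolding in_lam_linear(1)[of \<alpha>] distrib_right linear_coeff_coboundary in_lam_linear(2) by simp
  qed
  have "data_2_ii i j 0 Q \<phi> 0 \<phi> 0 (in_lam \<alpha> * [:[:0, 1:]:] + in_lam s - coboundary \<phi> \<phi> [:0, 0, k / 2:]) (in_lam t)"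
    unfolding data_2_ii_def eq \<alpha> using nz X ne ij qX(2)
    by (intro conjI exI[of _ t] exI[of _ "s - smult (- k / 2) ([:0, 0, 1:] * \<phi>)"]) (auto simp: n_def)
  then have "data_2_ii i j 0 Q \<phi> 0 \<phi> 0 (in_lam \<alpha> * [:[:0, 1:]:] + in_lam s + coboundary \<phi> \<phi> (- [:0, 0, k / 2:])) (in_lam t)"
    by (simp only: coboundary_linear(3) diff_conv_add_uminus)
  then show ?thesis by blast
qed

text \<open>
  With \<open>\<alpha> = - c\<^sub>i / X\<^sub>i\<close> (or \<open>- c\<^sub>j / X\<^sub>j\<close> if \<open>X\<^sub>i = 0\<close>) and \<open>X\<close> the prescribed combination of the columns,
  \<open>X \<and> \<alpha> = c\<^sub>i \<and> c\<^sub>j / q\<^sub>i\<^sub>j\<close>, and this is \<open>M\<close> because \<open>M\<close> has rank two.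
\<close>

lemma wedge_of_data_2_ii:
  assumes "data_2_ii i j p Q \<phi>A \<phi>B \<psi>A \<psi>B f g"
  obtains t \<alpha> s where "g = in_lam t" "t \<noteq> 0" "f = in_lam \<alpha> * [:[:0, 1:]:] + in_lam s"
    "wedge Q t ([:0, 1:] * \<phi>A) \<alpha>"
proof -
  obtain s t where d: "t \<noteq> 0" "g = in_lam t" "M_rank Q t = 2" "i < j" "M_entry Q t i j \<noteq> 0"
    "[:0, 1:] * \<phi>A = smult (coeff_pred \<phi>A i / M_entry Q t i j) (M_col Q t j)
          - smult (coeff_pred \<phi>A j / M_entry Q t i j) (M_col Q t i)"
    "coeff_pred \<phi>A i \<noteq> 0 \<or> coeff_pred \<phi>A j \<noteq> 0"
    "f = (if coeff_pred \<phi>A i \<noteq> 0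
             then in_lam (smult (- 1 / coeff_pred \<phi>A i) (M_col Q t i)) * [:[:0, 1:]:] + in_lam s
             else in_lam (smult (- 1 / coeff_pred \<phi>A j) (M_col Q t j)) * [:[:0, 1:]:] + in_lam s)"
    using assms unfolding data_2_ii_def by blast
  note w = rank_two_wedge[OF skew d(3,5)]
  have wv: "poly (poly Q [:l:]) (- l - m) * poly t (l + m) =
      (poly (M_col Q t i) l * poly (M_col Q t j) m - poly (M_col Q t j) l * poly (M_col Q t i) m) / M_entry Q t i j" for l m
    using w by (simp add: wedge_def diff_divide_distrib)
  define n where "n = (if coeff_pred \<phi>A i \<noteq> 0 then i else j)"
  have f: "f = in_lam (smult (- 1 / coeff_pred \<phi>A n) (M_col Q t n)) * [:[:0, 1:]:] + in_lam s"
    using d(8) by (auto simp: n_def)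
  have "wedge Q t ([:0, 1:] * \<phi>A) (smult (- 1 / coeff_pred \<phi>A n) (M_col Q t n))"
  proof (cases "coeff_pred \<phi>A i = 0")
    case False
    then show ?thesis unfolding wedge_def wv d(6) n_def using d(5) by (simp add: field_simps)
  next
    case True
    then show ?thesis unfolding wedge_def wv d(6) n_def using d(5,7) by (simp add: field_simps)
  qed
  from that[OF d(2,1) f this] show ?thesis .
qed

lemma cocycle_classification_p_zero:
  assumes "cocycle 0 Q \<phi> 0 \<psi> 0 f g" and nz: "Q \<noteq> 0" "\<phi> \<noteq> 0"
  shows "(\<exists>h. f = coboundary \<psi> \<phi> h \<and> g = 0) \<or> \<phi> = \<psi> \<and>
    (\<exists>h. (\<exists>s. f + coboundary \<phi> \<phi> h = in_lam s) \<and> g = 0 \<or> (\<exists>i j. data_2_ii i j 0 Q \<phi> 0 \<phi> 0 (f + coboundary \<phi> \<phi> h) g))"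
proof (cases "g = 0")
  case True
  then have "cocycle 0 0 \<phi> 0 \<psi> 0 f 0" using assms(1) by (simp add: cocycle_def twist_simps)
  from cocycle_abelian[OF this] nz(2) consider h where "f = coboundary \<psi> \<phi> h" 
    | h s where "\<phi> = \<psi>" "f = in_lam s + coboundary \<phi> \<phi> h" by blast
  then show ?thesis
  proof cases
    case 2
    then have "f + coboundary \<phi> \<phi> (- h) = in_lam s" by (simp add: coboundary_linear)
    with 2 True show ?thesis by blast
  qed (use True in blast)
next
  case False
  have "twist (poly \<psi> l) (poly \<phi> l) l (poly g [:m:]) = 0" for l m
    using assms(1) by (simp add: cocycle_def twist_simps)
  from killed_component[OF this nz(2) False] obtain t where t: "\<phi> = \<psi>" "g = in_lam t" by blast
  have "\<exists>h \<alpha> s. f = in_lam \<alpha> * [:[:0, 1:]:] + in_lam s + coboundary \<phi> \<phi> h"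
    by (rule cocycle_normalize_affine[where P = "\<lambda>l m. poly (poly Q [:l:]) (- l - m) * poly t (l + m)"])
      (use assms(1) nz(2) in \<open>auto simp: cocycle_def t\<close>)
  then obtain h \<alpha> s where f: "f = in_lam \<alpha> * [:[:0, 1:]:] + in_lam s + coboundary \<phi> \<phi> h" by blast
  have "cocycle 0 Q \<phi> 0 \<phi> 0 (in_lam \<alpha> * [:[:0, 1:]:] + in_lam s) (in_lam t)"
    using assms(1) twist_commute unfolding cocycle_def t f 
    by (simp add: twist_simps(5) twist_simps(2) t(1))
  then have w: "wedge Q t ([:0, 1:] * \<phi>) \<alpha>" by (simp only: cocycle_affine_iff)
  have "t \<noteq> 0" using False t by auto
  obtain i j where "i < j" "M_entry Q t i j \<noteq> 0"
    using M_entry_nonzero_exists[OF skew nz(1) \<open>t \<noteq> 0\<close>] by blast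
  from data_2_ii_of_wedge[OF w nz \<open>t \<noteq> 0\<close> this]
  obtain h' where "data_2_ii i j 0 Q \<phi> 0 \<phi> 0 (in_lam \<alpha> * [:[:0, 1:]:] + in_lam s + coboundary \<phi> \<phi> h') g"
    unfolding t by blast
  moreover have "in_lam \<alpha> * [:[:0, 1:]:] + in_lam s + coboundary \<phi> \<phi> h' = f + coboundary \<phi> \<phi> (h' - h)"
    unfolding f using coboundary_linear(2)[of \<phi> \<phi> "h' - h" h] by simp
  ultimately show ?thesis using t(1) by metis
qed

end

section \<open>Cocycles when \<open>p \<noteq> 0\<close>\<close>

lemma poly_eqI_eval: "(\<And>x. poly f x = poly g x) \<Longrightarrow> f = g" for f g :: "complex poly"
  by (simp add: poly_eq_poly_eq_iff[symmetric] fun_eq_iff)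

lemma bounded_coefficient_degree: "\<exists>N. \<forall>l. degree (poly (f :: complex poly poly) [:l:]) \<le> N"
proof (induction f)
  case (pCons a f)
  then obtain N where N: "\<And>l. degree (poly f [:l:]) \<le> N" by blast
  have "degree (poly (pCons a f) [:l:]) \<le> max (degree a) N" for l
  proof -
    have "degree (smult l (poly f [:l:])) \<le> N" using degree_smult_le N[of l] by (rule order_trans)
    then have "degree (a + smult l (poly f [:l:])) \<le> max (degree a) N" by (intro degree_add_le) auto
    then show ?thesis by simp
  qed
  then show ?case by blast
qed simp

text \<open>
  The degrees in \<open>\<partial>\<close> of the values at complex \<open>\<lambda>\<close> are bounded. Their least bound is attained, and the
  coefficient of this power of \<open>\<partial>\<close> depends polynomially on \<open>\<lambda>\<close>.
\<close>

lemma top_coefficient: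
  fixes g :: "complex poly poly"
  assumes "g \<noteq> 0"
  obtains N a where "\<And>l. degree (poly g [:l:]) \<le> N" "a \<noteq> 0" "\<And>l. coeff (poly g [:l:]) N = poly a l"
proof -
  define N where "N = (LEAST N. \<forall>l. degree (poly g [:l:]) \<le> N)"
  have N: "\<forall>l. degree (poly g [:l:]) \<le> N"
    unfolding N_def using bounded_coefficient_degree[of g] by (rule LeastI_ex)
  have "\<exists>l. coeff (poly g [:l:]) N \<noteq> 0"
  proof (rule ccontr)
    assume "\<not> ?thesis"
    then have z: "coeff (poly g [:l:]) N = 0" for l by blast
    show False
    proof (cases N)
      case 0
      have "poly g [:l:] = 0" for l using z[of l] N 0 by (metis le_zero_eq leading_coeff_0_iff)
      then have "g = 0" by (intro poly_poly_eqI) simp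
      with assms show False ..
    next
      case (Suc M)
      have "degree (poly g [:l:]) \<le> M" for l
        using z[of l] N Suc by (metis coeff_0 degree_0 leading_coeff_0_iff le_SucE le0)
      then have "N \<le> M" unfolding N_def by (intro Least_le) blast
      with Suc show False by simp
    qed
  qed
  then have "map_poly (\<lambda>q. coeff q N) g \<noteq> 0" unfolding coeff_poly_const by auto
  with N that show ?thesis unfolding coeff_poly_const by blast
qed

lemma pderiv_translate: "pderiv (translate c q) = translate c (pderiv q)"
  by (simp add: translate_def pderiv_pcompose pderiv_pCons)

lemma poly_map_pderiv: "poly (map_poly pderiv g) [:l:] = pderiv (poly g [:l:])" for g :: "complex poly poly"
  by (induction g) (auto simp: map_poly_pCons pderiv_add pderiv_smult)

text \<open>
  The leading coefficient \<open>a(\<lambda>)\<close> of \<open>g\<close> in \<open>\<partial>\<close> satisfies \<open>(\<phi>(l) - \<psi>(l)) a(m) = p(l) a(l + m)\<close>, and comparing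
  leading coefficients in \<open>m\<close> removes \<open>a\<close>.
\<close>

lemma twisted_scaling_top:
  assumes eq: "\<And>l m. smult (poly \<phi> l) (translate l (poly g [:m:])) - smult (poly \<psi> l) (poly g [:m:]) =
      smult (poly p l) (poly g [:l + m:])"
    and "g \<noteq> 0"
  shows "\<phi> - \<psi> = p"
proof -
  from assms(2) obtain N a where N: "\<And>l. degree (poly g [:l:]) \<le> N" and a: "a \<noteq> 0" "\<And>l. coeff (poly g [:l:]) N = poly a l"
    using top_coefficient by blast
  have "poly (\<phi> - \<psi>) l = poly p l" for l
  proof -
    have "smult (poly \<phi> l - poly \<psi> l) a = smult (poly p l) (translate l a)"
    proof (rule poly_eqI_eval)
      fix m
      show "poly (smult (poly \<phi> l - poly \<psi> l) a) m = poly (smult (poly p l) (translate l a)) m"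
        using arg_cong[OF eq[of l m], of "\<lambda>q. coeff q N"] coeff_translate_top[OF N, of l m]
        by (simp add: a(2) algebra_simps)
    qed
    from arg_cong[OF this, of "\<lambda>q. coeff q (degree a)"] show ?thesis
      using a(1) by (simp add: coeff_translate_top)
  qed
  then show ?thesis by (rule poly_eqI_eval)
qed

text \<open>
  The hypothesis says that the difference of \<open>g\<close> in \<open>\<partial>\<close> with step \<open>l\<close>, times \<open>\<phi>(l)\<close>, is the difference in \<open>\<lambda>\<close>
  with step \<open>l\<close>, times \<open>p(l)\<close>. It is inherited by \<open>\<partial>g/\<partial>\<partial>\<close>, so by repeated differentiation it is enough
  to treat \<open>g = b(\<lambda>) \<partial> + s(\<lambda>)\<close>. Then \<open>b\<close> is a constant \<open>k\<close> and \<open>s\<close> is affine with some slope \<open>d\<close>, and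
  \<open>k \<phi> = d p\<close>.
\<close>

lemma proportional_or_constant:
  assumes eq: "\<And>l m. smult (poly \<phi> l) (translate l (poly g [:m:]) - poly g [:m:]) =
      smult (poly p l) (poly g [:l + m:] - poly g [:m:])"
    and nz: "\<phi> \<noteq> 0" "p \<noteq> 0"
  shows "(\<forall>m. degree (poly g [:m:]) = 0) \<or> (\<exists>r. p = smult r \<phi>)"
proof -
  obtain N where "\<And>m. degree (poly g [:m:]) \<le> N" using bounded_coefficient_degree by blast
  then show ?thesis using eq
  proof (induction N arbitrary: g)
    case (Suc N)
    let ?g = "map_poly pderiv g"
    have "degree (poly ?g [:m:]) \<le> N" for m
      using Suc.prems(1)[of m] by (simp add: poly_map_pderiv degree_pderiv)
    moreover have "smult (poly \<phi> l) (translate l (poly ?g [:m:]) - poly ?g [:m:]) =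
      smult (poly p l) (poly ?g [:l + m:] - poly ?g [:m:])" for l m
      using arg_cong[OF Suc.prems(2)[of l m], of pderiv]
      by (simp add: poly_map_pderiv pderiv_smult pderiv_diff pderiv_translate)
    ultimately consider "\<exists>r. p = smult r \<phi>" | "\<And>m. degree (poly ?g [:m:]) = 0"
      using Suc.IH[of ?g] by blast
    then show ?case
    proof cases
      case 2
      then have "degree (poly g [:m:]) \<le> 1" for m by (simp add: poly_map_pderiv degree_pderiv)
      then obtain b s where g: "g = in_lam b * [:[:0, 1:]:] + in_lam s" by (rule affine_coeffs_imp_form)
      have e: "poly p l * (poly b (l + m) - poly b m) = 0"
        "poly \<phi> l * (l * poly b m) = poly p l * (poly s (l + m) - poly s m)" for l m
        using arg_cong[OF Suc.prems(2)[of l m], of "\<lambda>q. coeff q 1"] arg_cong[OF Suc.prems(2)[of l m], of "\<lambda>q. coeff q 0"]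
        by (simp_all add: g mult.commute)
      obtain c where c: "c \<noteq> 0" "poly p c \<noteq> 0" using poly_nonzero_point nz(2) by metis
      have "translate c b = b"
        using e(1)[of c] c(2) by (intro poly_eqI_eval) (simp add: add.commute)
      then obtain k where b: "b = [:k:]" using translate_periodic_imp_const[OF c(1)] by blast
      have "translate c s - s = [:poly \<phi> c * (c * k) / poly p c:]"
      proof (rule poly_eqI_eval)
        fix x
        show "poly (translate c s - s) x = poly [:poly \<phi> c * (c * k) / poly p c:] x"
          using e(2)[of c x] c(2) by (simp add: b add.commute[of x] eq_divide_eq mult.commute)
      qed
      then obtain s0 d where s: "s = [:s0, d:]" using translate_step_const_imp_affine[OF c(1)] by blast
      show ?thesis
      proof (cases "k = 0")
        case True
        then show ?thesis by (auto simp: g b)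
      next
        case False
        have "poly ([:0, 1:] * smult k \<phi>) l = poly ([:0, 1:] * smult d p) l" for l
          using e(2)[of l 0] by (simp add: b s mult_ac)
        then have "[:0, 1:] * smult k \<phi> = [:0, 1:] * smult d p"
          by (rule poly_eqI_eval)
        then have k: "smult k \<phi> = smult d p" by simp
        with False nz(1) have "d \<noteq> 0" by auto
        then have "p = smult (k / d) \<phi>" using arg_cong[OF k, of "smult (1 / d)"] by simp
        then show ?thesis by blast
      qed
    qed blast
  qed simp
qed

text \<open>
  Write \<open>G\<close> for \<open>g\<close> as a function of two complex variables. The relation
  \<open>G(x + l, m) = G(x, m) + r (G(x, m + l) - G(x, m))\<close> moves steps in \<open>x\<close> to steps in \<open>m\<close>. Two steps in \<open>x\<close>
  taken at once or one after the other give results that differ by \<open>r (r - 1)\<close> times the second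
  difference of \<open>G\<close> in \<open>m\<close>. So \<open>G\<close> is affine in \<open>m\<close>, and the relation then makes it affine in \<open>x\<close> with slopes in
  the ratio \<open>r\<close>.
\<close>

lemma proportional_affine:
  assumes eq: "\<And>l m. smult (poly \<phi> l) (translate l (poly g [:m:]) - poly g [:m:]) =
      smult (poly (smult r \<phi>) l) (poly g [:l + m:] - poly g [:m:])"
    and nz: "\<phi> \<noteq> 0" "r \<noteq> 0" "r \<noteq> 1"
  shows "\<exists>k1 k2. g = [:[:k2, k1:], [:k1 / r:]:]"
proof -
  define G where "G x m = poly (poly g [:m:]) x" for x m
  have G_lam: "G x m = poly (map_poly (\<lambda>q. poly q x) g) m" for x m
    unfolding G_def by (induction g) (auto simp: map_poly_pCons)
  have wave: "G (x + l) m = G x m + r * (G x (l + m) - G x m)" for x l m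
  proof -
    \<comment> \<open>The relation as a polynomial in \<open>l\<close>, so that the factor \<open>\<phi>(l)\<close> can be cancelled.\<close>
    let ?T = "translate x (poly g [:m:]) - [:G x m:] - smult r (translate m (map_poly (\<lambda>q. poly q x) g) - [:G x m:])"
    have "poly \<phi> l * poly ?T l = 0" for l
      using arg_cong[OF eq[of l m], of "\<lambda>q. poly q x"] by (simp add: G_lam[symmetric]) (simp add: G_def algebra_simps)
    then have "poly (\<phi> * ?T) l = 0" for l by simp
    then have "\<phi> * ?T = 0" using poly_all_0_iff_0 by blast
    then have "?T = 0" using nz(1) by simp
    then have "poly ?T l = 0" by simp
    then show ?thesis by (simp add: G_lam[symmetric]) (simp add: G_def algebra_simps)
  qed
  have second: "G x (n + (l + m)) = G x (n + m) + G x (l + m) - G x m" for x l n m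
  proof -
    \<comment> \<open>Expanding both sides with \<open>wave\<close> leaves \<open>r (r - 1)\<close> times a second difference.\<close>
    have "G (x + (l + n)) m = G ((x + l) + n) m" by (simp add: add.assoc)
    then have "r * (r - 1) * (G x (n + (l + m)) - (G x (n + m) + G x (l + m) - G x m)) = 0"
      unfolding wave[of x "l + n"] wave[of "x + l" n] wave[of x l] by (simp add: algebra_simps)
    with nz(2,3) show ?thesis by simp
  qed
  have aff: "G x m = G x 0 + (G x 1 - G x 0) * m" for x m
  proof -
    let ?q = "map_poly (\<lambda>q. poly q x) g"
    have "translate 1 ?q - ?q = [:G x 1 - G x 0:]"
      using second[where m = 0 and l = 1 and x = x]
      by (intro poly_eqI_eval) (simp add: G_lam[symmetric])
    have "?q = [:poly ?q 0, (G x 1 - G x 0) / 1:]"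
      by (rule translate_step_const_imp_affine[OF _ \<open>translate 1 ?q - ?q = _\<close>]) simp
    from arg_cong[OF this, of "\<lambda>q. poly q m"] show ?thesis by (simp add: G_lam[symmetric] mult.commute)
  qed
  define b where "b = G 0 1 - G 0 0"
  have slope: "G x 1 - G x 0 = b" for x
  proof -
    have "G x 1 = G 0 1 + r * (G 0 (x + 1) - G 0 1)" "G x 0 = G 0 0 + r * (G 0 x - G 0 0)"
      using wave[of 0 x 1] wave[of 0 x 0] by simp_all
    moreover have "G 0 (x + 1) = G 0 0 + b * (x + 1)" "G 0 x = G 0 0 + b * x"
      unfolding b_def by (rule aff)+
    moreover have "G 0 1 = G 0 0 + b" by (simp add: b_def)
    ultimately show ?thesis by (simp add: algebra_simps)
  qed
  have form: "G x m = G 0 0 + r * b * x + b * m" for x m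
  proof -
    have "G x m = G x 0 + b * m" using aff[of x m] slope by simp
    moreover have "G x 0 = G 0 0 + r * (G 0 x - G 0 0)" using wave[of 0 x 0] by simp
    moreover have "G 0 x = G 0 0 + b * x" using aff[of 0 x] by (simp add: b_def)
    ultimately show ?thesis by (simp add: algebra_simps)
  qed
  have "g = [:[:G 0 0, r * b:], [:(r * b) / r:]:]"
  proof (rule bivariate_eqI)
    fix l x
    show "poly (poly g [:l:]) x = poly (poly [:[:G 0 0, r * b:], [:(r * b) / r:]:] [:l:]) x"
      using form[of x l] nz(2) by (simp add: G_def algebra_simps)
  qed
  then show ?thesis by blast
qed

text \<open>
  Once \<open>\<phi> - \<psi> = p\<close> is known, substituting \<open>\<psi> = \<phi> - p\<close> turns the equation into proportionality of
  differences. A ratio \<open>r = 1\<close> would give \<open>\<psi> = 0\<close>.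
\<close>

lemma twisted_scaling_solutions:
  assumes eq: "\<And>l m. smult (poly \<phi> l) (translate l (poly g [:m:])) - smult (poly \<psi> l) (poly g [:m:]) =
      smult (poly p l) (poly g [:l + m:])"
    and nz: "\<phi> \<noteq> 0" "\<psi> \<noteq> 0" "p \<noteq> 0" "g \<noteq> 0"
  shows "\<phi> - \<psi> = p \<and> ((\<exists>r k1 k2. p = smult r \<phi> \<and> r \<noteq> 1 \<and> g = [:[:k2, k1:], [:k1 / r:]:]) \<or>
      (\<exists>k1. (\<nexists>r. p = smult r \<phi>) \<and> g = [:[:k1:]:]))"
proof -
  have p: "\<phi> - \<psi> = p" by (rule twisted_scaling_top[OF eq nz(4)])
  then have \<psi>: "poly \<psi> l = poly \<phi> l - poly p l" for l by auto
  have eq': "smult (poly \<phi> l) (translate l (poly g [:m:]) - poly g [:m:]) =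
      smult (poly p l) (poly g [:l + m:] - poly g [:m:])" for l m
    using eq[of l m] by (simp add: \<psi> smult_diff_right smult_diff_left algebra_simps)
  show ?thesis
  proof (cases "\<exists>r. p = smult r \<phi>")
    case True
    then obtain r where r: "p = smult r \<phi>" by blast
    have "r \<noteq> 0" "r \<noteq> 1" using r nz p by auto
    from proportional_affine[OF eq'[unfolded r] nz(1) this] show ?thesis using p r \<open>r \<noteq> 1\<close> by blast
  next
    case False
    then have "\<And>m. degree (poly g [:m:]) = 0" using proportional_or_constant[OF eq' nz(1,3)] by blast
    then obtain s where g: "g = in_lam s" by (rule const_coeffs_imp_in_lam)
    obtain c where c: "c \<noteq> 0" "poly p c \<noteq> 0" using poly_nonzero_point nz(3) by metis
    have "translate c s = s"
      using eq'[of c] c(2) by (intro poly_eqI_eval) (simp add: g add.commute)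
    then obtain k where "s = [:k:]" using translate_periodic_imp_const[OF c(1)] by blast
    with g False p show ?thesis by auto
  qed
qed

text \<open>
  Coboundaries do not affect \<open>g\<close> when \<open>B\<close> acts by zero on both modules, so \<open>f\<close> can be normalised as in the
  abelian case, independently of \<open>g\<close>.
\<close>

lemma cocycle_classification_Q_zero:
  assumes "cocycle p 0 \<phi> 0 \<psi> 0 f g" and nz: "p \<noteq> 0" "\<phi> \<noteq> 0" "\<psi> \<noteq> 0"
  shows "(\<exists>h. f = coboundary \<psi> \<phi> h \<and> g = 0) \<or>
    (\<phi> = \<psi> \<and> g = 0 \<and> (\<exists>h s. f + coboundary \<psi> \<phi> h = in_lam s)) \<or>
    (\<exists>h. f + coboundary \<psi> \<phi> h = 0) \<and> data_3_ii p 0 \<phi> 0 \<psi> 0 0 g"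
proof -
  have "cocycle 0 0 \<phi> 0 \<psi> 0 f 0" using assms(1) by (simp add: cocycle_def twist_simps)
  from cocycle_abelian[OF this] nz(2)
  have f: "(\<exists>h. f = coboundary \<psi> \<phi> h) \<or> \<phi> = \<psi> \<and> (\<exists>h s. f = in_lam s + coboundary \<psi> \<phi> h)" by blast
  show ?thesis
  proof (cases "g = 0")
    case True
    from f show ?thesis
    proof (elim disjE conjE exE)
      fix h s assume "\<phi> = \<psi>" "f = in_lam s + coboundary \<psi> \<phi> h"
      then have "f + coboundary \<psi> \<phi> (- h) = in_lam s" by (simp add: coboundary_linear)
      with True \<open>\<phi> = \<psi>\<close> show ?thesis by blast
    qed (use True in blast)
  next
    case False
    have "smult (poly \<phi> l) (translate l (poly g [:m:])) - smult (poly \<psi> l) (poly g [:m:]) =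
      smult (poly p l) (poly g [:l + m:])" for l m
      using assms(1) by (simp add: cocycle_def twist_simps(5)) (simp add: twist_def)
    from twisted_scaling_solutions[OF this nz(2,3,1) False] nz(1) False have d: "data_3_ii p 0 \<phi> 0 \<psi> 0 0 g" "\<phi> \<noteq> \<psi>"
      by (auto simp: data_3_ii_def)
    with f obtain h where "f = coboundary \<psi> \<phi> h" by blast
    then have "f + coboundary \<psi> \<phi> (- h) = 0" by (simp add: coboundary_linear)
    with d show ?thesis by blast
  qed
qed

lemma data_3_ii_cocycle:
  assumes "data_3_ii p Q \<phi>A \<phi>B \<psi>A \<psi>B f g"
  shows "cocycle p Q \<phi>A \<phi>B \<psi>A \<psi>B f g"
proof -
  from assms have z: "Q = 0" "\<phi>B = 0" "\<psi>B = 0" "f = 0" and p: "\<phi>A - \<psi>A = p" "p \<noteq> 0"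
    and g: "(\<exists>r k1 k2. p = smult r \<phi>A \<and> r \<noteq> 1 \<and> g = [:[:k2, k1:], [:k1 / r:]:]) \<or>
      (\<exists>k1. (\<nexists>r. p = smult r \<phi>A) \<and> g = [:[:k1:]:])"
    by (simp_all add: data_3_ii_def)
  have \<psi>: "\<psi>A = \<phi>A - p" using p by auto
  have "- twist (poly \<psi>A l) (poly \<phi>A l) l (poly g [:m:]) = smult (poly p l) (poly g [:l + m:])" for l m
    using g
  proof (elim disjE exE conjE)
    fix r k1 k2 assume r: "p = smult r \<phi>A" "g = [:[:k2, k1:], [:k1 / r:]:]"
    with p(2) have "r \<noteq> 0" by auto
    then show ?thesis unfolding \<psi> r by (simp add: twist_def field_simps)
  next
    fix k1 assume "g = [:[:k1:]:]"
    then show ?thesis unfolding \<psi> by (simp add: twist_def algebra_simps)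
  qed
  then show ?thesis by (simp add: cocycle_def z twist_simps)
qed

section \<open>Nontrivial cocycles and the listed data\<close>

text \<open>
  The left sides of the cocycle equations vanish on coboundaries because the operators \<open>twist\<close> commute; the
  right sides do because \<open>B\<close> acts by zero unless \<open>p = Q = 0\<close>.
\<close>

lemma cocycle_add_coboundary:
  assumes "cocycle p Q \<phi>A \<phi>B \<psi>A \<psi>B f g" and B: "\<phi>B \<noteq> 0 \<or> \<psi>B \<noteq> 0 \<Longrightarrow> p = 0 \<and> Q = 0"
  shows "cocycle p Q \<phi>A \<phi>B \<psi>A \<psi>B (f + coboundary \<psi>A \<phi>A h) (g + coboundary \<psi>B \<phi>B h)"
proof -
  have comm: "twist (poly \<psi>A m) (poly \<phi>A m) m (twist (poly \<psi>A l) (poly \<phi>A l) l h) =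
      twist (poly \<psi>A l) (poly \<phi>A l) l (twist (poly \<psi>A m) (poly \<phi>A m) m h)"
    "twist (poly \<psi>B m) (poly \<phi>B m) m (twist (poly \<psi>A l) (poly \<phi>A l) l h) =
      twist (poly \<psi>A l) (poly \<phi>A l) l (twist (poly \<psi>B m) (poly \<phi>B m) m h)"
    "twist (poly \<psi>B m) (poly \<phi>B m) m (twist (poly \<psi>B l) (poly \<phi>B l) l h) =
      twist (poly \<psi>B l) (poly \<phi>B l) l (twist (poly \<psi>B m) (poly \<phi>B m) m h)" for l m
    by (rule twist_commute)+
  have B0: "smult (poly (poly Q [:l:]) (- l - m)) (twist (poly \<psi>B k) (poly \<phi>B k) k h) = 0"
    "smult (poly p l) (twist (poly \<psi>B k) (poly \<phi>B k) k h) = 0" for l m k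
    using B by (cases "\<phi>B = 0 \<and> \<psi>B = 0"; auto simp: twist_simps(5))+
  show ?thesis unfolding cocycle_def
  proof (intro conjI allI)
    fix l m
    note c = assms(1)[unfolded cocycle_def]
    show "twist (poly \<psi>A m) (poly \<phi>A m) m (poly (f + coboundary \<psi>A \<phi>A h) [:l:]) -
        twist (poly \<psi>A l) (poly \<phi>A l) l (poly (f + coboundary \<psi>A \<phi>A h) [:m:]) =
        smult (poly (poly Q [:l:]) (- l - m)) (poly (g + coboundary \<psi>B \<phi>B h) [:l + m:])"
      using c[THEN conjunct1, rule_format, of m l] comm(1)[of m l]
      by (simp add: twist_simps smult_add_right B0 del: add_uminus_conv_diff)
    show "twist (poly \<psi>B m) (poly \<phi>B m) m (poly (f + coboundary \<psi>A \<phi>A h) [:l:]) -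
        twist (poly \<psi>A l) (poly \<phi>A l) l (poly (g + coboundary \<psi>B \<phi>B h) [:m:]) =
        smult (poly p l) (poly (g + coboundary \<psi>B \<phi>B h) [:l + m:])"
      using c[THEN conjunct2, THEN conjunct1, rule_format, of m l] comm(2)[of m l]
      by (simp add: twist_simps smult_add_right B0)
    show "twist (poly \<psi>B m) (poly \<phi>B m) m (poly (g + coboundary \<psi>B \<phi>B h) [:l:]) =
        twist (poly \<psi>B l) (poly \<phi>B l) l (poly (g + coboundary \<psi>B \<phi>B h) [:m:])"
      using c[THEN conjunct2, THEN conjunct2, rule_format, of m l] comm(3)[of m l]
      by (simp add: twist_simps)
  qed
qed

abbreviation (input) listed_data where
  "listed_data p Q \<phi>A \<phi>B \<psi>A \<psi>B f g \<equiv>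
     data_1_i p Q \<phi>A \<phi>B \<psi>A \<psi>B f g \<or>
     data_1_ii p Q \<phi>A \<phi>B \<psi>A \<psi>B f g \<or>
     data_1_iii p Q \<phi>A \<phi>B \<psi>A \<psi>B f g \<or>
     data_2_i p Q \<phi>A \<phi>B \<psi>A \<psi>B f g \<or>
     (\<exists>i0 j0. data_2_ii i0 j0 p Q \<phi>A \<phi>B \<psi>A \<psi>B f g) \<or>
     data_3_i p Q \<phi>A \<phi>B \<psi>A \<psi>B f g \<or>
     data_3_ii p Q \<phi>A \<phi>B \<psi>A \<psi>B f g"

lemma noncoboundary_shift:
  assumes "\<not> (\<exists>h. f = coboundary \<psi>A \<phi>A h \<and> g = coboundary \<psi>B \<phi>B h)"
  shows "\<not> (\<exists>h. f + coboundary \<psi>A \<phi>A k = coboundary \<psi>A \<phi>A h \<and> g + coboundary \<psi>B \<phi>B k = coboundary \<psi>B \<phi>B h)"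
proof
  assume "\<exists>h. f + coboundary \<psi>A \<phi>A k = coboundary \<psi>A \<phi>A h \<and> g + coboundary \<psi>B \<phi>B k = coboundary \<psi>B \<phi>B h"
  then obtain h where "f + coboundary \<psi>A \<phi>A k = coboundary \<psi>A \<phi>A h" "g + coboundary \<psi>B \<phi>B k = coboundary \<psi>B \<phi>B h" by blast
  then have "f = coboundary \<psi>A \<phi>A (h + - k)" "g = coboundary \<psi>B \<phi>B (h + - k)"
    unfolding coboundary_linear(2,3) by (simp_all add: algebra_simps eq_diff_eq)
  with assms show False by blast
qed

context rank_one_pair begin

lemma B_component_cases: "\<phi>B \<noteq> 0 \<or> \<psi>B \<noteq> 0 \<Longrightarrow> p = 0 \<and> Q = 0"
  using V.\<phi>B_nonzero W.\<phi>B_nonzero by blast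

lemma Q_skew_eval: "poly (poly Q [:m:]) (- m - l) = - poly (poly Q [:l:]) (- l - m)"
  using Q_at_skew[of m l] by (simp add: Q_at_def)

text \<open>
  In each case the normal form leaves the listed shape of \<open>f\<close> and \<open>g\<close>; nontriviality of the cocycle, which
  is invariant under adding coboundaries, gives the listed restrictions on \<open>s\<close> and \<open>t\<close>.
\<close>

lemma nontrivial_cocycle_normal_form:
  assumes coc: "is_cocycle f g" and nt: "\<not> (\<exists>h. f = coboundary \<psi>A \<phi>A h \<and> g = coboundary \<psi>B \<phi>B h)"
  shows "\<exists>h. listed_data p Q \<phi>A \<phi>B \<psi>A \<psi>B (f + coboundary \<psi>A \<phi>A h) (g + coboundary \<psi>B \<phi>B h)"
proof -
  note shift = noncoboundary_shift[OF nt]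
  consider "p = 0" "Q = 0" | "p = 0" "Q \<noteq> 0" | "p \<noteq> 0" "Q = 0" using p_eq_0_or_Q_eq_0 by blast
  then show ?thesis
  proof cases
    case 1
    with cocycle_abelian[of \<phi>A \<phi>B \<psi>A \<psi>B f g] coc nt V.\<phi>_nonzero obtain h s t where
      eq: "\<phi>A = \<psi>A" "\<phi>B = \<psi>B" and "f = in_lam s + coboundary \<psi>A \<phi>A h" "g = in_lam t + coboundary \<psi>B \<phi>B h" by blast
    then have st: "f + coboundary \<psi>A \<phi>A (- h) = in_lam s" "g + coboundary \<psi>B \<phi>B (- h) = in_lam t"
      by (simp_all add: coboundary_linear)
    have "\<nexists>c. s = smult c ([:0, 1:] * \<phi>A) \<and> t = smult c ([:0, 1:] * \<phi>B)"
      using shift[of "- h", unfolded st] in_lam_coboundary_iff[OF V.\<phi>_nonzero, of s t] unfolding eq by blast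
    then have "listed_data p Q \<phi>A \<phi>B \<psi>A \<psi>B (in_lam s) (in_lam t)"
      using 1 V.\<phi>_nonzero eq unfolding data_1_i_def data_1_ii_def data_1_iii_def
      by (cases "\<phi>A = 0"; cases "\<phi>B = 0") auto
    then show ?thesis unfolding st[symmetric] by blast
  next
    case 2
    with B_component_cases have B: "\<phi>B = 0" "\<psi>B = 0" by blast+
    with V.\<phi>_nonzero have nz: "\<phi>A \<noteq> 0" by blast
    have "cocycle 0 Q \<phi>A 0 \<psi>A 0 f g" using coc 2 B by simp
    from cocycle_classification_p_zero[OF Q_skew_eval this 2(2) nz] nt have eq: "\<phi>A = \<psi>A" and
      "\<exists>h. (\<exists>s. f + coboundary \<phi>A \<phi>A h = in_lam s) \<and> g = 0 \<or> (\<exists>i j. data_2_ii i j 0 Q \<phi>A 0 \<phi>A 0 (f + coboundary \<phi>A \<phi>A h) g)"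
      unfolding B coboundary_linear(4) by blast+
    then consider h s where "f + coboundary \<psi>A \<phi>A h = in_lam s" "g = 0"
      | h i j where "data_2_ii i j p Q \<phi>A \<phi>B \<psi>A \<psi>B (f + coboundary \<psi>A \<phi>A h) g" using 2 B by auto
    then show ?thesis
    proof cases
      case (1 h s)
      have "\<nexists>c. s = smult c ([:0, 1:] * \<phi>A)"
      proof
        assume "\<exists>c. s = smult c ([:0, 1:] * \<phi>A)"
        then have "\<exists>c. s = smult c ([:0, 1:] * \<phi>A) \<and> 0 = smult c ([:0, 1:] * 0)" by simp
        then show False
          using shift[of h] in_lam_coboundary_iff[of \<phi>A 0 s 0] nz 1 unfolding B eq by (simp add: coboundary_linear)
      qed
      then have "data_2_i p Q \<phi>A \<phi>B \<psi>A \<psi>B (f + coboundary \<psi>A \<phi>A h) (g + coboundary \<psi>B \<phi>B h)"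
        using 1 2 B eq nz by (auto simp: data_2_i_def coboundary_linear)
      then show ?thesis by blast
    next
      case (2 h i j)
      then have "data_2_ii i j p Q \<phi>A \<phi>B \<psi>A \<psi>B (f + coboundary \<psi>A \<phi>A h) (g + coboundary \<psi>B \<phi>B h)"
        by (simp add: B coboundary_linear)
      then show ?thesis by blast
    qed
  next
    case 3
    with B_component_cases have B: "\<phi>B = 0" "\<psi>B = 0" by blast+
    with V.\<phi>_nonzero W.\<phi>_nonzero have nz: "\<phi>A \<noteq> 0" "\<psi>A \<noteq> 0" by blast+
    have "cocycle p 0 \<phi>A 0 \<psi>A 0 f g" using coc 3 B by simp
    from cocycle_classification_Q_zero[OF this 3(1) nz] nt consider h s where "\<phi>A = \<psi>A" "g = 0" "f + coboundary \<psi>A \<phi>A h = in_lam s"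
      | h where "f + coboundary \<psi>A \<phi>A h = 0" "data_3_ii p Q \<phi>A \<phi>B \<psi>A \<psi>B 0 g"
      unfolding B coboundary_linear(4) 3(2) by blast
    then show ?thesis
    proof cases
      case (1 h s)
      have "\<nexists>c. s = smult c ([:0, 1:] * \<phi>A)"
      proof
        assume "\<exists>c. s = smult c ([:0, 1:] * \<phi>A)"
        then have "\<exists>c. s = smult c ([:0, 1:] * \<phi>A) \<and> 0 = smult c ([:0, 1:] * 0)" by simp
        then show False
          using shift[of h] in_lam_coboundary_iff[of \<phi>A 0 s 0] nz 1 unfolding B by (simp add: coboundary_linear)
      qed
      then have "data_3_i p Q \<phi>A \<phi>B \<psi>A \<psi>B (f + coboundary \<psi>A \<phi>A h) (g + coboundary \<psi>B \<phi>B h)"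
        using 1 3 B nz by (auto simp: data_3_i_def coboundary_linear)
      then show ?thesis by blast
    next
      case (2 h)
      then have "data_3_ii p Q \<phi>A \<phi>B \<psi>A \<psi>B (f + coboundary \<psi>A \<phi>A h) (g + coboundary \<psi>B \<phi>B h)"
        by (simp add: B coboundary_linear)
      then show ?thesis by blast
    qed
  qed
qed

lemma listed_data_nontrivial_cocycle:
  assumes "listed_data p Q \<phi>A \<phi>B \<psi>A \<psi>B f g"
  shows "is_cocycle f g" "\<not> (\<exists>h. f = coboundary \<psi>A \<phi>A h \<and> g = coboundary \<psi>B \<phi>B h)"
proof -
  have const: "is_cocycle (in_lam s) (in_lam t) \<and> \<not> (\<exists>h. in_lam s = coboundary \<psi>A \<phi>A h \<and> in_lam t = coboundary \<psi>B \<phi>B h)"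
    if "\<phi>A = \<psi>A" "\<phi>B = \<psi>B" "p = 0 \<and> Q = 0 \<or> t = 0"
      "\<nexists>c. s = smult c ([:0, 1:] * \<phi>A) \<and> t = smult c ([:0, 1:] * \<phi>B)" for s t
    using in_lam_cocycle[of p Q t \<phi>A \<phi>B s] in_lam_coboundary_iff[OF V.\<phi>_nonzero, of s t] that by simp
  have "is_cocycle f g \<and> \<not> (\<exists>h. f = coboundary \<psi>A \<phi>A h \<and> g = coboundary \<psi>B \<phi>B h)"
    using assms
  proof (elim disjE exE)
    fix i j assume d: "data_2_ii i j p Q \<phi>A \<phi>B \<psi>A \<psi>B f g"
    then have z: "p = 0" "\<phi>B = 0" "\<psi>B = 0" "\<phi>A = \<psi>A" unfolding data_2_ii_def by blast+
    obtain t \<alpha> s where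
      fg: "g = in_lam t" "t \<noteq> 0" "f = in_lam \<alpha> * [:[:0, 1:]:] + in_lam s" and w: "wedge Q t ([:0, 1:] * \<phi>A) \<alpha>"
      by (rule wedge_of_data_2_ii[OF Q_skew_eval d])
    have "is_cocycle f g" using w by (simp only: fg z cocycle_affine_iff)
    then show ?thesis using z fg by (simp add: coboundary_linear(4))
  next
    assume d: "data_3_ii p Q \<phi>A \<phi>B \<psi>A \<psi>B f g"
    then have "g \<noteq> 0" "\<phi>B = 0" "\<psi>B = 0" by (simp_all add: data_3_ii_def)
    with data_3_ii_cocycle[OF d] show ?thesis by (simp add: coboundary_linear(4))
  next
    assume "data_1_i p Q \<phi>A \<phi>B \<psi>A \<psi>B f g"
    then obtain s t where fg: "f = in_lam s" "g = in_lam t" and d: "s \<noteq> 0 \<or> (\<nexists>c. t = smult c ([:0, 1:] * \<phi>B))"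
      and z: "p = 0" "Q = 0" "\<phi>A = 0" "\<psi>A = 0" "\<phi>B = \<psi>B" unfolding data_1_i_def by blast
    have "\<nexists>c. s = smult c ([:0, 1:] * \<phi>A) \<and> t = smult c ([:0, 1:] * \<phi>B)" using d z by auto
    moreover have "\<phi>A = \<psi>A" "\<phi>B = \<psi>B" using z by simp_all
    ultimately show ?thesis unfolding fg using z by (intro const) simp_all
  next
    assume "data_1_ii p Q \<phi>A \<phi>B \<psi>A \<psi>B f g"
    then obtain s t where fg: "f = in_lam s" "g = in_lam t" and d: "t \<noteq> 0 \<or> (\<nexists>c. s = smult c ([:0, 1:] * \<phi>A))"
      and z: "p = 0" "Q = 0" "\<phi>B = 0" "\<psi>B = 0" "\<phi>A = \<psi>A" unfolding data_1_ii_def by blast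
    have "\<nexists>c. s = smult c ([:0, 1:] * \<phi>A) \<and> t = smult c ([:0, 1:] * \<phi>B)" using d z by auto
    moreover have "\<phi>A = \<psi>A" "\<phi>B = \<psi>B" using z by simp_all
    ultimately show ?thesis unfolding fg using z by (intro const) simp_all
  next
    assume "data_1_iii p Q \<phi>A \<phi>B \<psi>A \<psi>B f g"
    then obtain s t where fg: "f = in_lam s" "g = in_lam t"
      and d: "\<nexists>c. s = smult c ([:0, 1:] * \<phi>A) \<and> t = smult c ([:0, 1:] * \<phi>B)"
      and z: "p = 0" "Q = 0" "\<phi>A = \<psi>A" "\<phi>B = \<psi>B" unfolding data_1_iii_def by blast
    show ?thesis unfolding fg by (rule const[OF z(3,4) _ d]) (simp add: z)
  next
    assume "data_2_i p Q \<phi>A \<phi>B \<psi>A \<psi>B f g"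
    then obtain s where fg: "f = in_lam s" "g = in_lam 0" and d: "\<nexists>c. s = smult c ([:0, 1:] * \<phi>A)" and z: "\<phi>A = \<psi>A" "\<phi>B = \<psi>B"
      unfolding data_2_i_def in_lam_simps(1) by metis
    show ?thesis unfolding fg by (rule const) (use d z in auto)
  next
    assume "data_3_i p Q \<phi>A \<phi>B \<psi>A \<psi>B f g"
    then obtain s where fg: "f = in_lam s" "g = in_lam 0" and d: "\<nexists>c. s = smult c ([:0, 1:] * \<phi>A)" and z: "\<phi>A = \<psi>A" "\<phi>B = \<psi>B"
      unfolding data_3_i_def in_lam_simps(1) by metis
    show ?thesis unfolding fg by (rule const) (use d z in auto)
  qed
  then show "is_cocycle f g" "\<not> (\<exists>h. f = coboundary \<psi>A \<phi>A h \<and> g = coboundary \<psi>B \<phi>B h)" by blast+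
qed

lemma form_realization:
  assumes E: "ext_form E \<iota> \<pi> f g"
  shows "\<exists>(E' :: ('r, 'v \<times> 'w) cmod) \<iota>' \<pi>'. ext_form E' \<iota>' \<pi>' (f + coboundary \<psi>A \<phi>A h) (g + coboundary \<psi>B \<phi>B h) \<and>
    ext_equiv E \<iota> \<pi> E' \<iota>' \<pi>'"
proof -
  interpret E: rank_one_ext R A B p Q \<phi>A \<phi>B V v \<psi>A \<psi>B W w E \<iota> \<pi>
    using E by unfold_locales (simp add: ext_of_form_def)
  have "is_cocycle (f + coboundary \<psi>A \<phi>A h) (g + coboundary \<psi>B \<phi>B h)"
    using cocycle_add_coboundary[OF E.form_cocycle[OF E] B_component_cases] .
  note form = cocycle_sum_form[OF this]
  from form ext_equiv_iff[OF E form] show ?thesis by blast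
qed

lemma Ext_space_eq: "Ext_space R W V = {{\<delta> \<in> ext_cocycles R V W.
    (\<lambda>a y. cocycle_map f g a y - \<delta> a y) \<in> trivial_cocycles R V W} | f g. is_cocycle f g}"
proof -
  have "Ext_space R W V = (\<lambda>\<gamma>. {\<delta> \<in> ext_cocycles R V W.
      (\<lambda>a y. \<gamma> a y - \<delta> a y) \<in> trivial_cocycles R V W}) ` ext_cocycles R V W"
    unfolding Ext_space_def quotient_def by auto
  then show ?thesis by (subst (asm) (2) ext_cocycles_eq) auto
qed

end

section \<open>Dimension of the space of extensions\<close>

lemma (in poly_module) subst_lam_sum: "subst_lam sM (\<Sum>x\<in>F. P x) q = (\<Sum>x\<in>F. subst_lam sM (P x) q)"
  by (induction F rule: infinite_finite_induct) (auto simp: subst_lam_add)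

lemma degree_taylor_le: "degree (taylor h) \<le> degree h"
  unfolding taylor_def using degree_pcompose_le[of "in_lam h" "[:[:0, 1:], 1:]"] by simp

text \<open>
  Two preimages under \<open>twist\<close> differ by a constant, and one of them satisfies the degree bound of
  \<open>twist_surj\<close>.
\<close>

lemma bounded_degree_coboundary:
  assumes "c \<noteq> 0" "poly \<phi> c \<noteq> 0" "degree (poly (coboundary \<phi> \<phi> h) [:c:]) \<le> N"
  shows "degree h \<le> Suc N"
proof -
  let ?t = "twist (poly \<phi> c) (poly \<phi> c) c"
  obtain k where k: "?t k = ?t h" "degree k \<le> Suc (degree (?t h))" using twist_surj assms(1,2) by blast
  have "?t (h - k) = 0" by (simp add: twist_simps k)
  then obtain r where "h - k = [:r:]" using twist_eq_0_imp_const assms(1,2) by blast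
  then have "h = k + [:r:]" by (simp add: algebra_simps)
  moreover have "degree k \<le> Suc N" using k(2) assms(3) by simp
  ultimately show ?thesis by (simp add: degree_add_le)
qed

context rank_one_pair begin

lemma cocycle_map_diff:
  "(\<lambda>a y. cocycle_map f g a y - cocycle_map f' g' a y) = cocycle_map (f - f') (g - g')"
  by (intro ext V.vec_poly_eqI)
    (simp add: V.subst_lam_diff ev_cocycle_map V.scale_left_diff_distrib[symmetric] algebra_simps smult_diff_right)

lemma cocycle_map_sum:
  "(\<lambda>a y. \<Sum>i\<in>I. map_poly (cscale V [:c i:]) (cocycle_map (f i) (g i) a y)) =
    cocycle_map (\<Sum>i\<in>I. smult [:c i:] (f i)) (\<Sum>i\<in>I. smult [:c i:] (g i))"
proof (intro ext V.vec_poly_eqI)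
  fix a y l
  have "V.ev (\<Sum>i\<in>I. map_poly (cscale V [:c i:]) (cocycle_map (f i) (g i) a y)) l =
    cscale V (\<Sum>i\<in>I. [:c i:] * ((smult (poly (coordA a) (- l)) (poly (f i) [:l:]) +
      smult (poly (coordB a) (- l)) (poly (g i) [:l:])) * translate l (W.coord w y))) v"
    by (simp only: V.subst_lam_sum V.ev_scale ev_cocycle_map V.scale_scale V.scale_sum_left)
  also have "\<dots> = V.ev (cocycle_map (\<Sum>i\<in>I. smult [:c i:] (f i)) (\<Sum>i\<in>I. smult [:c i:] (g i)) a y) l"
    unfolding ev_cocycle_map
    by (rule arg_cong[where f = "\<lambda>q. cscale V q v"], rule poly_eqI_eval)
      (simp add: poly_sum sum_distrib_left sum_distrib_right sum.distrib algebra_simps)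
  finally show "V.ev (\<Sum>i\<in>I. map_poly (cscale V [:c i:]) (cocycle_map (f i) (g i) a y)) l =
    V.ev (cocycle_map (\<Sum>i\<in>I. smult [:c i:] (f i)) (\<Sum>i\<in>I. smult [:c i:] (g i)) a y) l" .
qed

text \<open>
  The cocycles \<open>(\<lambda>\<^sup>n, 0)\<close> are not in the span of finitely many classes for large \<open>n\<close>. A linear combination of
  the representatives has bounded degree both in \<open>\<partial>\<close> and in \<open>\<lambda>\<close>. If it differs from \<open>\<lambda>\<^sup>n\<close> by a coboundary of
  \<open>h\<close>, this coboundary has bounded degree in \<open>\<partial>\<close>, hence so has \<open>h\<close>, and the coboundary has degree in \<open>\<lambda>\<close> at
  most \<open>deg \<phi>\<^sub>A + deg h\<close>.
\<close>

lemma Ext_infinite_dim: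
  assumes eq: "\<phi>A = \<psi>A" "\<phi>B = \<psi>B"
  shows "\<not> Ext_finite_dim R W V"
proof
  assume "Ext_finite_dim R W V"
  then obtain F where F: "finite F" "F \<subseteq> ext_cocycles R V W"
    and span: "\<forall>X\<in>Ext_space R W V. \<exists>c :: _ \<Rightarrow> complex. (\<lambda>a w. \<Sum>\<delta>\<in>F. map_poly (cscale V [:c \<delta>:]) (\<delta> a w)) \<in> X"
    unfolding Ext_finite_dim_def by blast
  define rep where "rep \<delta> = (SOME fg. cocycle_map (fst fg) (snd fg) = \<delta>)" for \<delta>
  define f g where "f \<delta> = fst (rep \<delta>)" and "g \<delta> = snd (rep \<delta>)" for \<delta>
  have fg: "cocycle_map (f \<delta>) (g \<delta>) = \<delta>" if mem: "\<delta> \<in> F" for \<delta>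
  proof -
    obtain f' g' where "\<delta> = cocycle_map f' g'" using mem F(2) unfolding ext_cocycles_eq by blast
    then have "cocycle_map (fst (f', g')) (snd (f', g')) = \<delta>" by simp
    then show ?thesis unfolding f_def g_def rep_def by (rule someI)
  qed
  obtain N1 where N1: "\<And>\<delta>. \<delta> \<in> F \<Longrightarrow> degree (f \<delta>) \<le> N1"
    using F(1) by (meson Max_ge finite_imageI imageI)
  have "\<forall>\<delta>. \<exists>N. \<forall>l. degree (poly (f \<delta>) [:l:]) \<le> N" by (intro allI bounded_coefficient_degree)
  from choice[OF this] obtain M where M: "\<And>\<delta> l. degree (poly (f \<delta>) [:l:]) \<le> M \<delta>" by blast
  obtain N2 where N2: "\<And>\<delta>. \<delta> \<in> F \<Longrightarrow> M \<delta> \<le> N2"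
    using F(1) by (meson Max_ge finite_imageI imageI)
  \<comment> \<open>Larger than the degree in \<open>\<lambda>\<close> of any combination of the representatives and of any coboundary whose
    degree in \<open>\<partial>\<close> is at most \<open>N2\<close>.\<close>
  define n where "n = Suc (max N1 (degree \<phi>A + Suc N2))"
  have "is_cocycle (in_lam (monom 1 n)) 0" using in_lam_cocycle[of p Q 0 \<phi>A \<phi>B] eq by simp
  then have "{\<delta> \<in> ext_cocycles R V W. (\<lambda>a y. cocycle_map (in_lam (monom 1 n)) 0 a y - \<delta> a y)
      \<in> trivial_cocycles R V W} \<in> Ext_space R W V" (is "?X \<in> _")
    unfolding Ext_space_eq by blast
  from bspec[OF span this] obtain c :: "_ \<Rightarrow> complex" where
    "(\<lambda>a w. \<Sum>\<delta>\<in>F. map_poly (cscale V [:c \<delta>:]) (\<delta> a w)) \<in> ?X" ..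
  then have "(\<lambda>a y. cocycle_map (in_lam (monom 1 n)) 0 a y - (\<Sum>\<delta>\<in>F. map_poly (cscale V [:c \<delta>:]) (\<delta> a y)))
      \<in> trivial_cocycles R V W" unfolding mem_Collect_eq by (rule conjunct2)
  moreover have "(\<Sum>\<delta>\<in>F. map_poly (cscale V [:c \<delta>:]) (\<delta> a y)) =
      cocycle_map (\<Sum>\<delta>\<in>F. smult [:c \<delta>:] (f \<delta>)) (\<Sum>\<delta>\<in>F. smult [:c \<delta>:] (g \<delta>)) a y" for a y
  proof -
    have "(\<Sum>\<delta>\<in>F. map_poly (cscale V [:c \<delta>:]) (\<delta> a y)) =
        (\<Sum>\<delta>\<in>F. map_poly (cscale V [:c \<delta>:]) (cocycle_map (f \<delta>) (g \<delta>) a y))"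
      by (intro sum.cong refl) (simp add: fg)
    also have "\<dots> = cocycle_map (\<Sum>\<delta>\<in>F. smult [:c \<delta>:] (f \<delta>)) (\<Sum>\<delta>\<in>F. smult [:c \<delta>:] (g \<delta>)) a y"
      using fun_cong[OF fun_cong[OF cocycle_map_sum[where c = c and f = f and g = g and I = F]], of a y] .
    finally show ?thesis .
  qed
  ultimately have "cocycle_map (in_lam (monom 1 n) - (\<Sum>\<delta>\<in>F. smult [:c \<delta>:] (f \<delta>)))
      (0 - (\<Sum>\<delta>\<in>F. smult [:c \<delta>:] (g \<delta>))) \<in> trivial_cocycles R V W"
    by (simp only: cocycle_map_diff)
  then obtain h where h: "in_lam (monom 1 n) - (\<Sum>\<delta>\<in>F. smult [:c \<delta>:] (f \<delta>)) = coboundary \<phi>A \<phi>A h"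
    unfolding trivial_cocycles_eq eq mem_Collect_eq cocycle_map_eq_iff by blast
  let ?G = "\<Sum>\<delta>\<in>F. smult [:c \<delta>:] (f \<delta>)"
  have G1: "degree ?G \<le> N1"
    using N1 F(1) by (intro degree_sum_le) (auto intro: order_trans[OF degree_smult_le])
  have coboundary: "degree (coboundary \<phi>A \<phi>A h) \<le> degree \<phi>A + Suc N2"
  proof (cases "\<phi>A = 0")
    case False
    then obtain z where z: "z \<noteq> 0" "poly \<phi>A z \<noteq> 0" using poly_nonzero_point by metis
    have "degree (poly ?G [:z:]) \<le> N2"
      unfolding poly_sum using F(1)
      by (intro degree_sum_le) (auto intro!: order_trans[OF degree_smult_le] order_trans[OF M N2])
    then have "degree (poly (coboundary \<phi>A \<phi>A h) [:z:]) \<le> N2"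
      unfolding h[symmetric] by (simp add: poly_monom poly_const_pow degree_diff_le)
    from bounded_degree_coboundary[OF z this] have hN: "degree h \<le> Suc N2" .
    show ?thesis unfolding coboundary_def
      using hN degree_taylor_le[of h] degree_mult_le[of "in_lam \<phi>A" "[:h:]"] degree_mult_le[of "in_lam \<phi>A" "taylor h"]
      by (intro degree_diff_le) auto
  qed (simp add: coboundary_linear)
  have "in_lam (monom 1 n) = coboundary \<phi>A \<phi>A h + ?G" using h by (simp add: algebra_simps)
  then have "n = degree (coboundary \<phi>A \<phi>A h + ?G)" by (metis degree_in_lam degree_monom_eq one_neq_zero)
  also have "\<dots> \<le> max (degree \<phi>A + Suc N2) N1" using coboundary G1 by (intro degree_add_le) auto
  finally show False by (simp add: n_def)
qed

lemma Ext_finite_dim_if_spanned: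
  assumes "finite S" "\<And>s. s \<in> S \<Longrightarrow> is_cocycle 0 s"
    and span: "\<And>f g. is_cocycle f g \<Longrightarrow> \<exists>h c. f = coboundary \<psi>A \<phi>A h \<and> g = (\<Sum>s\<in>S. smult [:c s:] s)"
    and B: "\<phi>B = 0" "\<psi>B = 0"
  shows "Ext_finite_dim R W V"
  unfolding Ext_finite_dim_def
proof (intro exI[of _ "cocycle_map 0 ` S"] conjI ballI)
  show "finite (cocycle_map 0 ` S)" using assms(1) by simp
  show "cocycle_map 0 ` S \<subseteq> ext_cocycles R V W" unfolding ext_cocycles_eq using assms(2) by blast
  fix X assume "X \<in> Ext_space R W V"
  then obtain f g where coc: "is_cocycle f g" and X: "\<And>\<delta>. \<delta> \<in> X \<longleftrightarrow> \<delta> \<in> ext_cocycles R V W \<and>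
    (\<lambda>a y. cocycle_map f g a y - \<delta> a y) \<in> trivial_cocycles R V W" unfolding Ext_space_eq by blast
  from span[OF coc] obtain h c where f: "f = coboundary \<psi>A \<phi>A h" and g: "g = (\<Sum>s\<in>S. smult [:c s:] s)" by blast
  have inj: "inj_on (cocycle_map 0) S" by (auto simp: inj_on_def cocycle_map_eq_iff)
  \<comment> \<open>The coefficients are indexed by cocycles, and \<open>S\<close> consists of the polynomials \<open>g\<close>.\<close>
  define c' where "c' = c \<circ> the_inv_into S (cocycle_map 0)"
  have sum: "(\<lambda>a y. \<Sum>\<delta>\<in>cocycle_map 0 ` S. map_poly (cscale V [:c' \<delta>:]) (\<delta> a y)) = cocycle_map 0 g"
  proof -
    have "(\<Sum>\<delta>\<in>cocycle_map 0 ` S. map_poly (cscale V [:c' \<delta>:]) (\<delta> a y)) =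
      (\<Sum>s\<in>S. map_poly (cscale V [:c s:]) (cocycle_map 0 s a y))" for a y
      unfolding sum.reindex[OF inj] by (rule sum.cong) (simp_all add: c'_def the_inv_into_f_f[OF inj])
    then show ?thesis
      using cocycle_map_sum[where c = c and f = "\<lambda>_. 0" and g = "\<lambda>s. s" and I = S] by (simp add: g)
  qed
  have "is_cocycle (f + coboundary \<psi>A \<phi>A (- h)) (g + coboundary \<psi>B \<phi>B (- h))"
    by (rule cocycle_add_coboundary[OF coc]) (use B in auto)
  then have g0: "is_cocycle 0 g" by (simp add: f B coboundary_linear)
  have "is_cocycle (0 + coboundary \<psi>A \<phi>A h) (0 + coboundary \<psi>B \<phi>B h)"
    by (rule cocycle_add_coboundary[OF cocycle_0]) (use B in auto)
  then have tr: "cocycle_map f 0 \<in> trivial_cocycles R V W"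
    unfolding trivial_cocycles_eq f by (intro CollectI exI[of _ h]) (simp add: B coboundary_linear(4))
  have "(\<lambda>a y. cocycle_map f g a y - cocycle_map 0 g a y) = cocycle_map f 0"
    unfolding cocycle_map_diff by simp
  moreover have "cocycle_map 0 g \<in> ext_cocycles R V W" unfolding ext_cocycles_eq using g0 by blast
  ultimately have "cocycle_map 0 g \<in> X"
    unfolding X using tr by (simp only: simp_thms)
  then show "\<exists>c. (\<lambda>a w. \<Sum>\<delta>\<in>cocycle_map 0 ` S. map_poly (cscale V [:c \<delta>:]) (\<delta> a w)) \<in> X"
    by (intro exI[of _ c']) (simp only: sum)
qed

text \<open>
  By the classification, \<open>(0, \<partial> + \<lambda>/r)\<close> and \<open>(0, 1)\<close> span if \<open>p = r \<phi>\<^sub>A\<close>, and \<open>(0, 1)\<close> alone otherwise.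
\<close>

lemma Ext_finite_dim_data_3_ii:
  assumes d: "data_3_ii p Q \<phi>A \<phi>B \<psi>A \<psi>B f0 g0"
  shows "Ext_finite_dim R W V"
proof -
  from d have z: "p \<noteq> 0" "Q = 0" "\<phi>B = 0" "\<psi>B = 0" "\<phi>A \<noteq> \<psi>A" and p: "\<phi>A - \<psi>A = p" by (simp_all add: data_3_ii_def)
  have nz: "\<phi>A \<noteq> 0" "\<psi>A \<noteq> 0" using V.\<phi>_nonzero W.\<phi>_nonzero z by blast+
  have classes: "\<exists>h. f = coboundary \<psi>A \<phi>A h \<and> (g = 0 \<or> data_3_ii p Q \<phi>A \<phi>B \<psi>A \<psi>B 0 g)" if "is_cocycle f g" for f g
  proof -
    have "cocycle p 0 \<phi>A 0 \<psi>A 0 f g" using that z by simp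
    from cocycle_classification_Q_zero[OF this z(1) nz] z(5) consider h where "f = coboundary \<psi>A \<phi>A h" "g = 0"
      | h where "f + coboundary \<psi>A \<phi>A h = 0" "data_3_ii p Q \<phi>A \<phi>B \<psi>A \<psi>B 0 g"
      unfolding z by blast
    then show ?thesis
    proof cases
      case (2 h)
      then have "f = coboundary \<psi>A \<phi>A (- h)" unfolding coboundary_linear(3) by (simp add: eq_neg_iff_add_eq_0)
      with 2 show ?thesis by blast
    qed blast
  qed
  have const: "is_cocycle 0 [:[:1:]:]"
  proof -
    have "\<psi>A = \<phi>A - p" using p by auto
    then show ?thesis by (simp add: cocycle_def z twist_simps(1,5)) (simp add: twist_def)
  qed
  show ?thesis
  proof (cases "\<exists>r. p = smult r \<phi>A")
    case True
    then obtain r where r: "p = smult r \<phi>A" by blast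
    then have r01: "r \<noteq> 0" "r \<noteq> 1" using z(1) p nz by auto
    have uniq: "r' = r" if "p = smult r' \<phi>A" for r'
    proof -
      have "smult (r - r') \<phi>A = 0" using that by (simp add: smult_diff_left r)
      then show ?thesis using nz(1) by simp
    qed
    let ?g = "[:[:0, 1:], [:1 / r:]:] :: complex poly poly" and ?e = "[:[:1:]:] :: complex poly poly"
    have "data_3_ii p Q \<phi>A \<phi>B \<psi>A \<psi>B 0 ?g"
      unfolding data_3_ii_def using z p r r01 by auto
    then have lin: "is_cocycle 0 ?g" by (rule data_3_ii_cocycle)
    show ?thesis
    proof (rule Ext_finite_dim_if_spanned[of "{?g, ?e}"])
      fix f g assume "is_cocycle f g"
      with classes obtain h where f: "f = coboundary \<psi>A \<phi>A h" and g: "g = 0 \<or> data_3_ii p Q \<phi>A \<phi>B \<psi>A \<psi>B 0 g" by blast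
      from g have "\<exists>k1 k2. g = [:[:k2, k1:], [:k1 / r:]:]"
      proof
        assume "g = 0"
        then show ?thesis by (intro exI[of _ 0]) simp
      next
        assume "data_3_ii p Q \<phi>A \<phi>B \<psi>A \<psi>B 0 g"
        then show ?thesis using True uniq unfolding data_3_ii_def by metis
      qed
      then obtain k1 k2 where "g = [:[:k2, k1:], [:k1 / r:]:]" by blast
      then have "g = (\<Sum>s\<in>{?g, ?e}. smult [:if s = ?g then k1 else k2:] s)" by simp
      with f show "\<exists>h c. f = coboundary \<psi>A \<phi>A h \<and> g = (\<Sum>s\<in>{?g, ?e}. smult [:c s:] s)"
        by (intro exI[of _ h] exI[of _ "\<lambda>s. if s = ?g then k1 else k2"]) blast
    qed (use lin const z in auto)
  next
    case False
    show ?thesis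
    proof (rule Ext_finite_dim_if_spanned[of "{[:[:1:]:]}"])
      fix f g assume "is_cocycle f g"
      with classes obtain h where f: "f = coboundary \<psi>A \<phi>A h" and g: "g = 0 \<or> data_3_ii p Q \<phi>A \<phi>B \<psi>A \<psi>B 0 g" by blast
      have "\<exists>k. g = [:[:k:]:]" using g False unfolding data_3_ii_def by (metis pCons_0_0)
      then obtain k where "g = [:[:k:]:]" by blast
      with f show "\<exists>h c. f = coboundary \<psi>A \<phi>A h \<and> g = (\<Sum>s\<in>{[:[:1:]:]}. smult [:c s:] s)"
        by (intro exI[of _ h] exI[of _ "\<lambda>_. k"]) simp
    qed (use const z in auto)
  qed
qed

end

section \<open>A module over every solvable rank two algebra\<close>

context rank_two begin

text \<open>
  The module \<open>\<complex>[\<partial>] 1\<close> with \<open>A\<^sub>\<lambda> 1 = 1\<close> and \<open>B\<^sub>\<lambda> 1 = 0\<close>: here \<open>A\<^sub>\<lambda> q(\<partial>) = q(\<partial> + \<lambda>)\<close>. Translations commute, so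
  \<open>[A\<^sub>\<lambda> A]\<close> and \<open>[A\<^sub>\<lambda> B]\<close> may act by zero whatever \<open>p\<close> and \<open>Q\<close> are.
\<close>

definition shift_module :: "('r, complex poly) cmod" where
  "shift_module = \<lparr>cscale = (*), cact = (\<lambda>a m. in_lam (pcompose (coordA a) [:0, - 1:]) * taylor m)\<rparr>"

lemma shift_module_simps [simp]: "cscale shift_module = (*)"
  "cact shift_module a m = in_lam (pcompose (coordA a) [:0, - 1:]) * taylor m"
  by (simp_all add: shift_module_def)

lemma module_mult: "module ((*) :: complex poly \<Rightarrow> _)"
  by unfold_locales (auto simp: algebra_simps)

lemma act_at_shift_module: "act_at shift_module a l m = smult (poly (coordA a) (- l)) (translate l m)"
proof -
  have "subst_lam (*) P q = poly P q" for P and q :: "complex poly"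
    by (simp add: subst_lam_def poly_altdef mult.commute)
  then show ?thesis by (simp add: act_at_def poly_pcompose)
qed

text \<open>
  Irreducibility: the top coefficient in \<open>\<lambda>\<close> of \<open>q(\<partial> + \<lambda>)\<close> is a nonzero constant, so every nonzero submodule
  contains \<open>1\<close>.
\<close>

lemma shift_module_irreducible_rank_one: "irreducible_rank_one R A B p Q 1 0 shift_module 1"
proof -
  interpret module "(*) :: complex poly \<Rightarrow> _" by (rule module_mult)
  have "conformal_action R shift_module"
    by (rule conformal_action_from_generators[where \<alpha> = translate and \<beta> = "\<lambda>_ _. 0"])
      (simp_all add: module_mult act_at_shift_module add.commute)
  then have "conformal_module R shift_module" using lie by (simp add: conformal_module_def)
  moreover have "nontrivial_irreducible shift_module"
    unfolding nontrivial_irreducible_def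
  proof (intro conjI allI impI)
    have "taylor 1 = 1" by (simp add: taylor_def pcompose_1)
    then show "\<exists>a m. cact shift_module a m \<noteq> 0" by (intro exI[of _ A] exI[of _ 1]) (simp add: pcompose_1)
    fix S assume S: "module.subspace (cscale shift_module) S \<and> (\<forall>a. \<forall>m\<in>S. \<forall>i. coeff (cact shift_module a m) i \<in> S)"
    then have sub: "subspace S" by simp
    show "S = {0} \<or> S = UNIV"
    proof (cases "S \<subseteq> {0}")
      case True
      then show ?thesis using subspace_0[OF sub] by blast
    next
      case False
      then obtain m where m: "m \<in> S" "m \<noteq> 0" by blast
      have deg: "degree (taylor m) = degree m" unfolding taylor_def by (simp add: degree_pcompose)
      have "lead_coeff (taylor m) = [:lead_coeff m:]"
        unfolding taylor_def by (subst lead_coeff_comp) auto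
      moreover have "coeff (cact shift_module A m) (degree m) \<in> S" using S m(1) by blast
      ultimately have c: "[:lead_coeff m:] \<in> S" using deg by (simp add: pcompose_1)
      have "q \<in> S" for q
        using subspace_scale[OF sub c, of "smult (1 / lead_coeff m) q"] m(2) by simp
      then show ?thesis by blast
    qed
  qed
  moreover have "free_basis (cscale shift_module) {1}"
    unfolding free_basis_def by (auto simp: independent_explicit_module span_singleton subset_singleton_iff)
  moreover have "cact shift_module A 1 = times_vec (cscale shift_module) (in_lam 1) 1"
    "cact shift_module B 1 = times_vec (cscale shift_module) (in_lam 0) 1"
    by (simp_all add: times_vec_def taylor_def pcompose_1)
  ultimately show ?thesis unfolding irreducible_rank_one_def by simp
qed

text \<open>
  For \<open>\<phi>\<^sub>A = 1\<close>, \<open>\<phi>\<^sub>B = 0\<close> the cocycle \<open>(1, 0)\<close> is not a coboundary, because \<open>1\<close> is not a multiple of \<open>\<lambda>\<close>.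
\<close>

lemma nontrivial_extension_exists:
  "\<exists>\<phi>A \<phi>B \<psi>A \<psi>B (V :: ('r, complex poly) cmod) v (W :: ('r, complex poly) cmod) w
      (E :: ('r, complex poly \<times> complex poly) cmod) \<iota> \<pi>.
      irreducible_rank_one R A B p Q \<phi>A \<phi>B V v \<and>
      irreducible_rank_one R A B p Q \<psi>A \<psi>B W w \<and>
      extension R V W E \<iota> \<pi> \<and> \<not> trivial_ext V W E \<iota> \<pi>"
proof -
  interpret V: rank_one_pair R A B p Q 1 0 shift_module 1 1 0 shift_module 1
    by unfold_locales (rule shift_module_irreducible_rank_one)+
  have "V.is_cocycle (in_lam 1) (in_lam 0)" by (rule in_lam_cocycle) simp
  note form = V.cocycle_sum_form[OF this]
  have "\<not> (\<exists>c. 1 = smult c ([:0, 1:] * 1) \<and> 0 = smult c ([:0, 1:] * (0 :: complex poly)))"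
    by (auto dest: arg_cong[of _ _ "\<lambda>q. poly q 0"])
  then have "\<not> trivial_ext shift_module shift_module (twisted_sum shift_module shift_module
      (V.cocycle_map (in_lam 1) (in_lam 0))) (\<lambda>v. (v, 0)) snd"
    unfolding V.trivial_ext_iff[OF form] using in_lam_coboundary_iff[of 1 0 1 0] by simp
  moreover have "extension R shift_module shift_module (twisted_sum shift_module shift_module
      (V.cocycle_map (in_lam 1) (in_lam 0))) (\<lambda>v. (v, 0)) snd"
    using form unfolding ext_of_form_def by blast
  ultimately show ?thesis using shift_module_irreducible_rank_one by blast
qed

end

section \<open>Classification of the extensions\<close>

context rank_one_pair begin

lemma extension_form:
  assumes "extension R V W E \<iota> \<pi>"
  shows "\<exists>f g. ext_form E \<iota> \<pi> f g"
proof -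
  interpret E: rank_one_ext R A B p Q \<phi>A \<phi>B V v \<psi>A \<psi>B W w E \<iota> \<pi>
    using assms by unfold_locales
  show ?thesis by (rule E.form_exists)
qed

lemma nontrivial_extension_classification:
  assumes ext: "extension R V W E \<iota> \<pi>" and nt: "\<not> trivial_ext V W E \<iota> \<pi>"
  shows "\<exists>f g (E' :: ('r, 'v \<times> 'w) cmod) \<iota>' \<pi>'. ext_form E' \<iota>' \<pi>' f g \<and> ext_equiv E \<iota> \<pi> E' \<iota>' \<pi>' \<and>
    listed_data p Q \<phi>A \<phi>B \<psi>A \<psi>B f g"
proof -
  interpret E: rank_one_ext R A B p Q \<phi>A \<phi>B V v \<psi>A \<psi>B W w E \<iota> \<pi>
    using ext by unfold_locales
  obtain f g where form: "ext_form E \<iota> \<pi> f g" using E.form_exists by blast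
  obtain h where "listed_data p Q \<phi>A \<phi>B \<psi>A \<psi>B (f + coboundary \<psi>A \<phi>A h) (g + coboundary \<psi>B \<phi>B h)"
    using nontrivial_cocycle_normal_form[OF E.form_cocycle[OF form]] nt trivial_ext_iff[OF form] by blast
  with form_realization[OF form, of h] show ?thesis by blast
qed

text \<open>
  The decomposition \<open>M = X \<and> \<alpha>\<close> does not refer to a pair of indices, and any pair with nonzero entry can be
  used to normalise \<open>\<alpha>\<close> modulo \<open>X\<close>.
\<close>

lemma data_2_ii_change_indices:
  assumes form: "ext_form E \<iota> \<pi> f (in_lam t)" and d: "data_2_ii i0 j0 p Q \<phi>A \<phi>B \<psi>A \<psi>B f (in_lam t)"
    and ij: "i1 < j1" "M_entry Q t i1 j1 \<noteq> 0"
  shows "\<exists>f' (E' :: ('r, 'v \<times> 'w) cmod) \<iota>' \<pi>'. ext_form E' \<iota>' \<pi>' f' (in_lam t) \<and>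
    ext_equiv E \<iota> \<pi> E' \<iota>' \<pi>' \<and> data_2_ii i1 j1 p Q \<phi>A \<phi>B \<psi>A \<psi>B f' (in_lam t)"
proof -
  have z: "p = 0" "\<phi>B = 0" "\<psi>B = 0" "\<phi>A = \<psi>A" "Q \<noteq> 0" "\<phi>A \<noteq> 0"
    using d unfolding data_2_ii_def by blast+
  obtain t' \<alpha> s where t': "in_lam t = in_lam t'" "t' \<noteq> 0" and f: "f = in_lam \<alpha> * [:[:0, 1:]:] + in_lam s"
    and w: "wedge Q t' ([:0, 1:] * \<phi>A) \<alpha>"
    by (rule wedge_of_data_2_ii[OF Q_skew_eval d])
  have "t' = t" using t'(1) by simp
  with w t'(2) data_2_ii_of_wedge[OF Q_skew_eval _ z(5,6) _ ij] obtain h where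
    "data_2_ii i1 j1 0 Q \<phi>A 0 \<phi>A 0 (f + coboundary \<phi>A \<phi>A h) (in_lam t)" unfolding f by blast
  then have "data_2_ii i1 j1 p Q \<phi>A \<phi>B \<psi>A \<psi>B (f + coboundary \<psi>A \<phi>A h) (in_lam t)" by (simp only: z)
  moreover have "in_lam t + coboundary \<psi>B \<phi>B h = in_lam t" by (simp add: z coboundary_linear)
  ultimately show ?thesis using form_realization[OF form, of h] by metis
qed

lemma listed_data_realization:
  assumes "listed_data p Q \<phi>A \<phi>B \<psi>A \<psi>B f g"
  shows "\<exists>(E :: ('r, 'v \<times> 'w) cmod) \<iota> \<pi>. ext_form E \<iota> \<pi> f g \<and> \<not> trivial_ext V W E \<iota> \<pi>"
    and "ext_form E \<iota> \<pi> f g \<Longrightarrow> \<not> trivial_ext V W E \<iota> \<pi>"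
proof -
  note form = cocycle_sum_form[OF listed_data_nontrivial_cocycle(1)[OF assms]]
  note nt = listed_data_nontrivial_cocycle(2)[OF assms]
  show "\<exists>(E :: ('r, 'v \<times> 'w) cmod) \<iota> \<pi>. ext_form E \<iota> \<pi> f g \<and> \<not> trivial_ext V W E \<iota> \<pi>"
    using form nt trivial_ext_iff[OF form] by blast
  show "ext_form E \<iota> \<pi> f g \<Longrightarrow> \<not> trivial_ext V W E \<iota> \<pi>"
    using nt trivial_ext_iff by blast
qed

end

theorem theorem4p10:
  fixes R :: "('r::ab_group_add, 'r) cmod"
    and A B :: 'r
    and p :: "complex poly"
    and Q :: "complex poly poly"
  assumes R: "solvable_rank_two R A B p Q"
  shows
    "(\<exists>\<phi>A \<phi>B \<psi>A \<psi>B (V :: ('r, complex poly) cmod) v (W :: ('r, complex poly) cmod) w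
        (E :: ('r, complex poly \<times> complex poly) cmod) \<iota> \<pi>.
        irreducible_rank_one R A B p Q \<phi>A \<phi>B V v \<and>
        irreducible_rank_one R A B p Q \<psi>A \<psi>B W w \<and>
        extension R V W E \<iota> \<pi> \<and> \<not> trivial_ext V W E \<iota> \<pi>)
     \<and>
     (\<forall>\<phi>A \<phi>B \<psi>A \<psi>B (V :: ('r, 'v::ab_group_add) cmod) v (W :: ('r, 'w::ab_group_add) cmod) w.
        irreducible_rank_one R A B p Q \<phi>A \<phi>B V v \<and>
        irreducible_rank_one R A B p Q \<psi>A \<psi>B W w \<longrightarrow>
        \<comment> \<open>every extension has the general form\<close>
        (\<forall>(E :: ('r, 'e::ab_group_add) cmod) \<iota> \<pi>. extension R V W E \<iota> \<pi> \<longrightarrow>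
           (\<exists>f g. ext_of_form R A B \<phi>A \<phi>B \<psi>A \<psi>B V v W w E \<iota> \<pi> f g)) \<and>
        \<comment> \<open>every nontrivial extension is equivalent to one with the listed data\<close>
        (\<forall>(E :: ('r, 'e) cmod) \<iota> \<pi>. extension R V W E \<iota> \<pi> \<and> \<not> trivial_ext V W E \<iota> \<pi> \<longrightarrow>
           (\<exists>f g (E' :: ('r, 'v \<times> 'w) cmod) \<iota>' \<pi>'.
              ext_of_form R A B \<phi>A \<phi>B \<psi>A \<psi>B V v W w E' \<iota>' \<pi>' f g \<and>
              ext_equiv E \<iota> \<pi> E' \<iota>' \<pi>' \<and>
              (data_1_i p Q \<phi>A \<phi>B \<psi>A \<psi>B f g \<or>
               data_1_ii p Q \<phi>A \<phi>B \<psi>A \<psi>B f g \<or>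
               data_1_iii p Q \<phi>A \<phi>B \<psi>A \<psi>B f g \<or>
               data_2_i p Q \<phi>A \<phi>B \<psi>A \<psi>B f g \<or>
               (\<exists>i0 j0. data_2_ii i0 j0 p Q \<phi>A \<phi>B \<psi>A \<psi>B f g) \<or>
               data_3_i p Q \<phi>A \<phi>B \<psi>A \<psi>B f g \<or>
               data_3_ii p Q \<phi>A \<phi>B \<psi>A \<psi>B f g))) \<and>
        \<comment> \<open>in the second subcase of the second case, any admissible pair of indices may be used\<close>
        (\<forall>(E :: ('r, 'e) cmod) \<iota> \<pi> f t i0 j0 i1 j1.
           ext_of_form R A B \<phi>A \<phi>B \<psi>A \<psi>B V v W w E \<iota> \<pi> f (in_lam t) \<and>
           data_2_ii i0 j0 p Q \<phi>A \<phi>B \<psi>A \<psi>B f (in_lam t) \<and>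
           i1 < j1 \<and> M_entry Q t i1 j1 \<noteq> 0 \<longrightarrow>
           (\<exists>f' (E' :: ('r, 'v \<times> 'w) cmod) \<iota>' \<pi>'.
              ext_of_form R A B \<phi>A \<phi>B \<psi>A \<psi>B V v W w E' \<iota>' \<pi>' f' (in_lam t) \<and>
              ext_equiv E \<iota> \<pi> E' \<iota>' \<pi>' \<and>
              data_2_ii i1 j1 p Q \<phi>A \<phi>B \<psi>A \<psi>B f' (in_lam t))) \<and>
        \<comment> \<open>conversely, all listed data give nontrivial extensions\<close>
        (\<forall>f g.
           data_1_i p Q \<phi>A \<phi>B \<psi>A \<psi>B f g \<or>
           data_1_ii p Q \<phi>A \<phi>B \<psi>A \<psi>B f g \<or>
           data_1_iii p Q \<phi>A \<phi>B \<psi>A \<psi>B f g \<or>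
           data_2_i p Q \<phi>A \<phi>B \<psi>A \<psi>B f g \<or>
           (\<exists>i0 j0. data_2_ii i0 j0 p Q \<phi>A \<phi>B \<psi>A \<psi>B f g) \<or>
           data_3_i p Q \<phi>A \<phi>B \<psi>A \<psi>B f g \<or>
           data_3_ii p Q \<phi>A \<phi>B \<psi>A \<psi>B f g \<longrightarrow>
           (\<exists>(E :: ('r, 'v \<times> 'w) cmod) \<iota> \<pi>.
              ext_of_form R A B \<phi>A \<phi>B \<psi>A \<psi>B V v W w E \<iota> \<pi> f g \<and>
              \<not> trivial_ext V W E \<iota> \<pi>) \<and>
           (\<forall>(E :: ('r, 'e) cmod) \<iota> \<pi>.
              ext_of_form R A B \<phi>A \<phi>B \<psi>A \<psi>B V v W w E \<iota> \<pi> f g \<longrightarrow>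
              \<not> trivial_ext V W E \<iota> \<pi>)) \<and>
        \<comment> \<open>dimension of the space of extensions in the subcases\<close>
        (\<forall>f g.
           data_1_i p Q \<phi>A \<phi>B \<psi>A \<psi>B f g \<or>
           data_1_ii p Q \<phi>A \<phi>B \<psi>A \<psi>B f g \<or>
           data_1_iii p Q \<phi>A \<phi>B \<psi>A \<psi>B f g \<or>
           data_2_i p Q \<phi>A \<phi>B \<psi>A \<psi>B f g \<or>
           (\<exists>i0 j0. data_2_ii i0 j0 p Q \<phi>A \<phi>B \<psi>A \<psi>B f g) \<or>
           data_3_i p Q \<phi>A \<phi>B \<psi>A \<psi>B f g \<longrightarrow>
           \<not> Ext_finite_dim R W V) \<and>
        (\<forall>f g. data_3_ii p Q \<phi>A \<phi>B \<psi>A \<psi>B f g \<longrightarrow> Ext_finite_dim R W V))"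
proof (intro conjI allI impI, goal_cases)
  interpret rank_two R A B p Q
    using R by unfold_locales
  case 1
  show ?case by (rule nontrivial_extension_exists)
next
  case (2 \<phi>A \<phi>B \<psi>A \<psi>B V v W w E \<iota> \<pi>)
  then interpret rank_one_pair R A B p Q \<phi>A \<phi>B V v \<psi>A \<psi>B W w
    using R by unfold_locales blast+
  from 2 show ?case by (intro extension_form) blast
next
  case (3 \<phi>A \<phi>B \<psi>A \<psi>B V v W w E \<iota> \<pi>)
  then interpret rank_one_pair R A B p Q \<phi>A \<phi>B V v \<psi>A \<psi>B W w
    using R by unfold_locales blast+
  from 3 show ?case by (intro nontrivial_extension_classification) blast+
next
  case (4 \<phi>A \<phi>B \<psi>A \<psi>B V v W w E \<iota> \<pi> f t i0 j0 i1 j1)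
  then interpret rank_one_pair R A B p Q \<phi>A \<phi>B V v \<psi>A \<psi>B W w
    using R by unfold_locales blast+
  from 4 show ?case by (intro data_2_ii_change_indices) blast+
next
  case (5 \<phi>A \<phi>B \<psi>A \<psi>B V v W w f g)
  then interpret rank_one_pair R A B p Q \<phi>A \<phi>B V v \<psi>A \<psi>B W w
    using R by unfold_locales blast+
  from 5(2) show ?case by (rule listed_data_realization(1))
next
  case (6 \<phi>A \<phi>B \<psi>A \<psi>B V v W w f g E \<iota> \<pi>)
  then interpret rank_one_pair R A B p Q \<phi>A \<phi>B V v \<psi>A \<psi>B W w
    using R by unfold_locales blast+
  from 6(2,3) show ?case by (rule listed_data_realization(2))
next
  case (7 \<phi>A \<phi>B \<psi>A \<psi>B V v W w f g)
  then interpret rank_one_pair R A B p Q \<phi>A \<phi>B V v \<psi>A \<psi>B W w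
    using R by unfold_locales blast+
  have "\<phi>A = \<psi>A" "\<phi>B = \<psi>B"
    using 7(2) unfolding data_1_i_def data_1_ii_def data_1_iii_def data_2_i_def data_2_ii_def data_3_i_def
    by (elim disjE exE conjE; simp)+
  then show ?case by (rule Ext_infinite_dim)
next
  case (8 \<phi>A \<phi>B \<psi>A \<psi>B V v W w f g)
  then interpret rank_one_pair R A B p Q \<phi>A \<phi>B V v \<psi>A \<psi>B W w
    using R by unfold_locales blast+
  from 8(2) show ?case by (rule Ext_finite_dim_data_3_ii)
qed

end
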